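(* Let $\Gamma=(V,E)$ be a simplicial graph and $\mathcal{A}$ a unital $C^*$-algebra. For each $v\in V$ let $G_v$ be a discrete group with an action $\alpha_v:G_v\to\mathrm{Aut}(\mathcal{A})$ such that the actions $\{\alpha_v\}_{v\in V}$ commute according to $\Gamma$. Suppose that $\alpha_v$ has the Haagerup property for each $v\in V$ and that the witnessing multipliers commute according to $\Gamma$; that is, for each $v\in V$ there is a sequence $\{h_{v,n}\}_{n\in\mathbb{N}}$ of unital positive definite multipliers with respect to $\alpha_v$ in $C_0(G_v,\mathcal{A})$ converging pointwise to $1_{\mathcal{A}}$, such that for each $n$ the family $\{h_{v,n}\}_{v\in V}$ commutes according to $\Gamma$. Then the graph product action $\bigstar_\Gamma\alpha_v$ of $\bigstar_\Gamma G_v$ on $\mathcal{A}$ has the Haagerup property.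
   Context: All groups (including $\bigstar_\Gamma G_v$) are countable and discrete. $\mathcal{Z}(\mathcal{A})$ is the center of $\mathcal{A}$. A simplicial graph is undirected, without loops, with at most one edge between two vertices. For an action $\alpha:G\to\mathrm{Aut}(\mathcal{A})$, a map $h:G\to\mathcal{Z}(\mathcal{A})$, $s\mapsto h_s$, is a positive definite multiplier if for all $n$ and $x_1,\dots,x_n\in G$ the matrix $[\alpha_{x_j}(h_{x_i^{-1}x_j})]_{i,j}$ is positive in $\mathbb{M}_n(\mathcal{A})$; it is unital if $h_e=1_{\mathcal{A}}$. $C_0(G,\mathcal{A})$ is the set of functions $h:G\to\mathcal{A}$ such that for every $\varepsilon>0$ there is a finite $F\subset G$ with $\|h_s\|<\varepsilon$ for $s\in G\setminus F$. The action $\alpha$ has the Haagerup property if there is a sequence of positive definite multipliers $h_n$ in $C_0(G,\mathcal{A})$ with $\|h_{n,s}-1_{\mathcal{A}}\|\to0$ for every $s\in G$ (pointwise convergence to $1_{\mathcal{A}}$). The graph product $\bigstar_\Gamma G_v$ is the free product of the $G_v$ modulo the relations $[g,h]=1$ for $g\in G_v$, $h\in G_w$, $(v,w)\in E$. The actions commute according to $\Gamma$ if $\alpha_{v,g}\alpha_{w,h}=\alpha_{w,h}\alpha_{v,g}$ whenever $(v,w)\in E$, $g\in G_v$, $h\in G_w$; then $\bigstar_\Gamma\alpha_v:\bigstar_\Gamma G_v\to\mathrm{Aut}(\mathcal{A})$ is the unique homomorphism extending all $\alpha_v$. A family of unital positive definite multipliers $h_v:G_v\to\mathcal{Z}(\mathcal{A})$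 commutes according to $\Gamma$ if whenever $(v,w)\in E$ one has $\alpha_{v,a}(h_{w,b})=h_{w,b}$ and $\alpha_{w,b}(h_{v,a})=h_{v,a}$ for all $a\in G_v$, $b\in G_w$. *)

theory Defs
  imports
    "HOL-Analysis.Analysis"
    "HOL-Algebra.Generated_Groups"
    "HOL-Algebra.Coset"
    "Jordan_Normal_Form.Matrix"
begin

subsection \<open>Unital C*-algebras\<close>

text \<open>
  The class extends \<^class>\<open>monoid_mult\<close> rather than \<^class>\<open>ring_1\<close> or
  \<^class>\<open>real_normed_algebra_1\<close>, which would impose \<open>0 \<noteq> 1\<close> and so exclude the zero algebra.
  Completeness comes from \<^class>\<open>banach\<close> and submultiplicativity of the norm from
  \<^class>\<open>real_normed_algebra\<close>.
\<close>

class unital_cstar_algebra = banach + real_normed_algebra + monoid_mult +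
  fixes scaleC :: "complex \<Rightarrow> 'a \<Rightarrow> 'a" (infixr \<open>*\<^sub>C\<close> 75)
    and star :: "'a \<Rightarrow> 'a"
  assumes scaleC_add_right: "c *\<^sub>C (x + y) = c *\<^sub>C x + c *\<^sub>C y"
    and scaleC_add_left: "(c + d) *\<^sub>C x = c *\<^sub>C x + d *\<^sub>C x"
    and scaleC_scaleC: "c *\<^sub>C d *\<^sub>C x = (c * d) *\<^sub>C x"
    and scaleC_of_real: "complex_of_real r *\<^sub>C x = r *\<^sub>R x"
    and norm_scaleC: "norm (c *\<^sub>C x) = cmod c * norm x"
    and mult_scaleC_left: "(c *\<^sub>C x) * y = c *\<^sub>C (x * y)"
    and mult_scaleC_right: "x * (c *\<^sub>C y) = c *\<^sub>C (x * y)"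
    and star_star: "star (star x) = x"
    and star_add: "star (x + y) = star x + star y"
    and star_scaleC: "star (c *\<^sub>C x) = cnj c *\<^sub>C star x"
    and star_mult: "star (x * y) = star y * star x"
    and cstar_identity: "norm (star x * x) = (norm x)\<^sup>2"

definition algebra_center :: "'a::unital_cstar_algebra set" where
  "algebra_center = {z. \<forall>a. z * a = a * z}"

definition star_automorphisms :: "('a::unital_cstar_algebra \<Rightarrow> 'a) set" where
  "star_automorphisms = {f. bij f
      \<and> (\<forall>x y. f (x + y) = f x + f y)
      \<and> (\<forall>c x. f (c *\<^sub>C x) = c *\<^sub>C f x)
      \<and> (\<forall>x y. f (x * y) = f x * f y)
      \<and> (\<forall>x. f (star x) = star (f x))}"

definition aut_group :: "('a::unital_cstar_algebra \<Rightarrow> 'a) monoid" where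
  "aut_group = \<lparr>carrier = star_automorphisms, mult = (\<circ>), one = id\<rparr>"

text \<open>Positivity in the C*-algebra of \<open>n \<times> n\<close> matrices over the algebra: being of the form
  \<open>B\<^sup>* B\<close> for a matrix \<open>B\<close> of the same size, the adjoint of \<open>B\<close> being the transpose with
  \<^const>\<open>star\<close> applied to every entry.\<close>

definition positive_matrix :: "nat \<Rightarrow> 'a::unital_cstar_algebra mat \<Rightarrow> bool" where
  "positive_matrix n X \<longleftrightarrow>
     (\<exists>B \<in> carrier_mat n n. X = map_mat star (transpose_mat B) * B)"


subsection \<open>Actions, multipliers and the Haagerup property\<close>

definition cstar_action ::
    "('g, 'm) monoid_scheme \<Rightarrow> ('g \<Rightarrow> 'a::unital_cstar_algebra \<Rightarrow> 'a) \<Rightarrow> bool" where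
  "cstar_action G \<alpha> \<longleftrightarrow> group G \<and> \<alpha> \<in> hom G aut_group"

definition positive_definite_multiplier ::
    "('g, 'm) monoid_scheme \<Rightarrow> ('g \<Rightarrow> 'a::unital_cstar_algebra \<Rightarrow> 'a) \<Rightarrow> ('g \<Rightarrow> 'a) \<Rightarrow> bool" where
  "positive_definite_multiplier G \<alpha> h \<longleftrightarrow>
     h \<in> carrier G \<rightarrow> algebra_center \<and>
     (\<forall>n. \<forall>x :: nat \<Rightarrow> 'g. (\<forall>i<n. x i \<in> carrier G) \<longrightarrow>
        positive_matrix n (mat n n (\<lambda>(i, j). \<alpha> (x j) (h (inv\<^bsub>G\<^esub> (x i) \<otimes>\<^bsub>G\<^esub> x j)))))"

definition unital_multiplier ::
    "('g, 'm) monoid_scheme \<Rightarrow> ('g \<Rightarrow> 'a::unital_cstar_algebra) \<Rightarrow> bool" where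
  "unital_multiplier G h \<longleftrightarrow> h \<one>\<^bsub>G\<^esub> = 1"

definition C0 :: "('g, 'm) monoid_scheme \<Rightarrow> ('g \<Rightarrow> 'a::unital_cstar_algebra) set" where
  "C0 G = {h. \<forall>\<epsilon>>0. \<exists>F. finite F \<and> F \<subseteq> carrier G \<and> (\<forall>s \<in> carrier G - F. norm (h s) < \<epsilon>)}"

definition haagerup_witness ::
    "('g, 'm) monoid_scheme \<Rightarrow> ('g \<Rightarrow> 'a::unital_cstar_algebra \<Rightarrow> 'a)
      \<Rightarrow> (nat \<Rightarrow> 'g \<Rightarrow> 'a) \<Rightarrow> bool" where
  "haagerup_witness G \<alpha> h \<longleftrightarrow>
     (\<forall>n. positive_definite_multiplier G \<alpha> (h n) \<and> h n \<in> C0 G) \<and>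
     (\<forall>s \<in> carrier G. (\<lambda>n. norm (h n s - 1)) \<longlonglongrightarrow> 0)"

definition haagerup_property ::
    "('g, 'm) monoid_scheme \<Rightarrow> ('g \<Rightarrow> 'a::unital_cstar_algebra \<Rightarrow> 'a) \<Rightarrow> bool" where
  "haagerup_property G \<alpha> \<longleftrightarrow> cstar_action G \<alpha> \<and> (\<exists>h. haagerup_witness G \<alpha> h)"


subsection \<open>Free products and graph products of groups\<close>

definition simplicial_graph :: "'v set \<Rightarrow> ('v \<times> 'v) set \<Rightarrow> bool" where
  "simplicial_graph V E \<longleftrightarrow> E \<subseteq> V \<times> V \<and> sym E \<and> irrefl E"

definition syllable_words :: "'v set \<Rightarrow> ('v \<Rightarrow> ('g, 'm) monoid_scheme) \<Rightarrow> ('v \<times> 'g) list set" where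
  "syllable_words V G = lists (SIGMA v:V. carrier (G v))"

text \<open>The free product is the set of words in the disjoint union of the groups, modulo deleting
  identity letters and multiplying adjacent letters from the same group.\<close>

inductive_set free_product_rel ::
    "'v set \<Rightarrow> ('v \<Rightarrow> ('g, 'm) monoid_scheme) \<Rightarrow> (('v \<times> 'g) list \<times> ('v \<times> 'g) list) set"
  for V :: "'v set" and G :: "'v \<Rightarrow> ('g, 'm) monoid_scheme" where
  refl: "xs \<in> syllable_words V G \<Longrightarrow> (xs, xs) \<in> free_product_rel V G"
| sym: "(xs, ys) \<in> free_product_rel V G \<Longrightarrow> (ys, xs) \<in> free_product_rel V G"
| trans: "(xs, ys) \<in> free_product_rel V G \<Longrightarrow> (ys, zs) \<in> free_product_rel V G
    \<Longrightarrow> (xs, zs) \<in> free_product_rel V G"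
| one: "xs \<in> syllable_words V G \<Longrightarrow> ys \<in> syllable_words V G \<Longrightarrow> v \<in> V
    \<Longrightarrow> (xs @ [(v, \<one>\<^bsub>G v\<^esub>)] @ ys, xs @ ys) \<in> free_product_rel V G"
| mult: "xs \<in> syllable_words V G \<Longrightarrow> ys \<in> syllable_words V G \<Longrightarrow> v \<in> V
    \<Longrightarrow> g \<in> carrier (G v) \<Longrightarrow> h \<in> carrier (G v)
    \<Longrightarrow> (xs @ [(v, g), (v, h)] @ ys, xs @ [(v, g \<otimes>\<^bsub>G v\<^esub> h)] @ ys) \<in> free_product_rel V G"

definition free_product ::
    "'v set \<Rightarrow> ('v \<Rightarrow> ('g, 'm) monoid_scheme) \<Rightarrow> ('v \<times> 'g) list set monoid" where
  "free_product V G =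
     \<lparr>carrier = syllable_words V G // free_product_rel V G,
      mult = (\<lambda>A B. \<Union>xs \<in> A. \<Union>ys \<in> B. free_product_rel V G `` {xs @ ys}),
      one = free_product_rel V G `` {[]}\<rparr>"

definition free_product_inj ::
    "'v set \<Rightarrow> ('v \<Rightarrow> ('g, 'm) monoid_scheme) \<Rightarrow> 'v \<Rightarrow> 'g \<Rightarrow> ('v \<times> 'g) list set" where
  "free_product_inj V G v g = free_product_rel V G `` {[(v, g)]}"

definition normal_closure :: "('g, 'm) monoid_scheme \<Rightarrow> 'g set \<Rightarrow> 'g set" where
  "normal_closure G S = \<Inter>{N. N \<lhd> G \<and> S \<subseteq> N}"

definition graph_relators ::
    "'v set \<Rightarrow> ('v \<times> 'v) set \<Rightarrow> ('v \<Rightarrow> ('g, 'm) monoid_scheme) \<Rightarrow> ('v \<times> 'g) list set set" where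
  "graph_relators V E G =
     (let F = free_product V G; \<iota> = free_product_inj V G in
      {\<iota> v g \<otimes>\<^bsub>F\<^esub> \<iota> w h \<otimes>\<^bsub>F\<^esub> inv\<^bsub>F\<^esub> (\<iota> v g) \<otimes>\<^bsub>F\<^esub> inv\<^bsub>F\<^esub> (\<iota> w h) | v w g h.
         (v, w) \<in> E \<and> g \<in> carrier (G v) \<and> h \<in> carrier (G w)})"

definition graph_product ::
    "'v set \<Rightarrow> ('v \<times> 'v) set \<Rightarrow> ('v \<Rightarrow> ('g, 'm) monoid_scheme)
      \<Rightarrow> ('v \<times> 'g) list set set monoid" where
  "graph_product V E G =
     free_product V G Mod normal_closure (free_product V G) (graph_relators V E G)"

definition graph_product_inj ::
    "'v set \<Rightarrow> ('v \<times> 'v) set \<Rightarrow> ('v \<Rightarrow> ('g, 'm) monoid_scheme)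
      \<Rightarrow> 'v \<Rightarrow> 'g \<Rightarrow> ('v \<times> 'g) list set set" where
  "graph_product_inj V E G v g =
     normal_closure (free_product V G) (graph_relators V E G)
       #>\<^bsub>free_product V G\<^esub> free_product_inj V G v g"

definition actions_commute ::
    "('v \<times> 'v) set \<Rightarrow> ('v \<Rightarrow> ('g, 'm) monoid_scheme)
      \<Rightarrow> ('v \<Rightarrow> 'g \<Rightarrow> 'a::unital_cstar_algebra \<Rightarrow> 'a) \<Rightarrow> bool" where
  "actions_commute E G \<alpha> \<longleftrightarrow>
     (\<forall>(v, w) \<in> E. \<forall>g \<in> carrier (G v). \<forall>h \<in> carrier (G w). \<alpha> v g \<circ> \<alpha> w h = \<alpha> w h \<circ> \<alpha> v g)"

definition multipliers_commute ::
    "('v \<times> 'v) set \<Rightarrow> ('v \<Rightarrow> ('g, 'm) monoid_scheme)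
      \<Rightarrow> ('v \<Rightarrow> 'g \<Rightarrow> 'a::unital_cstar_algebra \<Rightarrow> 'a) \<Rightarrow> ('v \<Rightarrow> 'g \<Rightarrow> 'a) \<Rightarrow> bool" where
  "multipliers_commute E G \<alpha> h \<longleftrightarrow>
     (\<forall>(v, w) \<in> E. \<forall>a \<in> carrier (G v). \<forall>b \<in> carrier (G w).
        \<alpha> v a (h w b) = h w b \<and> \<alpha> w b (h v a) = h v a)"

text \<open>The unique homomorphism extending all \<open>\<alpha> v\<close>. Homomorphisms are total functions in HOL, so
  uniqueness requires fixing the values outside the carrier by \<^const>\<open>extensional\<close>.\<close>

definition graph_product_action ::
    "'v set \<Rightarrow> ('v \<times> 'v) set \<Rightarrow> ('v \<Rightarrow> ('g, 'm) monoid_scheme)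
      \<Rightarrow> ('v \<Rightarrow> 'g \<Rightarrow> 'a::unital_cstar_algebra \<Rightarrow> 'a)
      \<Rightarrow> ('v \<times> 'g) list set set \<Rightarrow> 'a \<Rightarrow> 'a" where
  "graph_product_action V E G \<alpha> =
     (THE \<phi>. \<phi> \<in> hom (graph_product V E G) aut_group
        \<and> \<phi> \<in> extensional (carrier (graph_product V E G))
        \<and> (\<forall>v \<in> V. \<forall>g \<in> carrier (G v). \<phi> (graph_product_inj V E G v g) = \<alpha> v g))"

end

theory Submission
  imports Defs
begin


text \<open>
  A unital positive definite multiplier \<open>h\<close> for an action \<open>\<alpha>\<close> of a group is the same thing as a positive
  definite kernel \<open>k x y = \<alpha> y (h (x\<inverse> y))\<close> with central values and \<open>k x x = 1\<close> that is invariant: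
  \<open>\<alpha> z (k x y) = k (z x) (z y)\<close>. The proof builds such kernels on the graph product.

  Fix a vertex \<open>v\<close>. The other vertex groups permute the conjugates of the group of \<open>v\<close>, the neighbours
  of \<open>v\<close> fix it elementwise, and the conjugates generate a free product. Following the action on that
  free product, every element of the graph product determines a reduced word whose letters are elements
  of conjugates (\<open>tree_word\<close>). Reduced words form a tree, and transporting the kernel at \<open>v\<close> to every
  conjugate gives a kernel on words: multiply along the path between two words in the tree
  (\<open>word_kernel\<close>). It is positive definite because the remainder after splitting off the column of the
  empty word is a sum of Schur complements of the given kernels, one for each branching point
  (\<open>word_kernel_recursion\<close>, \<open>gram_word_kernel\<close>). That the multipliers commute according to the graph is
  what makes the neighbours of \<open>v\<close> preserve this construction, so that the kernel can be pulled back to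
  an invariant kernel on the graph product.

  The kernels of the different vertices are multiplied. Their values are central, so Schur products are
  positive definite, and only finitely many factors differ from one at any given pair. Along a word of
  minimal length no letters of \<open>v\<close> merge in the tree word (\<open>tree_word_minimal\<close>), hence the multiplier is
  at most the product of the norms of the given multipliers over the letters of that word. If these are
  first damped by factors below one that tend to zero along the vertices, such a product can exceed a
  given positive number for finitely many elements only; letting the damping disappear with \<open>n\<close> gives
  pointwise convergence to one.

  Matrix positivity means being of the form \<open>B\<^sup>* B\<close> with a square matrix \<open>B\<close>, whereas all
  constructions produce rectangular ones. The two agree (\<open>positive_matrix_iff_gram\<close>) because a matrix
  \<open>B\<^sup>* B\<close> has a square root given by a binomial series, whose convergence rests on the order of the
  algebra. The facts on positive elements that this takes are derived from the binomial series for
  square roots of single elements, without spectral theory.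
\<close>

section \<open>Positive elements of a C*-algebra\<close>

lemma star_zero [simp]: "star (0::'a::unital_cstar_algebra) = 0"
  using star_add[of "0::'a" 0] by simp

lemma star_minus [simp]: "star (- x) = - star (x::'a::unital_cstar_algebra)"
  using star_add[of x "- x"] by (simp add: add_eq_0_iff)

lemma star_diff [simp]: "star (x - y) = star x - star (y::'a::unital_cstar_algebra)"
  using star_add[of x "- y"] by simp

lemma star_scaleR [simp]: "star (r *\<^sub>R x) = r *\<^sub>R star (x::'a::unital_cstar_algebra)"
  by (metis scaleC_of_real star_scaleC complex_cnj_complex_of_real)

lemma star_one [simp]: "star (1::'a::unital_cstar_algebra) = 1"
  by (metis mult.right_neutral star_mult star_star mult.left_neutral)

declare star_add [simp] star_mult [simp] star_star [simp]

lemma norm_star [simp]: "norm (star x) = norm (x::'a::unital_cstar_algebra)"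
proof -
  have le: "norm y \<le> norm (star y)" for y :: 'a
  proof (cases "norm y = 0")
    case False
    have "norm y * norm y \<le> norm (star y) * norm y"
      using norm_mult_ineq[of "star y" y] by (simp add: cstar_identity power2_eq_square)
    with False show ?thesis by simp
  qed simp
  from le[of x] le[of "star x"] show ?thesis by simp
qed

lemma bounded_linear_star: "bounded_linear (star :: 'a::unital_cstar_algebra \<Rightarrow> 'a)"
  by (rule bounded_linear_intro[where K = 1]) simp_all

lemma norm_one_le: "norm (1::'a::unital_cstar_algebra) \<le> 1"
proof -
  have "norm (1::'a) = (norm (1::'a))\<^sup>2"
    using cstar_identity[of "1::'a"] by simp
  then show ?thesis by (cases "norm (1::'a) = 0") (simp_all add: power2_eq_square)
qed

lemma norm_power_le_one:
  assumes "norm (y::'a::unital_cstar_algebra) \<le> 1"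
  shows "norm (y ^ k) \<le> 1"
proof (induction k)
  case (Suc k)
  have "norm (y ^ Suc k) \<le> norm y * norm (y ^ k)" by (simp add: norm_mult_ineq)
  also have "\<dots> \<le> 1" using assms Suc by (simp add: mult_le_one)
  finally show ?case .
qed (simp add: norm_one_le)

lemma star_power: "star (x ^ k) = star (x::'a::unital_cstar_algebra) ^ k"
  by (induction k) (simp_all add: power_commutes)

lemma norm_mult_self:
  assumes "star b = (b::'a::unital_cstar_algebra)"
  shows "norm (b * b) = (norm b)\<^sup>2"
  using cstar_identity[of b] assms by simp

text \<open>The Taylor coefficients of the square root of \<open>1 - z\<close>.\<close>

definition root_coeff :: "nat \<Rightarrow> real" where
  "root_coeff k = ((1/2) gchoose k) * (-1) ^ k"

lemma root_coeff_0 [simp]: "root_coeff 0 = 1"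
  by (simp add: root_coeff_def)

lemma signed_gbinomial_Suc:
  "((a::real) gchoose Suc k) * (-1) ^ Suc k = (a gchoose k) * (-1) ^ k * ((real k - a) / (real k + 1))"
proof -
  have "(real k + 1) * (a gchoose Suc k) = (a - real k) * (a gchoose k)"
    unfolding gbinomial_absorb_comp
    using gbinomial_absorption[of k a] by (simp only: of_nat_Suc add.commute)
  then have "(a gchoose Suc k) = (a - real k) / (real k + 1) * (a gchoose k)"
    by (simp add: nonzero_eq_divide_eq mult.commute)
  moreover have "(a - real k) / (real k + 1) = - ((real k - a) / (real k + 1))"
    by (simp add: minus_divide_left)
  ultimately show ?thesis by simp
qed

lemma root_coeff_Suc: "root_coeff (Suc k) = root_coeff k * ((real k - 1/2) / (real k + 1))"
  unfolding root_coeff_def by (rule signed_gbinomial_Suc)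

lemma root_coeff_nonpos: "root_coeff (Suc k) \<le> 0"
proof (induction k)
  case (Suc k)
  then show ?case
    unfolding root_coeff_Suc[of "Suc k"] by (intro mult_nonpos_nonneg) simp_all
qed (simp add: root_coeff_Suc)

lemma root_coeff_tail: "summable (\<lambda>k. \<bar>root_coeff (Suc k)\<bar>)"
    "(\<Sum>k. \<bar>root_coeff (Suc k)\<bar>) \<le> 1"
proof -
  \<comment> \<open>The partial sums of the series at \<open>z = 1\<close> are themselves binomial coefficients up to sign.\<close>
  have nonneg: "0 \<le> ((-(1/2)::real) gchoose n) * (-1) ^ n" for n
  proof (induction n)
    case (Suc n)
    show ?case unfolding signed_gbinomial_Suc by (rule mult_nonneg_nonneg[OF Suc]) simp
  qed simp
  have bound: "(\<Sum>k<n. \<bar>root_coeff (Suc k)\<bar>) \<le> 1" for n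
  proof -
    have "(\<Sum>k\<le>n. root_coeff k) = ((-(1/2)::real) gchoose n) * (-1) ^ n"
      using gbinomial_sum_lower_neg[of "1/2::real" n] by (simp add: root_coeff_def mult.commute)
    moreover have "(\<Sum>k\<le>n. root_coeff k) = 1 + (\<Sum>k<n. root_coeff (Suc k))"
      by (simp add: sum.atMost_shift)
    moreover have "(\<Sum>k<n. \<bar>root_coeff (Suc k)\<bar>) = - (\<Sum>k<n. root_coeff (Suc k))"
      using root_coeff_nonpos by (simp add: sum_negf abs_of_nonpos)
    ultimately show ?thesis using nonneg[of n] by linarith
  qed
  show "summable (\<lambda>k. \<bar>root_coeff (Suc k)\<bar>)"
    by (rule summableI_nonneg_bounded[where x = 1]) (simp_all add: bound)
  then show "(\<Sum>k. \<bar>root_coeff (Suc k)\<bar>) \<le> 1"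
    by (rule suminf_le_const) (rule bound)
qed

lemma root_coeff_summable: "summable (\<lambda>k. \<bar>root_coeff k\<bar>)"
  using root_coeff_tail(1) by (subst (asm) summable_Suc_iff)

text \<open>The coefficients of \<open>1 - z\<close>.\<close>

abbreviation (input) one_minus_coeff :: "nat \<Rightarrow> real" where
  "one_minus_coeff k \<equiv> if k = 0 then 1 else if k = 1 then -1 else 0"

lemma root_coeff_convolution:
  "(\<Sum>i\<le>k. root_coeff i * root_coeff (k - i)) = one_minus_coeff k"
proof -
  have "(\<Sum>i\<le>k. root_coeff i * root_coeff (k - i))
      = (\<Sum>i\<le>k. ((1/2) gchoose i) * ((1/2) gchoose (k - i)) * (-1) ^ k)"
    by (rule sum.cong) (simp_all add: root_coeff_def power_add[symmetric])
  also have "\<dots> = ((1::real) gchoose k) * (-1) ^ k"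
    using gbinomial_Vandermonde[of "1/2::real" "1/2" k]
    by (simp add: sum_distrib_right[symmetric] atLeast0AtMost)
  also have "(1::real) gchoose k = of_nat (1 choose k)"
    by (metis binomial_gbinomial of_nat_1)
  finally show ?thesis
    by (cases "k \<le> 1") (auto simp: le_Suc_eq binomial_eq_0)
qed

lemma root_series_summable:
  assumes "\<And>k. norm (P k :: 'a::unital_cstar_algebra) \<le> 1"
  shows "summable (\<lambda>k. norm (root_coeff k *\<^sub>R P k))"
proof (rule summable_comparison_test'[OF root_coeff_summable])
  show "norm (norm (root_coeff k *\<^sub>R P k)) \<le> \<bar>root_coeff k\<bar>" for k
    using mult_left_mono[OF assms[of k], of "\<bar>root_coeff k\<bar>"] by simp
qed

text \<open>For a self-adjoint contraction the binomial series converges absolutely, even on the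
  boundary of the unit ball. All roots of single elements come from it.\<close>

lemma self_adjoint_root:
  fixes y :: "'a::unital_cstar_algebra"
  assumes sa: "star y = y" and le: "norm y \<le> 1"
  shows "\<exists>s. star s = s \<and> s * s = 1 - y \<and> norm (1 - s) \<le> 1 \<and> (\<forall>z. z * y = y * z \<longrightarrow> z * s = s * z)"
proof -
  let ?f = "\<lambda>k. root_coeff k *\<^sub>R y ^ k"
  define s where "s = (\<Sum>k. ?f k)"
  have sn: "summable (\<lambda>k. norm (?f k))"
    by (rule root_series_summable) (rule norm_power_le_one[OF le])
  then have sf: "summable ?f" by (rule summable_norm_cancel)
  have star: "star s = s"
    unfolding s_def using bounded_linear.suminf[OF bounded_linear_star sf]
    by (simp add: star_power sa)
  have comm: "z * s = s * z" if "z * y = y * z" for z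
  proof -
    have "z * y ^ k = y ^ k * z" for k
    proof (induction k)
      case (Suc k)
      have "z * y ^ Suc k = y * (z * y ^ k)" using that by (simp add: mult.assoc[symmetric])
      then show ?case using Suc by (simp add: mult.assoc)
    qed simp
    then show ?thesis
      unfolding s_def suminf_mult[OF sf, symmetric] suminf_mult2[OF sf] by simp
  qed
  have "(\<lambda>k. \<Sum>i\<le>k. ?f i * ?f (k - i)) sums (s * s)"
    unfolding s_def by (rule Cauchy_product_sums[OF sn sn])
  also have "(\<lambda>k. \<Sum>i\<le>k. ?f i * ?f (k - i))
      = (\<lambda>k. one_minus_coeff k *\<^sub>R y ^ k)"
    unfolding root_coeff_convolution[symmetric]
    by (simp add: scaleR_sum_left power_add[symmetric] mult.commute)
  finally have square: "(\<lambda>k. one_minus_coeff k *\<^sub>R y ^ k) sums (s * s)" .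
  have "(\<lambda>k. one_minus_coeff k *\<^sub>R y ^ k) sums (1 - y)"
    using sums_finite[of "{0, 1}" "\<lambda>k. one_minus_coeff k *\<^sub>R y ^ k"]
    by simp
  with square have root: "s * s = 1 - y" by (rule sums_unique2)
  have sn': "summable (\<lambda>k. norm (?f (Suc k)))"
    using sn by (subst summable_Suc_iff)
  have "s = ?f 0 + (\<Sum>k. ?f (Suc k))"
    unfolding s_def using suminf_split_head[OF sf] by simp
  then have "norm (1 - s) = norm (\<Sum>k. ?f (Suc k))" by (simp add: norm_minus_commute)
  also have "\<dots> \<le> (\<Sum>k. norm (?f (Suc k)))"
    by (rule summable_norm) (rule sn')
  also have "\<dots> \<le> (\<Sum>k. \<bar>root_coeff (Suc k)\<bar>)"
  proof (rule suminf_le)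
    show "norm (?f (Suc k)) \<le> \<bar>root_coeff (Suc k)\<bar>" for k
      using mult_left_mono[OF norm_power_le_one[OF le, of "Suc k"], of "\<bar>root_coeff (Suc k)\<bar>"]
      by simp
  qed (rule sn', rule root_coeff_tail)
  finally have "norm (1 - s) \<le> 1" using root_coeff_tail(2) by simp
  with star root comm show ?thesis by blast
qed

text \<open>Both \<open>b\<close> and \<open>c\<close> are combinations of \<open>u = b + \<i>c\<close> and its adjoint, and
  \<open>star u * u = b\<^sup>2 + c\<^sup>2\<close>.\<close>

lemma norm_sq_le_sum_of_squares:
  fixes b c :: "'a::unital_cstar_algebra"
  assumes b: "star b = b" and c: "star c = c" and bc: "b * c = c * b"
  shows "(norm b)\<^sup>2 \<le> norm (b * b + c * c)"
proof -
  let ?u = "b + \<i> *\<^sub>C c"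
  have m1: "(-1) *\<^sub>C x = - x" for x :: 'a
    using scaleC_of_real[of "-1" x] by simp
  have su: "star ?u = b + (- \<i>) *\<^sub>C c" by (simp add: star_scaleC b c)
  have z: "(- \<i>) *\<^sub>C x = - (\<i> *\<^sub>C x)" for x :: 'a
    using scaleC_add_left[of "- \<i>" \<i> x] scaleC_of_real[of 0 x] by (simp add: eq_neg_iff_add_eq_0)
  have ii: "\<i> *\<^sub>C \<i> *\<^sub>C x = - x" for x :: 'a
    by (simp add: scaleC_scaleC m1)
  have neg: "\<i> *\<^sub>C (- x) = - (\<i> *\<^sub>C x)" for x :: 'a
    using scaleC_scaleC[of \<i> "-1" x] scaleC_scaleC[of "-1" \<i> x] by (simp add: m1)
  have "star ?u * ?u = b * b + c * c"
    unfolding su z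
    by (simp add: distrib_left distrib_right left_diff_distrib mult_scaleC_left mult_scaleC_right
        scaleC_add_right diff_conv_add_uminus neg ii bc del: add_uminus_conv_diff)
  then have u: "(norm ?u)\<^sup>2 = norm (b * b + c * c)"
    by (metis cstar_identity)
  have double: "2 *\<^sub>R b = ?u + star ?u" unfolding su z by (simp add: scaleR_2)
  have "norm (2 *\<^sub>R b) \<le> norm ?u + norm (star ?u)"
    unfolding double by (rule norm_triangle_ineq)
  then have "norm b \<le> norm ?u" unfolding norm_star norm_scaleR by simp
  then have "(norm b)\<^sup>2 \<le> (norm ?u)\<^sup>2" by (simp add: power_mono)
  with u show ?thesis by simp
qed

text \<open>With \<open>w\<close> the root of \<open>1 - a\<^sup>2\<close>, the element \<open>w + \<i>a\<close> is unitary. This bound does the work of the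
  spectral theorem: it says that squares satisfy a criterion for positivity in terms of norms.\<close>

lemma norm_one_minus_square:
  fixes a :: "'a::unital_cstar_algebra"
  assumes sa: "star a = a" and le: "norm a \<le> 1"
  shows "norm (1 - a * a) \<le> 1"
proof -
  have sq: "star (a * a) = a * a" "norm (a * a) \<le> 1"
    using norm_mult_self[OF sa] le by (simp_all add: sa power_le_one)
  obtain w where w: "star w = w" "w * w = 1 - a * a"
    and comm: "\<forall>z. z * (a * a) = a * a * z \<longrightarrow> z * w = w * z"
    using self_adjoint_root[OF sq] by blast
  have "a * w = w * a" using comm by (simp add: mult.assoc)
  then have "(norm w)\<^sup>2 \<le> norm (w * w + a * a)"
    using norm_sq_le_sum_of_squares[of w a] w sa by simp
  then have "(norm w)\<^sup>2 \<le> 1" using w(2) norm_one_le[where 'a='a] by simp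
  then show ?thesis using norm_mult_self[OF w(1)] w(2) by simp
qed

definition cpos :: "'a::unital_cstar_algebra \<Rightarrow> bool" where
  "cpos a \<longleftrightarrow> (\<exists>b. star b = b \<and> a = b * b)"

lemma cpos_self_adjoint: "cpos a \<Longrightarrow> star a = a"
  by (auto simp: cpos_def)

lemma cpos_square: "star b = b \<Longrightarrow> cpos (b * b)"
  by (auto simp: cpos_def)

lemma cpos_zero [simp]: "cpos 0"
  using cpos_square[of 0] by simp

lemma cpos_scaleR: "cpos a \<Longrightarrow> 0 \<le> r \<Longrightarrow> cpos (r *\<^sub>R a)"
  unfolding cpos_def
proof clarify
  fix b assume "star b = b" "0 \<le> r"
  then show "\<exists>b'. star b' = b' \<and> r *\<^sub>R (b * b) = b' * b'"
    by (intro exI[of _ "sqrt r *\<^sub>R b"]) simp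
qed

text \<open>For squares this is the previous bound after scaling. The converse is \<open>norm_criterion_root\<close>. It is not
  clear that a sum of squares is a square, but bounds of the form \<open>norm (t - a) \<le> t\<close> can be added.\<close>

lemma cpos_norm_criterion:
  assumes "cpos a" "norm a \<le> t" "0 < t"
  shows "norm (t *\<^sub>R 1 - a) \<le> t"
proof -
  obtain b where b: "star b = b" "a = b * b" using assms by (auto simp: cpos_def)
  let ?b = "(1 / sqrt t) *\<^sub>R b"
  have "(norm b)\<^sup>2 \<le> t" using norm_mult_self[OF b(1)] b assms by simp
  then have "norm b \<le> sqrt t" by (simp add: real_le_rsqrt)
  then have "norm ?b \<le> 1" using assms by simp
  then have "norm (1 - ?b * ?b) \<le> 1" using b(1) by (intro norm_one_minus_square) simp_all
  moreover have eq: "t *\<^sub>R 1 - a = t *\<^sub>R (1 - ?b * ?b)"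
    using assms b(2) by (simp add: scaleR_diff_right)
  ultimately show ?thesis
    unfolding eq norm_scaleR using assms(3) by (simp add: mult_left_le)
qed

lemma norm_criterion_root:
  fixes a :: "'a::unital_cstar_algebra"
  assumes "star a = a" "norm (t *\<^sub>R 1 - a) \<le> t" "0 < t"
  shows "\<exists>b. star b = b \<and> b * b = a \<and> norm (sqrt t *\<^sub>R 1 - b) \<le> sqrt t
    \<and> (\<forall>z. z * a = a * z \<longrightarrow> z * b = b * z)"
proof -
  let ?y = "1 - (1 / t) *\<^sub>R a"
  have y: "?y = (1 / t) *\<^sub>R (t *\<^sub>R 1 - a)" using assms by (simp add: scaleR_diff_right)
  have sq: "star ?y = ?y" "norm ?y \<le> 1"
    unfolding y norm_scaleR using assms by simp_all
  obtain s where s: "star s = s" "s * s = 1 - ?y" "norm (1 - s) \<le> 1"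
    and comm: "\<forall>z. z * ?y = ?y * z \<longrightarrow> z * s = s * z"
    using self_adjoint_root[OF sq] by blast
  show ?thesis
  proof (intro exI conjI allI impI)
    show "star (sqrt t *\<^sub>R s) = sqrt t *\<^sub>R s" using s by simp
    show "sqrt t *\<^sub>R s * sqrt t *\<^sub>R s = a" using s assms by simp
    show "z * sqrt t *\<^sub>R s = sqrt t *\<^sub>R s * z" if "z * a = a * z" for z
      using comm by (simp add: right_diff_distrib left_diff_distrib that)
    show "norm (sqrt t *\<^sub>R 1 - sqrt t *\<^sub>R s) \<le> sqrt t"
      unfolding scaleR_diff_right[symmetric] norm_scaleR using s(3) assms(3) by (simp add: mult_left_le)
  qed
qed

lemma norm_criterion_cpos:
  "star a = a \<Longrightarrow> norm (t *\<^sub>R 1 - a) \<le> t \<Longrightarrow> 0 < t \<Longrightarrow> cpos (a::'a::unital_cstar_algebra)"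
  unfolding cpos_def using norm_criterion_root by metis

lemma cpos_root:
  assumes "cpos (a::'a::unital_cstar_algebra)"
  shows "\<exists>b. cpos b \<and> b * b = a \<and> (\<forall>z. z * a = a * z \<longrightarrow> z * b = b * z)"
proof -
  let ?t = "norm a + 1"
  have t: "0 < ?t" by (simp add: add_nonneg_pos)
  have crit: "norm (?t *\<^sub>R 1 - a) \<le> ?t" using cpos_norm_criterion[OF assms _ t] by simp
  obtain b where b: "star b = b" "b * b = a" "norm (sqrt ?t *\<^sub>R 1 - b) \<le> sqrt ?t"
    "\<forall>z. z * a = a * z \<longrightarrow> z * b = b * z"
    using norm_criterion_root[OF cpos_self_adjoint[OF assms] crit t] by blast
  have "cpos b" using norm_criterion_cpos[OF b(1,3)] t by simp
  then show ?thesis using b(2,4) by blast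
qed

lemma cpos_add:
  fixes a b :: "'a::unital_cstar_algebra"
  assumes "cpos a" "cpos b"
  shows "cpos (a + b)"
proof (rule norm_criterion_cpos)
  let ?s = "norm a + 1" and ?t = "norm b + 1"
  show "star (a + b) = a + b" using assms by (simp add: cpos_self_adjoint)
  have pos: "0 < ?s" "0 < ?t" by (simp_all add: add_nonneg_pos)
  then show "0 < ?s + ?t" by simp
  have "norm (?s *\<^sub>R 1 - a) \<le> ?s" "norm (?t *\<^sub>R 1 - b) \<le> ?t"
    using cpos_norm_criterion[OF assms(1) _ pos(1)] cpos_norm_criterion[OF assms(2) _ pos(2)]
    by simp_all
  then have "norm ((?s *\<^sub>R 1 - a) + (?t *\<^sub>R 1 - b)) \<le> ?s + ?t"
    by (intro norm_triangle_le add_mono)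
  moreover have "(?s + ?t) *\<^sub>R 1 - (a + b) = (?s *\<^sub>R 1 - a) + (?t *\<^sub>R 1 - b)"
    by (simp only: scaleR_add_left add_diff_add)
  ultimately show "norm ((?s + ?t) *\<^sub>R 1 - (a + b)) \<le> ?s + ?t"
    by (simp only:)
qed

lemma cpos_bound_minus:
  assumes "star y = (y::'a::unital_cstar_algebra)" "norm y \<le> t"
  shows "cpos (t *\<^sub>R 1 - y)"
proof (cases "t = 0")
  case False
  then have "0 < t" using assms norm_ge_zero[of y] by linarith
  then show ?thesis using assms by (intro norm_criterion_cpos[of _ t]) simp_all
qed (use assms in simp)

text \<open>The roots of \<open>x\<close> and \<open>s - x\<close> commute, and the sum of their squares is the scalar \<open>s\<close>.\<close>

lemma norm_le_if_cpos_below: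
  fixes x :: "'a::unital_cstar_algebra"
  assumes "cpos x" "cpos (s *\<^sub>R 1 - x)" "0 \<le> s"
  shows "norm x \<le> s"
proof -
  obtain b where b: "cpos b" "b * b = x" and bcomm: "\<forall>z. z * x = x * z \<longrightarrow> z * b = b * z"
    using cpos_root[OF assms(1)] by blast
  obtain c where c: "cpos c" "c * c = s *\<^sub>R 1 - x"
    and ccomm: "\<forall>z. z * (s *\<^sub>R 1 - x) = (s *\<^sub>R 1 - x) * z \<longrightarrow> z * c = c * z"
    using cpos_root[OF assms(2)] by blast
  have "b * x = x * b" using b by (metis mult.assoc)
  then have "b * c = c * b" by (intro ccomm[rule_format]) (simp add: right_diff_distrib left_diff_distrib)
  then have "(norm b)\<^sup>2 \<le> norm (b * b + c * c)"
    using b c cpos_self_adjoint by (intro norm_sq_le_sum_of_squares) auto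
  also have "b * b + c * c = s *\<^sub>R 1" using b c by simp
  also have "norm (s *\<^sub>R (1::'a)) \<le> s" using assms norm_one_le[where 'a='a] by (simp add: mult_left_le)
  finally show ?thesis using norm_mult_self[OF cpos_self_adjoint[OF b(1)]] b(2) by simp
qed

lemma cpos_antisym:
  fixes x :: "'a::unital_cstar_algebra"
  assumes "cpos x" "cpos (- x)"
  shows "x = 0"
  using norm_le_if_cpos_below[of x 0] assms by simp

lemma norm_power_two_power:
  fixes z :: "'a::unital_cstar_algebra"
  assumes "star z = z"
  shows "norm (z ^ (2 ^ k)) = norm z ^ (2 ^ k)"
proof (induction k)
  case (Suc k)
  have "z ^ (2 ^ Suc k) = z ^ (2 ^ k) * z ^ (2 ^ k)"
    by (simp add: power_add[symmetric] mult_2)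
  moreover have "star (z ^ (2 ^ k)) = z ^ (2 ^ k)" using assms by (simp add: star_power)
  ultimately show ?case
    using Suc norm_mult_self[of "z ^ (2 ^ k)"] by (simp add: power_mult[symmetric] mult.commute)
qed simp

lemma le_one_if_powers_grow_linearly:
  fixes q :: real
  assumes "0 \<le> q" and le: "\<And>k. q ^ (2 ^ k) \<le> 2 ^ k + 1"
  shows "q \<le> 1"
proof (rule ccontr)
  assume "\<not> q \<le> 1"
  define d where "d = q - 1"
  have d: "0 < d" "q = 1 + d" using \<open>\<not> q \<le> 1\<close> by (simp_all add: d_def)
  obtain k :: nat where k: "3 / d\<^sup>2 < 2 ^ k"
    using real_arch_pow[of 2 "3 / d\<^sup>2"] by auto
  let ?M = "2 ^ k :: real"
  have "1 + ?M * d \<le> q ^ (2 ^ k)"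
    using Bernoulli_inequality[of d "2 ^ k"] d by (simp add: mult.commute)
  then have "?M * d \<le> q ^ (2 ^ k)" by simp
  then have "(?M * d)\<^sup>2 \<le> (q ^ (2 ^ k))\<^sup>2" using d by (intro power_mono) auto
  also have "\<dots> = q ^ (2 ^ Suc k)" by (simp add: power_mult[symmetric] mult.commute)
  also have "\<dots> \<le> 2 * ?M + 1" using le[of "Suc k"] by simp
  also have "\<dots> \<le> 3 * ?M" by simp
  finally have "?M * (?M * d\<^sup>2) \<le> ?M * 3" by (simp add: power2_eq_square mult_ac)
  then have "?M * d\<^sup>2 \<le> 3" by (simp add: mult_le_cancel_left)
  moreover have "3 < ?M * d\<^sup>2" using k d by (simp add: field_simps)
  ultimately show False by simp
qed

text \<open>The two products \<open>star c * c\<close> and \<open>c * star c\<close> have the same nonzero spectrum. In terms of norms: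
  a polynomial in the second is a scalar plus \<open>c r (star c)\<close>, where \<open>r\<close> is a polynomial in the
  first, so if \<open>- star c * c\<close> passes the norm criterion for positivity then so does
  \<open>- c * star c\<close>, up to a factor that grows linearly with the degree and disappears on taking roots.
  Since the sum of the two products is positive, \<open>c * star c\<close> is then both positive and negative.\<close>

lemma eq_zero_if_star_mult_negative:
  fixes c :: "'a::unital_cstar_algebra"
  assumes neg: "cpos (- (star c * c))"
  shows "c = 0"
proof (rule ccontr)
  assume "c \<noteq> 0"
  define t where "t = (norm c)\<^sup>2"
  have t: "0 < t" using \<open>c \<noteq> 0\<close> by (simp add: t_def)
  define x where "x = star c * c"
  define z where "z = t *\<^sub>R 1 + c * star c"
  have nx: "norm x = t" by (simp add: x_def t_def cstar_identity)
  have tx: "norm (t *\<^sub>R 1 + x) \<le> t"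
    using cpos_norm_criterion[OF neg, of t] t nx x_def by simp
  define r where "r = rec_nat (0::'a) (\<lambda>n rn. t ^ n *\<^sub>R 1 + rn * (t *\<^sub>R 1 + x))"
  have r: "r 0 = 0" "r (Suc n) = t ^ n *\<^sub>R 1 + r n * (t *\<^sub>R 1 + x)" for n
    by (simp_all add: r_def)
  have zn: "z ^ n = t ^ n *\<^sub>R 1 + c * r n * star c" for n
  proof (induction n)
    case (Suc n)
    have "z ^ Suc n = (t ^ n *\<^sub>R 1 + c * r n * star c) * z"
      by (simp add: Suc[symmetric] power_commutes)
    also have "\<dots> = t ^ Suc n *\<^sub>R 1 + c * r (Suc n) * star c"
      by (simp add: z_def r x_def distrib_left distrib_right mult.assoc mult.commute[of t] scaleR_add_right)
    finally show ?case .
  qed (simp add: r)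
  have rn: "t * norm (r n) \<le> real n * t ^ n" for n
  proof (induction n)
    case (Suc n)
    have "norm (r (Suc n)) \<le> norm (t ^ n *\<^sub>R (1::'a)) + norm (r n * (t *\<^sub>R 1 + x))"
      unfolding r by (rule norm_triangle_ineq)
    also have "\<dots> \<le> t ^ n + norm (r n) * t"
    proof (rule add_mono)
      show "norm (t ^ n *\<^sub>R (1::'a)) \<le> t ^ n"
        using norm_one_le[where 'a='a] t by (simp add: mult_left_le)
      show "norm (r n * (t *\<^sub>R 1 + x)) \<le> norm (r n) * t"
        using norm_mult_ineq[of "r n"] mult_left_mono[OF tx, of "norm (r n)"]
        by (meson norm_ge_zero order_trans)
    qed
    also have "\<dots> \<le> t ^ n + real n * t ^ n" using Suc by (simp add: mult.commute)
    finally have "norm (r (Suc n)) \<le> (real n + 1) * t ^ n" by (simp add: distrib_right)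
    then have "t * norm (r (Suc n)) \<le> t * ((real n + 1) * t ^ n)" using t by simp
    then show ?case by (simp add: mult_ac add_ac)
  qed (simp add: r)
  have bound: "norm (z ^ n) \<le> (real n + 1) * t ^ n" for n
  proof -
    have "norm (z ^ n) \<le> norm (t ^ n *\<^sub>R (1::'a)) + norm (c * r n * star c)"
      unfolding zn by (rule norm_triangle_ineq)
    also have "norm (t ^ n *\<^sub>R (1::'a)) \<le> t ^ n"
      using norm_one_le[where 'a='a] t by (simp add: mult_left_le)
    also have "norm (c * r n * star c) \<le> norm c * norm (r n) * norm c"
      by (metis norm_mult_ineq norm_star mult_right_mono norm_ge_zero order_trans)
    also have "\<dots> = t * norm (r n)" by (simp add: t_def power2_eq_square)
    also have "\<dots> \<le> real n * t ^ n" by (rule rn)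
    finally show ?thesis by (simp add: distrib_right)
  qed
  have sz: "star z = z" by (simp add: z_def)
  have "norm z / t \<le> 1"
  proof (rule le_one_if_powers_grow_linearly)
    show "0 \<le> norm z / t" using t by simp
    show "(norm z / t) ^ (2 ^ k) \<le> 2 ^ k + 1" for k
      using bound[of "2 ^ k"] t unfolding norm_power_two_power[OF sz]
      by (simp add: power_divide field_simps)
  qed
  then have "norm (t *\<^sub>R 1 - (- (c * star c))) \<le> t" using t by (simp add: z_def)
  then have "cpos (- (c * star c))" using t by (intro norm_criterion_cpos[of _ t]) simp_all
  moreover have "cpos (c * star c)"
  proof -
    define u where "u = c + star c"
    define v where "v = \<i> *\<^sub>C (c - star c)"
    have m: "- \<i> *\<^sub>C (y::'a) = - (\<i> *\<^sub>C y)" "(-1) *\<^sub>C y = - y" "\<i> *\<^sub>C (- y) = - (\<i> *\<^sub>C y)" for y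
      using scaleC_of_real[of "-1" "\<i> *\<^sub>C y"] scaleC_of_real[of "-1" y] scaleC_scaleC[of "-1" \<i> y]
        scaleC_scaleC[of \<i> "-1" y]
      by simp_all
    have "star v = v" 
      by (simp add: v_def star_scaleC m(1)) (metis m(3) minus_diff_eq)
    moreover have "star u = u" by (simp add: u_def add.commute)
    ultimately have uv: "cpos (u * u + v * v)" by (simp add: cpos_add cpos_square)
    have "v * v = - ((c - star c) * (c - star c))"
      by (simp add: v_def mult_scaleC_left mult_scaleC_right scaleC_scaleC m)
    then have "u * u + v * v = 2 *\<^sub>R (c * star c) + 2 *\<^sub>R (star c * c)"
      by (simp add: u_def algebra_simps scaleR_2)
    then have "c * star c = (1/2) *\<^sub>R (u * u + v * v) + (- (star c * c))"
      by (simp add: scaleR_add_right[symmetric])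
    then show ?thesis using cpos_add[OF cpos_scaleR[OF uv, of "1/2"] neg] by simp
  qed
  ultimately have "c * star c = 0" by (intro cpos_antisym)
  then have "star (star c) * star c = 0" by simp
  then have "norm (star c) = 0" by (metis cstar_identity norm_zero power_eq_0_iff)
  with \<open>c \<noteq> 0\<close> show False by simp
qed

text \<open>With \<open>a = star x * x\<close>, \<open>m = \<bar>a\<bar>\<close> and \<open>q = m - a\<close>, twice the negative part of \<open>a\<close>, one has
  \<open>a q = - m q\<close>; hence \<open>c = x q\<close> satisfies \<open>star c * c = - q m q\<close>, which is negative, so \<open>c = 0\<close>.
  This forces \<open>q = 0\<close>, that is, \<open>a = m\<close>.\<close>

lemma cpos_star_mult: "cpos (star x * x)" for x :: "'a::unital_cstar_algebra"
proof -
  define a where "a = star x * x"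
  have sa: "star a = a" by (simp add: a_def)
  obtain m where m: "cpos m" "m * m = a * a"
    and mc: "\<forall>z. z * (a * a) = a * a * z \<longrightarrow> z * m = m * z"
    using cpos_root[OF cpos_square[OF sa]] by blast
  have am: "a * m = m * a" by (rule mc[rule_format]) (simp add: mult.assoc)
  obtain n where n: "cpos n" "n * n = m" and nc: "\<forall>z. z * m = m * z \<longrightarrow> z * n = n * z"
    using cpos_root[OF m(1)] by blast
  have sm: "star m = m" and sn: "star n = n" using m n cpos_self_adjoint by auto
  define q where "q = m - a"
  have sq: "star q = q" by (simp add: q_def sm sa)
  have qm: "q * m = m * q" by (simp add: q_def algebra_simps am)
  have qn: "q * n = n * q" by (rule nc[rule_format]) (rule qm)
  have aq: "a * q = - (m * q)" by (simp add: q_def algebra_simps am m(2))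
  define c where "c = x * q"
  have cc: "star c * c = - ((n * q) * (n * q))"
  proof -
    have "star c * c = q * (a * q)" by (simp add: c_def sq a_def mult.assoc)
    also have "\<dots> = - (q * (n * n * q))" by (simp add: aq n(2))
    also have "\<dots> = - ((n * q) * (n * q))" by (metis qn mult.assoc)
    finally show ?thesis .
  qed
  have snq: "star (n * q) = n * q" by (simp add: sn sq qn)
  then have "cpos (- (star c * c))" unfolding cc by (simp add: cpos_square)
  then have "c = 0" by (rule eq_zero_if_star_mult_negative)
  with cc have "(n * q) * (n * q) = 0" by simp
  then have "n * q = 0" using norm_mult_self[OF snq] by simp
  then have mq: "m * q = 0" by (metis n(2) mult.assoc mult_zero_right)
  have "q * q = m * q - a * q" by (simp add: q_def algebra_simps)
  then have "q * q = 0" using mq aq by simp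
  then have "q = 0" using norm_mult_self[OF sq] by simp
  then have "a = m" by (simp add: q_def)
  with m show ?thesis by (simp add: a_def)
qed

lemma cpos_conj: "cpos a \<Longrightarrow> cpos (star x * a * x)" for x :: "'a::unital_cstar_algebra"
proof -
  assume "cpos a"
  then obtain b where "star b = b" "a = b * b" by (auto simp: cpos_def)
  then have "star x * a * x = star (b * x) * (b * x)" by (simp add: mult.assoc)
  then show ?thesis by (simp only: cpos_star_mult)
qed

lemma cpos_mult_bound:
  fixes f x :: "'a::unital_cstar_algebra"
  shows "cpos ((norm f)\<^sup>2 *\<^sub>R (star x * x) - star (f * x) * (f * x))"
proof -
  have "cpos ((norm f)\<^sup>2 *\<^sub>R 1 - star f * f)"
    by (rule cpos_bound_minus) (simp_all add: cstar_identity)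
  from cpos_conj[OF this, of x] show ?thesis
    by (simp add: algebra_simps)
qed

lemma cpos_sum_list: "(\<And>x. x \<in> set xs \<Longrightarrow> cpos x) \<Longrightarrow> cpos (sum_list xs)"
  by (induction xs) (simp_all add: cpos_add)

lemma cpos_sum: "(\<And>i. i \<in> I \<Longrightarrow> cpos (f i)) \<Longrightarrow> cpos (sum f I)"
  by (induction I rule: infinite_finite_induct) (simp_all add: cpos_add)

lemma star_automorphism_simps:
  assumes "f \<in> star_automorphisms"
  shows "f (x + y) = f x + f y" "f (c *\<^sub>C x) = c *\<^sub>C f x" "f (x * y) = f x * f y"
    "f (star x) = star (f x)" "f 1 = 1" "f 0 = 0" "f (x - y) = f x - f y" "f (r *\<^sub>R x) = r *\<^sub>R f x"
    "f (- x) = - f x"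
proof -
  have f: "bij f" "f (x + y) = f x + f y" "f (c *\<^sub>C x) = c *\<^sub>C f x"
    "f (x * y) = f x * f y" "f (star x) = star (f x)" for x y c
    using assms unfolding star_automorphisms_def by blast+
  show "f (x + y) = f x + f y" "f (c *\<^sub>C x) = c *\<^sub>C f x" "f (x * y) = f x * f y"
    "f (star x) = star (f x)"
    by (simp_all only: f)
  obtain e where e: "f e = 1" using bij_is_surj[OF f(1)] by (metis surj_def)
  have "f 1 = f e * f 1" by (simp add: e)
  also have "\<dots> = f (e * 1)" by (rule f(4)[symmetric])
  finally show "f 1 = 1" by (simp add: e)
  show zero: "f 0 = 0" using f(2)[of 0 0] by simp
  have minus: "f (- y) = - f y" for y using f(2)[of y "- y"] zero by (simp add: add_eq_0_iff)
  then show "f (- x) = - f x" .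
  show "f (x - y) = f x - f y" using f(2)[of x "- y"] minus by simp
  show "f (r *\<^sub>R x) = r *\<^sub>R f x" using f(3)[of "of_real r" x] by (simp add: scaleC_of_real)
qed

lemma inv_star_automorphism:
  assumes "f \<in> star_automorphisms"
  shows "inv_into UNIV f \<in> star_automorphisms"
proof -
  have bij: "bij f" using assms by (simp add: star_automorphisms_def)
  then have s: "f (inv_into UNIV f x) = x" and i: "inv_into UNIV f (f x) = x" for x
    by (simp_all add: bij_is_surj surj_f_inv_f bij_is_inj)
  note h = star_automorphism_simps[OF assms]
  let ?g = "inv_into UNIV f"
  have eqI: "?g y = x" if "y = f x" for x y using i[of x] that by simp
  have "bij ?g" by (rule bij_imp_bij_inv[OF bij])
  moreover have "?g (x + y) = ?g x + ?g y" "?g (c *\<^sub>C x) = c *\<^sub>C ?g x" "?g (x * y) = ?g x * ?g y"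
    "?g (star x) = star (?g x)" for x y c
    by (rule eqI, simp add: h s)+
  ultimately show ?thesis by (simp add: star_automorphisms_def)
qed

text \<open>Automorphisms preserve the order, and the order determines the norm.\<close>

lemma star_automorphism_isometric:
  assumes "f \<in> star_automorphisms"
  shows "norm (f x) = norm x"
proof -
  have le: "norm (g x) \<le> norm x" if "g \<in> star_automorphisms" for g and x :: 'a
  proof -
    note h = star_automorphism_simps[OF that]
    have "cpos ((norm x)\<^sup>2 *\<^sub>R 1 - star x * x)"
      by (rule cpos_bound_minus) (simp_all add: cstar_identity)
    then obtain b where b: "star b = b" "(norm x)\<^sup>2 *\<^sub>R 1 - star x * x = b * b"
      by (auto simp: cpos_def)
    have "cpos (g b * g b)" using b h by (metis cpos_square)
    then have "cpos ((norm x)\<^sup>2 *\<^sub>R 1 - star (g x) * g x)"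
      by (metis b(2) h)
    then have "norm (star (g x) * g x) \<le> (norm x)\<^sup>2"
      by (intro norm_le_if_cpos_below) (simp_all add: cpos_star_mult)
    then show ?thesis by (simp add: cstar_identity)
  qed
  have "norm x = norm (inv_into UNIV f (f x))"
    using assms by (simp add: star_automorphisms_def bij_is_inj)
  also have "\<dots> \<le> norm (f x)" by (rule le[OF inv_star_automorphism[OF assms]])
  finally show ?thesis using le[OF assms, of x] by simp
qed

section \<open>Positive definite kernels with values in a C*-algebra\<close>

text \<open>The number of coordinates \<open>fs\<close> is unrelated to the size of the index set, which makes sums, products
  and restrictions of positive definite kernels immediate.\<close>

definition gram :: "'x set \<Rightarrow> ('x \<Rightarrow> 'x \<Rightarrow> 'a::unital_cstar_algebra) \<Rightarrow> bool" where
  "gram S k \<longleftrightarrow> (\<exists>fs. \<forall>x \<in> S. \<forall>y \<in> S. k x y = (\<Sum>f\<leftarrow>fs. star (f x) * f y))"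

lemma gramI: "(\<And>x y. x \<in> S \<Longrightarrow> y \<in> S \<Longrightarrow> k x y = (\<Sum>f\<leftarrow>fs. star (f x) * f y)) \<Longrightarrow> gram S k"
  unfolding gram_def by blast

lemma gram_cong:
  assumes "gram S k" "\<And>x y. x \<in> S \<Longrightarrow> y \<in> S \<Longrightarrow> k x y = l x y"
  shows "gram S l"
  using assms unfolding gram_def by simp

lemma gram_comp:
  assumes "gram S k" "f ` T \<subseteq> S"
  shows "gram T (\<lambda>x y. k (f x) (f y))"
proof -
  obtain fs where fs: "\<forall>x\<in>S. \<forall>y\<in>S. k x y = (\<Sum>g\<leftarrow>fs. star (g x) * g y)"
    using assms(1) unfolding gram_def by blast
  show ?thesis
    by (rule gramI[where fs = "map (\<lambda>g. g \<circ> f) fs"])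
      (use fs assms(2) in \<open>auto simp: o_def image_subset_iff\<close>)
qed

lemma star_sum_list: "star (\<Sum>f\<leftarrow>fs. g f) = (\<Sum>f\<leftarrow>fs. star (g f))"
  by (induction fs) simp_all

lemma star_sum: "star (sum g I) = (\<Sum>i\<in>I. star (g i))"
  by (induction I rule: infinite_finite_induct) simp_all

lemma gram_adjoint:
  assumes "gram S k" "x \<in> S" "y \<in> S"
  shows "star (k x y) = k y x"
proof -
  obtain fs where "\<forall>x\<in>S. \<forall>y\<in>S. k x y = (\<Sum>f\<leftarrow>fs. star (f x) * f y)"
    using assms(1) unfolding gram_def by blast
  then show ?thesis using assms by (simp add: star_sum_list)
qed

lemma gram_add:
  assumes "gram S k" "gram S l"
  shows "gram S (\<lambda>x y. k x y + l x y)"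
proof -
  obtain fs gs where fs: "\<forall>x\<in>S. \<forall>y\<in>S. k x y = (\<Sum>f\<leftarrow>fs. star (f x) * f y)"
    and gs: "\<forall>x\<in>S. \<forall>y\<in>S. l x y = (\<Sum>f\<leftarrow>gs. star (f x) * f y)"
    using assms unfolding gram_def by blast
  show ?thesis by (rule gramI[where fs = "fs @ gs"]) (simp add: fs gs)
qed

lemma gram_zero: "gram S (\<lambda>_ _. 0)"
  by (rule gramI[where fs = "[]"]) simp

lemma gram_sum:
  assumes "\<And>i. i \<in> I \<Longrightarrow> gram S (k i)"
  shows "gram S (\<lambda>x y. \<Sum>i\<in>I. k i x y)"
  using assms
  by (induction I rule: infinite_finite_induct) (simp_all add: gram_zero gram_add)

lemma gram_rank_one: "gram S (\<lambda>x y. star (c x) * c y)"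
  by (rule gramI[where fs = "[c]"]) simp

lemma gram_extend_by_zero:
  assumes "gram {x \<in> S. P x} k"
  shows "gram S (\<lambda>x y. if P x \<and> P y then k x y else 0)"
proof -
  obtain fs where fs: "\<forall>x\<in>{x \<in> S. P x}. \<forall>y\<in>{x \<in> S. P x}. k x y = (\<Sum>f\<leftarrow>fs. star (f x) * f y)"
    using assms(1) unfolding gram_def by blast
  have "(\<Sum>f\<leftarrow>fs. star (if P x then f x else 0) * (if P y then f y else 0))
      = (if P x \<and> P y then k x y else 0)" if "x \<in> S" "y \<in> S" for x y
    using that fs by (cases "P x"; cases "P y") simp_all
  then show ?thesis
    by (intro gramI[where fs = "map (\<lambda>f x. if P x then f x else 0) fs"]) (simp add: o_def)
qed

lemma gram_conj:
  assumes "gram S k"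
  shows "gram S (\<lambda>x y. star (c x) * k x y * c y)"
proof -
  obtain fs where fs: "\<forall>x\<in>S. \<forall>y\<in>S. k x y = (\<Sum>f\<leftarrow>fs. star (f x) * f y)"
    using assms(1) unfolding gram_def by blast
  show ?thesis
    by (rule gramI[where fs = "map (\<lambda>f x. f x * c x) fs"])
      (simp add: fs o_def sum_list_const_mult[symmetric] sum_list_mult_const[symmetric] mult.assoc)
qed

text \<open>Conjugating the coordinates of \<open>l\<close> by those of \<open>k\<close> produces
  \<open>star (f x) * l x y * f y\<close>, which is the product as soon as the values of \<open>l\<close> are central.\<close>

lemma gram_schur_product:
  assumes "gram S k" "gram S l" and central: "\<And>x y. x \<in> S \<Longrightarrow> y \<in> S \<Longrightarrow> l x y \<in> algebra_center"
  shows "gram S (\<lambda>x y. k x y * l x y)"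
proof -
  obtain fs where fs: "\<forall>x\<in>S. \<forall>y\<in>S. k x y = (\<Sum>f\<leftarrow>fs. star (f x) * f y)"
    using assms(1) unfolding gram_def by blast
  have "gram S (\<lambda>x y. \<Sum>f\<leftarrow>fs. star (f x) * l x y * f y)"
    by (induction fs) (simp_all add: gram_zero gram_add gram_conj[OF assms(2)])
  then show ?thesis
  proof (rule gram_cong)
    fix x y assume xy: "x \<in> S" "y \<in> S"
    have "l x y * a = a * l x y" for a using central[OF xy] by (simp add: algebra_center_def)
    then show "(\<Sum>f\<leftarrow>fs. star (f x) * l x y * f y) = k x y * l x y"
      by (simp add: fs xy mult.assoc sum_list_mult_const[symmetric])
  qed
qed

lemma gram_automorphism:
  assumes "gram S k" "\<phi> \<in> star_automorphisms"
  shows "gram S (\<lambda>x y. \<phi> (k x y))"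
proof -
  obtain fs where fs: "\<forall>x\<in>S. \<forall>y\<in>S. k x y = (\<Sum>f\<leftarrow>fs. star (f x) * f y)"
    using assms(1) unfolding gram_def by blast
  note h = star_automorphism_simps[OF assms(2)]
  have "\<phi> (\<Sum>f\<leftarrow>fs. star (f x) * f y) = (\<Sum>f\<leftarrow>fs. star (\<phi> (f x)) * \<phi> (f y))" for x y
    by (induction fs) (simp_all only: h list.map sum_list.Nil sum_list.Cons)
  then show ?thesis
    by (intro gramI[where fs = "map (\<lambda>f. \<phi> \<circ> f) fs"]) (simp add: fs o_def)
qed

lemma gram_scaleR:
  assumes "gram S k" "0 \<le> r"
  shows "gram S (\<lambda>x y. r *\<^sub>R k x y)"
  by (rule gram_cong[OF gram_conj[OF assms(1), of "\<lambda>_. sqrt r *\<^sub>R 1"]]) (use assms in simp)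

lemma gram_identity:
  assumes "finite S"
  shows "gram S (\<lambda>x y. if x = y then 1 else 0)"
proof (rule gram_cong[OF gram_sum[of S]])
  show "gram S (\<lambda>x y. star (if x = a then 1 else 0) * (if y = a then 1 else 0))" for a
    by (rule gram_rank_one)
  show "(\<Sum>a\<in>S. star (if x = a then 1 else 0) * (if y = a then 1 else (0::'b))) = (if x = y then 1 else 0)"
    if "x \<in> S" "y \<in> S" for x y
  proof -
    have "(\<Sum>a\<in>S. star (if x = a then 1 else 0) * (if y = a then 1 else (0::'b)))
        = (\<Sum>a\<in>S. if a = x then (if x = y then 1 else 0) else 0)"
      by (rule sum.cong) auto
    then show ?thesis using assms that by simp
  qed
qed

lemma gram_diagonal_cpos:
  assumes "gram S k" "x \<in> S"
  shows "cpos (k x x)"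
proof -
  obtain fs where "\<forall>x\<in>S. \<forall>y\<in>S. k x y = (\<Sum>f\<leftarrow>fs. star (f x) * f y)"
    using assms(1) unfolding gram_def by blast
  then show ?thesis using assms(2) by (auto intro!: cpos_sum_list cpos_star_mult)
qed

text \<open>Every coordinate loses its component along the unit vector at \<open>z\<close>.\<close>

lemma gram_schur_complement:
  assumes "gram S k" "z \<in> S" "k z z = 1"
  shows "gram S (\<lambda>x y. k x y - k x z * k z y)"
proof -
  obtain fs where fs: "\<forall>x\<in>S. \<forall>y\<in>S. k x y = (\<Sum>f\<leftarrow>fs. star (f x) * f y)"
    using assms(1) unfolding gram_def by blast
  have expand: "(\<Sum>f\<leftarrow>fs. star (f x - f z * c) * (f y - f z * d))
      = (\<Sum>f\<leftarrow>fs. star (f x) * f y) - (\<Sum>f\<leftarrow>fs. star (f x) * f z) * d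
        - star c * (\<Sum>f\<leftarrow>fs. star (f z) * f y) + star c * (\<Sum>f\<leftarrow>fs. star (f z) * f z) * d" for c d x y
    by (induction fs) (simp_all add: algebra_simps)
  show ?thesis
  proof (rule gramI[where fs = "map (\<lambda>f x. f x - f z * k z x) fs"])
    fix x y assume xy: "x \<in> S" "y \<in> S"
    have s: "star (k z x) = k x z" using gram_adjoint[OF assms(1)] xy assms(2) by blast
    have "(\<Sum>f\<leftarrow>fs. star (f x - f z * k z x) * (f y - f z * k z y))
        = k x y - k x z * k z y - k x z * k z y + k x z * k z z * k z y"
      unfolding expand s using fs xy assms(2) by simp
    then show "k x y - k x z * k z y
        = (\<Sum>f\<leftarrow>map (\<lambda>f x. f x - f z * k z x) fs. star (f x) * f y)"
      by (simp add: o_def assms(3))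
  qed
qed

text \<open>The Cauchy--Schwarz inequality, read off from the diagonal of a Schur complement.\<close>

lemma gram_norm_le_one:
  assumes "gram S k" "x \<in> S" "z \<in> S" "k z z = 1" "k x x = 1"
  shows "norm (k z x) \<le> 1"
proof -
  have "cpos (k x x - k x z * k z x)"
    by (rule gram_diagonal_cpos[OF gram_schur_complement]) (use assms in simp_all)
  moreover have "k x z = star (k z x)" using gram_adjoint[OF assms(1)] assms by simp
  ultimately have "cpos (1 *\<^sub>R 1 - star (k z x) * k z x)" using assms(5) by simp
  then have "norm (star (k z x) * k z x) \<le> 1"
    by (intro norm_le_if_cpos_below) (simp_all add: cpos_star_mult)
  then show ?thesis by (simp add: cstar_identity abs_square_le_1)
qed

text \<open>The difference grows by \<open>\<Sum>i. star (x i - x a) * (x i - x a)\<close> when an index \<open>a\<close> is added.\<close>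

lemma cpos_sum_squares_minus_square_sum:
  assumes "finite I"
  shows "cpos (real (card I) *\<^sub>R (\<Sum>i\<in>I. star (x i) * x i) - star (sum x I) * sum x I)"
  using assms
proof (induction I rule: finite_induct)
  case (insert a I)
  let ?Q = "\<Sum>i\<in>I. star (x i) * x i" and ?S = "sum x I"
  have e: "(\<Sum>i\<in>I. star (x i - x a) * (x i - x a))
      = ?Q - star ?S * x a - star (x a) * ?S + real (card I) *\<^sub>R (star (x a) * x a)"
    by (simp add: algebra_simps sum.distrib sum_subtractf sum_distrib_left sum_distrib_right
        star_sum sum_constant_scaleR)
  have "cpos ((real (card I) *\<^sub>R ?Q - star ?S * ?S) + (\<Sum>i\<in>I. star (x i - x a) * (x i - x a)))"
    by (intro cpos_add cpos_sum cpos_star_mult insert.IH)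
  moreover have "(real (card I) *\<^sub>R ?Q - star ?S * ?S) + (\<Sum>i\<in>I. star (x i - x a) * (x i - x a))
     = real (card (insert a I)) *\<^sub>R (\<Sum>i\<in>insert a I. star (x i) * x i)
        - star (sum x (insert a I)) * sum x (insert a I)"
    unfolding e using insert.hyps by (simp add: algebra_simps)
  ultimately show ?case by simp
qed simp

text \<open>This takes the place of an estimate in the norm of the C*-algebra of matrices. The difference of
  the two inner squares is \<open>(2/t) w\<^sup>* X w - (1/t\<^sup>2) (X w)\<^sup>* (X w)\<close>, and the second term is at
  most half the first if \<open>t\<close> is an upper bound for \<open>B B\<^sup>*\<close>, where \<open>X = B\<^sup>* B\<close>.\<close>

lemma matrix_contraction:
  fixes b :: "nat \<Rightarrow> nat \<Rightarrow> 'a::unital_cstar_algebra"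
  assumes X: "\<And>i j. X i j = (\<Sum>l<m. star (b l i) * b l j)"
  shows "\<exists>t>0. \<forall>w. let T = (\<lambda>i. w i - (1/t) *\<^sub>R (\<Sum>j<n. X i j * w j)) in
    cpos ((\<Sum>i<n. star (w i) * w i) - (\<Sum>i<n. star (T i) * T i))"
proof -
  \<comment> \<open>A crude bound for \<open>B B\<^sup>*\<close>, so that \<open>(X w)\<^sup>* (X w) \<le> t w\<^sup>* X w\<close>; the added one makes it positive.\<close>
  define t where "t = real m * (\<Sum>l<m. \<Sum>i<n. (norm (b l i))\<^sup>2) + 1"
  have t: "0 < t" unfolding t_def
    by (intro add_nonneg_pos mult_nonneg_nonneg sum_nonneg) simp_all
  have "let T = (\<lambda>i. w i - (1/t) *\<^sub>R (\<Sum>j<n. X i j * w j)) in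
    cpos ((\<Sum>i<n. star (w i) * w i) - (\<Sum>i<n. star (T i) * T i))" for w
  proof -
    define u where "u l = (\<Sum>j<n. b l j * w j)" for l
    define v where "v i = (\<Sum>j<n. X i j * w j)" for i
    define q where "q = (\<Sum>l<m. star (u l) * u l)"
    define s where "s = (\<Sum>i<n. star (v i) * v i)"
    have v: "v i = (\<Sum>l<m. star (b l i) * u l)" for i
      unfolding v_def u_def X sum_distrib_right sum_distrib_left
      by (subst sum.swap) (simp add: mult.assoc)
    have wv: "(\<Sum>i<n. star (w i) * v i) = q"
    proof -
      have "(\<Sum>i<n. star (w i) * v i) = (\<Sum>l<m. \<Sum>i<n. star (w i) * star (b l i) * u l)"
        unfolding v sum_distrib_left by (subst sum.swap) (simp add: mult.assoc)
      also have "\<dots> = q"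
        unfolding q_def by (rule sum.cong) (simp_all add: u_def star_sum sum_distrib_right)
      finally show ?thesis .
    qed
    have vw: "(\<Sum>i<n. star (v i) * w i) = q"
    proof -
      have "(\<Sum>i<n. star (v i) * w i) = star (\<Sum>i<n. star (w i) * v i)" by (simp add: star_sum)
      also have "\<dots> = q" unfolding wv by (simp add: q_def star_sum)
      finally show ?thesis .
    qed
    have "cpos (t *\<^sub>R q - s)"
    proof -
      let ?c = "\<lambda>l. real m * (\<Sum>i<n. (norm (b l i))\<^sup>2)"
      have c: "?c l \<le> t" if "l < m" for l
      proof -
        have "(\<Sum>i<n. (norm (b l i))\<^sup>2) \<le> (\<Sum>l<m. \<Sum>i<n. (norm (b l i))\<^sup>2)"
          using that by (intro member_le_sum) (auto intro: sum_nonneg)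
        then have "?c l \<le> real m * (\<Sum>l<m. \<Sum>i<n. (norm (b l i))\<^sup>2)" by (rule mult_left_mono) simp
        then show ?thesis by (simp add: t_def)
      qed
      have 1: "cpos (\<Sum>l<m. (t - ?c l) *\<^sub>R (star (u l) * u l))"
        using c by (intro cpos_sum cpos_scaleR cpos_star_mult) simp
      have 2: "cpos (\<Sum>i<n. real m *\<^sub>R (\<Sum>l<m. (norm (b l i))\<^sup>2 *\<^sub>R (star (u l) * u l)
          - star (star (b l i) * u l) * (star (b l i) * u l)))"
      proof (intro cpos_sum cpos_scaleR)
        show "cpos ((norm (b l i))\<^sup>2 *\<^sub>R (star (u l) * u l)
            - star (star (b l i) * u l) * (star (b l i) * u l))" for l i
          using cpos_mult_bound[of "star (b l i)" "u l"] by simp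
      qed simp
      have 3: "cpos (\<Sum>i<n. real m *\<^sub>R (\<Sum>l<m. star (star (b l i) * u l) * (star (b l i) * u l))
          - star (v i) * v i)"
      proof (rule cpos_sum)
        show "cpos (real m *\<^sub>R (\<Sum>l<m. star (star (b l i) * u l) * (star (b l i) * u l))
          - star (v i) * v i)" for i
          using cpos_sum_squares_minus_square_sum[of "{..<m}" "\<lambda>l. star (b l i) * u l"]
          by (simp only: v card_lessThan finite_lessThan)
      qed
      have "(\<Sum>l<m. ?c l *\<^sub>R (star (u l) * u l))
          = (\<Sum>i<n. real m *\<^sub>R (\<Sum>l<m. (norm (b l i))\<^sup>2 *\<^sub>R (star (u l) * u l)))"
        unfolding scaleR_sum_right sum_distrib_left scaleR_sum_left
        by (subst sum.swap) simp
      then have "t *\<^sub>R q - s = (\<Sum>l<m. (t - ?c l) *\<^sub>R (star (u l) * u l))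
        + (\<Sum>i<n. real m *\<^sub>R (\<Sum>l<m. (norm (b l i))\<^sup>2 *\<^sub>R (star (u l) * u l)
          - star (star (b l i) * u l) * (star (b l i) * u l)))
        + (\<Sum>i<n. real m *\<^sub>R (\<Sum>l<m. star (star (b l i) * u l) * (star (b l i) * u l))
          - star (v i) * v i)"
        unfolding q_def s_def
        by (simp only: scaleR_left_diff_distrib sum_subtractf scaleR_diff_right scaleR_sum_right[of t])
          simp
      with cpos_add[OF cpos_add[OF 1 2] 3] show ?thesis by (simp only:)
    qed
    moreover have "cpos q" unfolding q_def by (intro cpos_sum cpos_star_mult)
    ultimately have pos: "cpos ((1/t) *\<^sub>R q + (1/t)\<^sup>2 *\<^sub>R (t *\<^sub>R q - s))"
      using t by (intro cpos_add cpos_scaleR) simp_all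
    have "(1/t)\<^sup>2 * t = 1/t" using t by (simp add: power2_eq_square)
    then have combine: "(1/t) *\<^sub>R q + (1/t)\<^sup>2 *\<^sub>R (t *\<^sub>R q - s) = (1/t) *\<^sub>R q + (1/t) *\<^sub>R q - (1/t)\<^sup>2 *\<^sub>R s"
      by (simp add: scaleR_diff_right)
    have "(\<Sum>i<n. star (w i - (1/t) *\<^sub>R v i) * (w i - (1/t) *\<^sub>R v i))
        = (\<Sum>i<n. star (w i) * w i) - (1/t) *\<^sub>R (\<Sum>i<n. star (w i) * v i)
          - (1/t) *\<^sub>R (\<Sum>i<n. star (v i) * w i) + (1/t)\<^sup>2 *\<^sub>R s"
      unfolding s_def scaleR_sum_right sum_subtractf[symmetric] sum.distrib[symmetric]
      by (rule sum.cong) (simp_all add: algebra_simps power2_eq_square)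
    then have "(\<Sum>i<n. star (w i) * w i) - (\<Sum>i<n. star (w i - (1/t) *\<^sub>R v i) * (w i - (1/t) *\<^sub>R v i))
        = (1/t) *\<^sub>R q + (1/t) *\<^sub>R q - (1/t)\<^sup>2 *\<^sub>R s"
      unfolding vw wv by simp
    with pos combine show ?thesis unfolding v_def Let_def by simp
  qed
  with t show ?thesis by blast
qed

text \<open>The powers of \<open>T = 1 - X / t\<close> have entries of norm at most one, because their columns are obtained
  from unit vectors by repeated contractions. So the binomial series for the square root of
  \<open>1 - T = X / t\<close> converges entrywise. For square matrices, unlike for triangular ones as in a
  Cholesky factorization, this works without invertibility.\<close>

lemma gram_self_adjoint_root:
  fixes b :: "nat \<Rightarrow> nat \<Rightarrow> 'a::unital_cstar_algebra"
  assumes X: "\<And>i j. X i j = (\<Sum>l<m. star (b l i) * b l j)"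
  shows "\<exists>C. \<forall>i<n. \<forall>j<n. star (C i j) = C j i \<and> (\<Sum>l<n. C i l * C l j) = X i j"
proof -
  obtain t where t: "0 < t" and contr:
    "\<forall>w. let T = (\<lambda>i. w i - (1/t) *\<^sub>R (\<Sum>j<n. X i j * w j)) in
      cpos ((\<Sum>i<n. star (w i) * w i) - (\<Sum>i<n. star (T i) * T i))"
    using matrix_contraction[of X, OF X] by blast
  define T where "T i j = (if i = j then 1 else 0) - (1/t) *\<^sub>R X i j" for i j
  define P where "P = rec_nat (\<lambda>i j. if i = j then 1 else 0) (\<lambda>k Pk i j. \<Sum>l<n. T i l * Pk l j)"
  have P0: "P 0 i j = (if i = j then 1 else 0)" and PS: "P (Suc k) i j = (\<Sum>l<n. T i l * P k l j)" for k i j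
    by (simp_all add: P_def)
  have delta: "(\<Sum>l<n. (if i = l then 1 else 0) * z l) = z i" "(\<Sum>l<n. z l * (if l = i then 1 else 0)) = z i"
    if "i < n" for i and z :: "nat \<Rightarrow> 'a"
  proof -
    have "(\<Sum>l<n. (if i = l then 1 else 0) * z l) = (\<Sum>l<n. if l = i then z i else 0)"
      by (rule sum.cong) auto
    also have "\<dots> = z i" using that by simp
    finally show "(\<Sum>l<n. (if i = l then 1 else 0) * z l) = z i" .
    have "(\<Sum>l<n. z l * (if l = i then 1 else 0)) = (\<Sum>l<n. if l = i then z i else 0)"
      by (rule sum.cong) auto
    also have "\<dots> = z i" using that by simp
    finally show "(\<Sum>l<n. z l * (if l = i then 1 else 0)) = z i" .
  qed
  have Tw: "(\<Sum>l<n. T i l * w l) = w i - (1/t) *\<^sub>R (\<Sum>j<n. X i j * w j)" if "i < n" for i w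
    unfolding T_def left_diff_distrib sum_subtractf delta(1)[OF that] by (simp add: scaleR_sum_right)
  have P1: "P (Suc 0) i j = T i j" if "j < n" for i j
    using delta(2)[OF that, of "T i"] by (simp add: PS P0)
  have Padd: "(\<Sum>l<n. P a i l * P c l j) = P (a + c) i j" if "i < n" for a c i j
    using that
  proof (induction a arbitrary: i)
    case 0
    then show ?case by (simp add: P0 delta(1))
  next
    case (Suc a)
    have "(\<Sum>l<n. P (Suc a) i l * P c l j) = (\<Sum>r<n. T i r * (\<Sum>l<n. P a r l * P c l j))"
      unfolding PS sum_distrib_right sum_distrib_left by (subst sum.swap) (simp add: mult.assoc)
    also have "\<dots> = (\<Sum>r<n. T i r * P (a + c) r j)" by (rule sum.cong) (simp_all add: Suc.IH)
    finally show ?case by (simp add: PS)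
  qed
  have Xadj: "star (X i j) = X j i" for i j by (simp add: X star_sum)
  have Padj: "star (P k i j) = P k j i" if "i < n" "j < n" for k i j
    using that
  proof (induction k arbitrary: i j)
    case (Suc k)
    have "star (P (Suc k) i j) = (\<Sum>l<n. P k j l * P (Suc 0) l i)"
      unfolding PS[of k i j] star_sum using Suc by (intro sum.cong) (simp_all add: P1 T_def Xadj)
    also have "\<dots> = P (Suc k) j i" using Padd[OF Suc.prems(2), of k "Suc 0" i] by simp
    finally show ?case .
  qed (simp add: P0)
  have column: "cpos (1 - (\<Sum>i<n. star (P k i j) * P k i j))" if "j < n" for k j
  proof (induction k)
    case 0
    have "(\<Sum>i<n. star (P 0 i j) * P 0 i j) = (\<Sum>i<n. if i = j then 1 else 0)"
      by (rule sum.cong) (auto simp: P0)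
    then show ?case using that by simp
  next
    case (Suc k)
    have "(\<Sum>i<n. star (P (Suc k) i j) * P (Suc k) i j)
      = (\<Sum>i<n. star (P k i j - (1/t) *\<^sub>R (\<Sum>l<n. X i l * P k l j)) * (P k i j - (1/t) *\<^sub>R (\<Sum>l<n. X i l * P k l j)))"
      by (rule sum.cong) (simp_all only: lessThan_iff PS Tw)
    then show ?case
      using cpos_add[OF Suc contr[unfolded Let_def, rule_format, of "\<lambda>i. P k i j"]] by simp
  qed
  have Pnorm: "norm (P k i j) \<le> 1" if "i < n" "j < n" for k i j
  proof -
    let ?s = "\<lambda>i. star (P k i j) * P k i j"
    have "cpos ((1 - sum ?s {..<n}) + sum ?s ({..<n} - {i}))"
      by (intro cpos_add column cpos_sum cpos_star_mult that)
    moreover have "sum ?s {..<n} = ?s i + sum ?s ({..<n} - {i})"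
      using that by (intro sum.remove) simp_all
    ultimately have "cpos (1 *\<^sub>R 1 - ?s i)" by simp
    then have "norm (?s i) \<le> 1"
      by (intro norm_le_if_cpos_below cpos_star_mult) simp_all
    then show ?thesis by (simp add: cstar_identity abs_square_le_1)
  qed
  let ?f = "\<lambda>i j k. root_coeff k *\<^sub>R P k i j"
  have sn: "summable (\<lambda>k. norm (?f i j k))" if "i < n" "j < n" for i j
    by (rule root_series_summable) (rule Pnorm[OF that])
  define S where "S i j = (\<Sum>k. ?f i j k)" for i j
  have Sadj: "star (S i j) = S j i" if "i < n" "j < n" for i j
    unfolding S_def
    using bounded_linear.suminf[OF bounded_linear_star summable_norm_cancel[OF sn[OF that]]]
    by (simp add: Padj that)
  have Ssq: "(\<Sum>l<n. S i l * S l j) = (1/t) *\<^sub>R X i j" if ij: "i < n" "j < n" for i j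
  proof -
    have "(\<lambda>k. \<Sum>l<n. \<Sum>r\<le>k. ?f i l r * ?f l j (k - r)) sums (\<Sum>l<n. S i l * S l j)"
      unfolding S_def using ij by (intro sums_sum Cauchy_product_sums sn) auto
    also have "(\<lambda>k. \<Sum>l<n. \<Sum>r\<le>k. ?f i l r * ?f l j (k - r))
        = (\<lambda>k. one_minus_coeff k *\<^sub>R P k i j)"
    proof
      fix k
      have "(\<Sum>l<n. \<Sum>r\<le>k. ?f i l r * ?f l j (k - r))
          = (\<Sum>r\<le>k. (root_coeff r * root_coeff (k - r)) *\<^sub>R (\<Sum>l<n. P r i l * P (k - r) l j))"
        unfolding scaleR_sum_right by (subst sum.swap) (simp add: mult.commute)
      also have "\<dots> = (\<Sum>r\<le>k. (root_coeff r * root_coeff (k - r)) *\<^sub>R P k i j)"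
        by (rule sum.cong) (simp_all add: Padd ij)
      finally show "(\<Sum>l<n. \<Sum>r\<le>k. ?f i l r * ?f l j (k - r))
          = one_minus_coeff k *\<^sub>R P k i j"
        unfolding root_coeff_convolution[symmetric] scaleR_sum_left .
    qed
    finally have square: "(\<lambda>k. one_minus_coeff k *\<^sub>R P k i j)
        sums (\<Sum>l<n. S i l * S l j)" .
    have "(\<lambda>k. one_minus_coeff k *\<^sub>R P k i j) sums (P 0 i j - P (Suc 0) i j)"
      using sums_finite[of "{0, 1}" "\<lambda>k. one_minus_coeff k *\<^sub>R P k i j"]
      by simp
    with square have "(\<Sum>l<n. S i l * S l j) = P 0 i j - P (Suc 0) i j" by (rule sums_unique2)
    also have "\<dots> = (1/t) *\<^sub>R X i j" unfolding P1[OF ij(2)] by (simp add: P0 T_def)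
    finally show ?thesis .
  qed
  show ?thesis
  proof (intro exI[of _ "\<lambda>i j. sqrt t *\<^sub>R S i j"] allI impI conjI)
    show "star (sqrt t *\<^sub>R S i j) = sqrt t *\<^sub>R S j i" if "i < n" "j < n" for i j
      using Sadj[OF that] by simp
    show "(\<Sum>l<n. sqrt t *\<^sub>R S i l * sqrt t *\<^sub>R S l j) = X i j" if "i < n" "j < n" for i j
      using Ssq[OF that] t by (simp add: scaleR_sum_right[symmetric])
  qed
qed

lemma positive_matrix_iff_gram:
  "positive_matrix n (mat n n (\<lambda>(i, j). k i j)) \<longleftrightarrow> gram {..<n} k"
proof
  assume "positive_matrix n (mat n n (\<lambda>(i, j). k i j))"
  then obtain B where B: "B \<in> carrier_mat n n"
    and eq: "mat n n (\<lambda>(i, j). k i j) = map_mat star (transpose_mat B) * B"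
    unfolding positive_matrix_def by blast
  show "gram {..<n} k"
  proof (rule gramI[where fs = "map (\<lambda>l i. B $$ (l, i)) [0..<n]"])
    fix i j assume ij: "i \<in> {..<n}" "j \<in> {..<n}"
    have "k i j = (map_mat star (transpose_mat B) * B) $$ (i, j)"
      using ij by (simp add: eq[symmetric])
    also have "\<dots> = (\<Sum>l<n. star (B $$ (l, i)) * B $$ (l, j))"
      using ij B by (simp add: scalar_prod_def atLeast0LessThan)
    finally show "k i j = (\<Sum>f\<leftarrow>map (\<lambda>l i. B $$ (l, i)) [0..<n]. star (f i) * f j)"
      by (simp add: o_def interv_sum_list_conv_sum_set_nat atLeast0LessThan)
  qed
next
  assume "gram {..<n} k"
  then obtain fs where fs: "\<forall>i\<in>{..<n}. \<forall>j\<in>{..<n}. k i j = (\<Sum>f\<leftarrow>fs. star (f i) * f j)"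
    unfolding gram_def by blast
  let ?X = "\<lambda>i j. \<Sum>f\<leftarrow>fs. star (f i) * f j"
  have "?X i j = (\<Sum>l<length fs. star ((fs ! l) i) * (fs ! l) j)" for i j
    by (simp add: sum_list_sum_nth atLeast0LessThan)
  from gram_self_adjoint_root[of ?X, OF this, of n]
  obtain C where C: "\<forall>i<n. \<forall>j<n. star (C i j) = C j i \<and> (\<Sum>l<n. C i l * C l j) = ?X i j"
    by blast
  show "positive_matrix n (mat n n (\<lambda>(i, j). k i j))"
    unfolding positive_matrix_def
  proof
    let ?C = "mat n n (\<lambda>(i, j). C i j)"
    show "?C \<in> carrier_mat n n" by simp
    show "mat n n (\<lambda>(i, j). k i j) = map_mat star (transpose_mat ?C) * ?C"
      by (rule eq_matI) (simp_all add: scalar_prod_def fs C atLeast0LessThan)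
  qed
qed

section \<open>Reduced words in a free product of copies of a group\<close>

fun starts_with :: "'i \<Rightarrow> ('i \<times> 'g) list \<Rightarrow> bool" where
  "starts_with i [] = False"
| "starts_with i ((j, g) # w) = (j = i)"

fun reduced_word :: "('g, 'm) monoid_scheme \<Rightarrow> 'i set \<Rightarrow> ('i \<times> 'g) list \<Rightarrow> bool" where
  "reduced_word G I [] = True"
| "reduced_word G I ((i, g) # w) =
    (i \<in> I \<and> g \<in> carrier G \<and> g \<noteq> \<one>\<^bsub>G\<^esub> \<and> \<not> starts_with i w \<and> reduced_word G I w)"

text \<open>For a fixed index \<open>i\<close> every reduced word is \<open>cons_letter G i g t\<close> for exactly one group element \<open>g\<close>,
  possibly the identity, and one word \<open>t\<close> that does not start with \<open>i\<close>. In these coordinates the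
  \<open>i\<close>-th copy of the group multiplies \<open>g\<close> and leaves \<open>t\<close> alone.\<close>

definition head_letter :: "('g, 'm) monoid_scheme \<Rightarrow> 'i \<Rightarrow> ('i \<times> 'g) list \<Rightarrow> 'g" where
  "head_letter G i w = (if starts_with i w then snd (hd w) else \<one>\<^bsub>G\<^esub>)"

definition drop_letter :: "'i \<Rightarrow> ('i \<times> 'g) list \<Rightarrow> ('i \<times> 'g) list" where
  "drop_letter i w = (if starts_with i w then tl w else w)"

definition cons_letter ::
    "('g, 'm) monoid_scheme \<Rightarrow> 'i \<Rightarrow> 'g \<Rightarrow> ('i \<times> 'g) list \<Rightarrow> ('i \<times> 'g) list" where
  "cons_letter G i g t = (if g = \<one>\<^bsub>G\<^esub> then t else (i, g) # t)"

definition left_mult ::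
    "('g, 'm) monoid_scheme \<Rightarrow> 'i \<Rightarrow> 'g \<Rightarrow> ('i \<times> 'g) list \<Rightarrow> ('i \<times> 'g) list" where
  "left_mult G i z w = cons_letter G i (z \<otimes>\<^bsub>G\<^esub> head_letter G i w) (drop_letter i w)"

lemma starts_with_Cons: "starts_with i w \<longleftrightarrow> (\<exists>g t. w = (i, g) # t)"
  by (cases "(i, w)" rule: starts_with.cases) auto

lemma cons_head_drop: "reduced_word G I w \<Longrightarrow> cons_letter G i (head_letter G i w) (drop_letter i w) = w"
  by (auto simp: cons_letter_def head_letter_def drop_letter_def starts_with_Cons)

lemma head_drop_closed:
  assumes "reduced_word G I w" "monoid G"
  shows "head_letter G i w \<in> carrier G" "reduced_word G I (drop_letter i w)"
    "\<not> starts_with i (drop_letter i w)"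
  using assms by (auto simp: head_letter_def drop_letter_def starts_with_Cons monoid.one_closed)

lemma head_drop_cons:
  assumes "\<not> starts_with i t"
  shows "head_letter G i (cons_letter G i g t) = g" "drop_letter i (cons_letter G i g t) = t"
  using assms by (auto simp: head_letter_def drop_letter_def cons_letter_def)

lemma reduced_cons_letter:
  "\<lbrakk>reduced_word G I t; \<not> starts_with i t; i \<in> I; g \<in> carrier G\<rbrakk> \<Longrightarrow> reduced_word G I (cons_letter G i g t)"
  by (simp add: cons_letter_def)

lemma reduced_left_mult:
  assumes "group G" "reduced_word G I w" "i \<in> I" "z \<in> carrier G"
  shows "reduced_word G I (left_mult G i z w)"
  using assms head_drop_closed[OF assms(2) group.is_monoid[OF assms(1)]]
  by (simp add: left_mult_def reduced_cons_letter group.is_monoid monoid.m_closed)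

lemma left_mult_one:
  assumes "group G" "reduced_word G I w"
  shows "left_mult G i \<one>\<^bsub>G\<^esub> w = w"
  using assms head_drop_closed[OF assms(2) group.is_monoid[OF assms(1)]]
  by (simp add: left_mult_def cons_head_drop group.is_monoid monoid.l_one)

lemma left_mult_mult:
  assumes "group G" "reduced_word G I w" "y \<in> carrier G" "z \<in> carrier G"
  shows "left_mult G i (y \<otimes>\<^bsub>G\<^esub> z) w = left_mult G i y (left_mult G i z w)"
proof -
  have m: "monoid G" using assms(1) by (simp add: group.is_monoid)
  note hd = head_drop_closed[OF assms(2) m, of i]
  show ?thesis
    unfolding left_mult_def head_drop_cons[OF hd(3)]
    using assms hd m by (simp add: monoid.m_assoc)
qed

lemma map_apfst_left_mult:
  assumes "inj_on \<sigma> I" "reduced_word G I w" "i \<in> I" "\<sigma> i = i"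
  shows "map (apfst \<sigma>) (left_mult G i z w) = left_mult G i z (map (apfst \<sigma>) w)"
proof -
  have "starts_with i (map (apfst \<sigma>) w) = starts_with i w"
  proof (cases w)
    case (Cons l t)
    obtain j g where "l = (j, g)" by (cases l)
    with Cons assms show ?thesis by (auto dest: inj_onD)
  qed simp
  then show ?thesis
    using assms(4)
    by (auto simp: left_mult_def cons_letter_def head_letter_def drop_letter_def starts_with_Cons)
qed

lemma reduced_map_apfst:
  assumes "inj_on \<sigma> I" "\<sigma> ` I \<subseteq> I" "reduced_word G I w"
  shows "reduced_word G I (map (apfst \<sigma>) w)"
  using assms(3)
proof (induction w)
  case (Cons l t)
  obtain i g where l: "l = (i, g)" by (cases l)
  have "\<not> starts_with (\<sigma> i) (map (apfst \<sigma>) t)"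
  proof (cases t)
    case Cons': (Cons m s)
    obtain j h where "m = (j, h)" by (cases m)
    with Cons' Cons.prems l assms(1) show ?thesis by (auto dest: inj_onD)
  qed simp
  with Cons l assms(2) show ?case by (auto simp: image_subset_iff)
qed simp


section \<open>Free products of positive definite kernels\<close>

lemma centerD: "z \<in> algebra_center \<Longrightarrow> z * x = x * z"
  by (simp add: algebra_center_def)

lemma center_closed:
  "1 \<in> algebra_center" "a \<in> algebra_center \<Longrightarrow> b \<in> algebra_center \<Longrightarrow> a * b \<in> algebra_center"
  "a \<in> algebra_center \<Longrightarrow> star a \<in> algebra_center"
proof -
  show "1 \<in> algebra_center" by (simp add: algebra_center_def)
  show "a * b \<in> algebra_center" if "a \<in> algebra_center" "b \<in> algebra_center"
  proof -
    have "a * b * x = x * (a * b)" for x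
    proof -
      have "a * b * x = a * (x * b)" using centerD[OF that(2), of x] by (simp add: mult.assoc)
      also have "\<dots> = x * a * b" using centerD[OF that(1), of x] by (simp add: mult.assoc[symmetric])
      finally show ?thesis by (simp add: mult.assoc)
    qed
    then show ?thesis by (simp add: algebra_center_def)
  qed
  show "star a \<in> algebra_center" if "a \<in> algebra_center"
  proof -
    have "star a * x = x * star a" for x
    proof -
      have "star (star x * a) = star (a * star x)" using centerD[OF that, of "star x"] by simp
      then show ?thesis by simp
    qed
    then show ?thesis by (simp add: algebra_center_def)
  qed
qed

lemma center_automorphism:
  assumes "\<phi> \<in> star_automorphisms" "a \<in> algebra_center"
  shows "\<phi> a \<in> algebra_center"
proof -
  have "\<phi> a * x = x * \<phi> a" for x
  proof -
    have "surj \<phi>" using assms(1) by (simp add: star_automorphisms_def bij_is_surj)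
    then obtain y where y: "x = \<phi> y" by (rule surjE)
    have "\<phi> (a * y) = \<phi> (y * a)" using centerD[OF assms(2), of y] by simp
    then show ?thesis unfolding y star_automorphism_simps(3)[OF assms(1)] .
  qed
  then show ?thesis by (simp add: algebra_center_def)
qed

text \<open>For every index \<open>i\<close> the group acts by \<open>\<beta> i\<close> and carries an invariant central positive definite
  kernel \<open>\<kappa> i\<close>. The resulting kernel on reduced words is the Markov product along the tree of words:
  a common prefix acts by automorphisms, and after the branching point the kernel factors through the
  shared vertex. Here \<open>tau w\<close> is its value between the empty word and \<open>w\<close>.\<close>

locale kernel_family =
  fixes G :: "('g, 'm) monoid_scheme" (structure) and I :: "'i set"
    and \<beta> :: "'i \<Rightarrow> 'g \<Rightarrow> 'a::unital_cstar_algebra \<Rightarrow> 'a"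
    and \<kappa> :: "'i \<Rightarrow> 'g \<Rightarrow> 'g \<Rightarrow> 'a"
  assumes group: "group G"
    and aut: "\<lbrakk>i \<in> I; g \<in> carrier G\<rbrakk> \<Longrightarrow> \<beta> i g \<in> star_automorphisms"
    and action: "\<lbrakk>i \<in> I; g \<in> carrier G; h \<in> carrier G\<rbrakk> \<Longrightarrow> \<beta> i (g \<otimes> h) x = \<beta> i g (\<beta> i h x)"
    and kernel_gram: "\<lbrakk>i \<in> I; finite S; S \<subseteq> carrier G\<rbrakk> \<Longrightarrow> gram S (\<kappa> i)"
    and kernel_unit: "\<lbrakk>i \<in> I; g \<in> carrier G\<rbrakk> \<Longrightarrow> \<kappa> i g g = 1"
    and kernel_central: "\<lbrakk>i \<in> I; g \<in> carrier G; h \<in> carrier G\<rbrakk> \<Longrightarrow> \<kappa> i g h \<in> algebra_center"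
    and kernel_invariant: "\<lbrakk>i \<in> I; z \<in> carrier G; g \<in> carrier G; h \<in> carrier G\<rbrakk>
      \<Longrightarrow> \<beta> i z (\<kappa> i g h) = \<kappa> i (z \<otimes> g) (z \<otimes> h)"
begin

lemma one_closed: "\<one> \<in> carrier G"
  using group by (simp add: group.is_monoid monoid.one_closed)

lemma action_one:
  assumes "i \<in> I"
  shows "\<beta> i \<one> x = x"
proof -
  have "\<beta> i \<one> (\<beta> i \<one> x) = \<beta> i \<one> x"
    using action[OF assms one_closed one_closed] group
    by (simp add: group.is_monoid monoid.l_one one_closed)
  moreover have "inj (\<beta> i \<one>)"
    using aut[OF assms one_closed] by (simp add: star_automorphisms_def bij_is_inj)
  ultimately show ?thesis by (simp add: inj_eq)
qed

lemma kernel_adjoint: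
  assumes "i \<in> I" "g \<in> carrier G" "h \<in> carrier G"
  shows "star (\<kappa> i g h) = \<kappa> i h g"
  using gram_adjoint[OF kernel_gram, of i "{g, h}" g h] assms by simp

fun tau :: "('i \<times> 'g) list \<Rightarrow> 'a" where
  "tau [] = 1"
| "tau ((i, g) # w) = \<kappa> i \<one> g * \<beta> i g (tau w)"

fun word_kernel :: "('i \<times> 'g) list \<Rightarrow> ('i \<times> 'g) list \<Rightarrow> 'a" where
  "word_kernel [] w = tau w"
| "word_kernel (l # u) [] = star (tau (l # u))"
| "word_kernel ((i, g) # u) ((j, h) # w) =
    (if i = j
     then if g = h then \<beta> i g (word_kernel u w) else star (\<beta> i g (tau u)) * \<kappa> i g h * \<beta> i h (tau w)
     else star (tau ((i, g) # u)) * tau ((j, h) # w))"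

lemma tau_central: "reduced_word G I w \<Longrightarrow> tau w \<in> algebra_center"
  by (induction w rule: tau.induct)
    (auto intro!: center_closed center_automorphism[OF aut] kernel_central one_closed)

lemma word_kernel_central:
  "reduced_word G I u \<Longrightarrow> reduced_word G I w \<Longrightarrow> word_kernel u w \<in> algebra_center"
proof (induction u w rule: word_kernel.induct)
  case (3 i g u j h w)
  then show ?case
    using tau_central[of "(i, g) # u"] tau_central[of "(j, h) # w"] tau_central[of u] tau_central[of w]
    by (auto intro!: center_closed center_automorphism[OF aut] kernel_central one_closed simp del: tau.simps)
qed (auto simp: tau_central center_closed(3) simp del: tau.simps)

lemma word_kernel_no_common_index:
  assumes "\<not> starts_with i u" "w = (i, h) # t"
  shows "word_kernel u w = star (tau u) * tau w" "word_kernel w u = star (tau w) * tau u"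
  using assms
  by (cases u; auto simp del: tau.simps simp: tau.simps(1))+

lemma word_kernel_cons_letter:
  assumes "i \<in> I" "g \<in> carrier G" "h \<in> carrier G" "\<not> starts_with i u" "\<not> starts_with i w"
  shows "word_kernel (cons_letter G i g u) (cons_letter G i h w) =
    (if g = h then \<beta> i g (word_kernel u w) else star (\<beta> i g (tau u)) * \<kappa> i g h * \<beta> i h (tau w))"
proof -
  consider "g = \<one>" "h = \<one>" | "g \<noteq> \<one>" "h \<noteq> \<one>"
    | "g = \<one>" "h \<noteq> \<one>" | "g \<noteq> \<one>" "h = \<one>" by blast
  then show ?thesis
  proof cases
    case 3
    have "word_kernel u ((i, h) # w) = star (tau u) * tau ((i, h) # w)"
      by (rule word_kernel_no_common_index(1)[OF assms(4) HOL.refl])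
    with 3 assms show ?thesis by (simp add: cons_letter_def action_one mult.assoc)
  next
    case 4
    have "word_kernel ((i, g) # u) w = star (tau ((i, g) # u)) * tau w"
      by (rule word_kernel_no_common_index(2)[OF assms(5) HOL.refl])
    with 4 assms show ?thesis
      by (simp add: cons_letter_def action_one kernel_adjoint one_closed)
  qed (use assms in \<open>simp_all add: cons_letter_def action_one\<close>)
qed

text \<open>Both words are written in the coordinates of \<open>i\<close>. There the formula of the previous lemma depends
  on \<open>g\<close> and \<open>h\<close> only through their equality, the action and the invariant kernel at \<open>i\<close>.\<close>

lemma word_kernel_left_mult:
  assumes "i \<in> I" "z \<in> carrier G" "reduced_word G I u" "reduced_word G I w"
  shows "word_kernel (left_mult G i z u) (left_mult G i z w) = \<beta> i z (word_kernel u w)"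
proof -
  have m: "monoid G" using group by (simp add: group.is_monoid)
  note u = head_drop_closed[OF assms(3) m, of i] and w = head_drop_closed[OF assms(4) m, of i]
  define g u' h w' where "g = head_letter G i u" "u' = drop_letter i u"
    "h = head_letter G i w" "w' = drop_letter i w"
  note defs = this
  have gh: "g \<in> carrier G" "h \<in> carrier G" "\<not> starts_with i u'" "\<not> starts_with i w'"
    using u w by (simp_all add: defs)
  have uw: "u = cons_letter G i g u'" "w = cons_letter G i h w'"
    using cons_head_drop assms by (metis defs)+
  note a = star_automorphism_simps[OF aut[OF assms(1,2)]]
  have zgh: "z \<otimes> g = z \<otimes> h \<longleftrightarrow> g = h"
    using m gh assms(2) group by (simp add: monoid.Units_l_cancel group.Units_eq)
  have zc: "z \<otimes> g \<in> carrier G" "z \<otimes> h \<in> carrier G"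
    using m gh assms(2) by (simp_all add: monoid.m_closed)
  have "word_kernel (left_mult G i z u) (left_mult G i z w)
    = word_kernel (cons_letter G i (z \<otimes> g) u') (cons_letter G i (z \<otimes> h) w')"
    by (simp add: left_mult_def defs)
  also have "\<dots> = \<beta> i z (word_kernel (cons_letter G i g u') (cons_letter G i h w'))"
    unfolding word_kernel_cons_letter[OF assms(1) zc gh(3,4)] word_kernel_cons_letter[OF assms(1) gh] zgh
    by (simp add: a action kernel_invariant assms gh)
  finally show ?thesis by (simp add: uw)
qed

lemma tau_map:
  assumes \<phi>: "\<phi> \<in> star_automorphisms"
    and \<beta>: "\<And>i g x. i \<in> I \<Longrightarrow> g \<in> carrier G \<Longrightarrow> \<beta> (\<sigma> i) g (\<phi> x) = \<phi> (\<beta> i g x)"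
    and \<kappa>: "\<And>i g h. i \<in> I \<Longrightarrow> g \<in> carrier G \<Longrightarrow> h \<in> carrier G \<Longrightarrow> \<kappa> (\<sigma> i) g h = \<phi> (\<kappa> i g h)"
    and "reduced_word G I w"
  shows "tau (map (apfst \<sigma>) w) = \<phi> (tau w)"
  using assms(4)
  by (induction w rule: tau.induct)
    (simp_all add: star_automorphism_simps[OF \<phi>] \<beta> \<kappa> one_closed)

lemma word_kernel_map:
  assumes \<phi>: "\<phi> \<in> star_automorphisms"
    and \<beta>: "\<And>i g x. i \<in> I \<Longrightarrow> g \<in> carrier G \<Longrightarrow> \<beta> (\<sigma> i) g (\<phi> x) = \<phi> (\<beta> i g x)"
    and \<kappa>: "\<And>i g h. i \<in> I \<Longrightarrow> g \<in> carrier G \<Longrightarrow> h \<in> carrier G \<Longrightarrow> \<kappa> (\<sigma> i) g h = \<phi> (\<kappa> i g h)"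
    and inj: "inj_on \<sigma> I"
    and "reduced_word G I u" "reduced_word G I w"
  shows "word_kernel (map (apfst \<sigma>) u) (map (apfst \<sigma>) w) = \<phi> (word_kernel u w)"
  using assms(5,6)
proof (induction u w rule: word_kernel.induct)
  case (1 w)
  then show ?case using tau_map[OF \<phi> \<beta> \<kappa>] by simp
next
  case (2 l u)
  then show ?case
    using tau_map[OF \<phi> \<beta> \<kappa>, of "l # u"] by (simp add: star_automorphism_simps[OF \<phi>])
next
  case (3 i g u j h w)
  have t: "tau (map (apfst \<sigma>) x) = \<phi> (tau x)" if "reduced_word G I x" for x
    using tau_map[OF \<phi> \<beta> \<kappa> that] by simp
  have ij: "\<sigma> i = \<sigma> j \<longleftrightarrow> i = j" using 3 inj by (auto dest: inj_onD)
  show ?case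
  proof (cases "i = j")
    case True
    with 3 t[of u] t[of w] show ?thesis
      by (simp add: \<beta> \<kappa> star_automorphism_simps[OF \<phi>])
  next
    case False
    with 3 ij t[of "(i, g) # u"] t[of "(j, h) # w"] show ?thesis
      by (simp add: star_automorphism_simps[OF \<phi>] del: tau.simps)
  qed
qed

text \<open>Words with different first indices only meet at the empty word, so the rank one kernel of its column
  accounts for them. If the first letters agree, it accounts for the part \<open>\<kappa> i g \<one> * \<kappa> i \<one> g\<close> of
  \<open>\<kappa> i g g = 1\<close>; the Schur complement of \<open>\<kappa> i\<close> supplies the rest of the rank one term of the remaining
  words. Every summand on the right is positive definite as a kernel if the difference for shorter
  words is, and this gives positivity by induction.\<close>

lemma word_kernel_recursion:
  assumes u: "reduced_word G I ((i, g) # u)" and w: "reduced_word G I ((j, h) # w)"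
  shows "word_kernel ((i, g) # u) ((j, h) # w) - star (tau ((i, g) # u)) * tau ((j, h) # w) =
    (if i = j then star (\<beta> i g (tau u)) * (\<kappa> i g h - \<kappa> i g \<one> * \<kappa> i \<one> h) * \<beta> j h (tau w) else 0)
    + (if (i, g) = (j, h) then \<beta> i g (word_kernel u w - star (tau u) * tau w) else 0)"
proof (cases "i = j")
  case True
  have i: "i \<in> I" "g \<in> carrier G" "h \<in> carrier G" using u w by simp_all
  have t: "star (tau ((i, g) # u)) * tau ((j, h) # w)
      = star (\<beta> i g (tau u)) * (\<kappa> i g \<one> * \<kappa> i \<one> h) * \<beta> j h (tau w)"
    using True i by (simp add: kernel_adjoint one_closed mult.assoc)
  show ?thesis
    unfolding t using True i
    by (simp add: star_automorphism_simps[OF aut] kernel_unit right_diff_distrib left_diff_distrib)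
qed simp

lemma gram_word_kernel_minus_rank_one:
  assumes "finite S" "\<forall>w\<in>S. reduced_word G I w \<and> length w \<le> n"
  shows "gram S (\<lambda>u w. word_kernel u w - star (tau u) * tau w)"
  using assms
proof (induction n arbitrary: S)
  case 0
  then have "S \<subseteq> {[]}" by auto
  then show ?case by (intro gram_cong[OF gram_zero]) (auto dest!: subsetD)
next
  case (Suc n)
  define L where "L = hd ` (S - {[]})"
  have fin: "finite L" using Suc.prems by (simp add: L_def)
  define first where "first i u = \<beta> i (snd (hd u)) (tau (tl u))" for i u
  define A where "A i u w = (if starts_with i u \<and> starts_with i w
      then star (first i u) * (\<kappa> i (snd (hd u)) (snd (hd w))
        - \<kappa> i (snd (hd u)) \<one> * \<kappa> i \<one> (snd (hd w))) * first i w
      else 0)" for i u w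
  define B where "B l u w = (if (u \<noteq> [] \<and> hd u = l) \<and> (w \<noteq> [] \<and> hd w = l)
      then \<beta> (fst l) (snd l) (word_kernel (tl u) (tl w) - star (tau (tl u)) * tau (tl w)) else 0)" for l u w
  have A: "gram S (A i)" if first_index: "i \<in> fst ` L" for i
  proof -
    have i: "i \<in> I"
    proof -
      obtain l where "l \<in> L" "fst l = i" using first_index by blast
      then obtain w where "w \<in> S" "w \<noteq> []" "fst (hd w) = i" unfolding L_def by blast
      then show ?thesis using Suc.prems(2) by (cases w) auto
    qed
    let ?T = "{u \<in> S. starts_with i u}"
    have T: "snd (hd u) \<in> carrier G" if "u \<in> ?T" for u
      using that Suc.prems(2) by (auto simp: starts_with_Cons)
    let ?C = "insert \<one> ((\<lambda>u. snd (hd u)) ` ?T)"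
    have "gram ?C (\<kappa> i)"
      using Suc.prems(1) T by (intro kernel_gram[OF i]) (auto simp: one_closed)
    then have "gram ?C (\<lambda>g h. \<kappa> i g h - \<kappa> i g \<one> * \<kappa> i \<one> h)"
      by (rule gram_schur_complement) (simp_all add: kernel_unit i one_closed)
    then have "gram ?T (\<lambda>u w. \<kappa> i (snd (hd u)) (snd (hd w))
        - \<kappa> i (snd (hd u)) \<one> * \<kappa> i \<one> (snd (hd w)))"
      by (rule gram_comp) auto
    from gram_extend_by_zero[OF gram_conj[OF this, of "first i"]]
    show ?thesis unfolding A_def by simp
  qed
  have B: "gram S (B l)" if first_letter: "l \<in> L" for l
  proof -
    let ?T = "{u \<in> S. u \<noteq> [] \<and> hd u = l}"
    have l: "fst l \<in> I" "snd l \<in> carrier G"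
    proof -
      obtain w where "w \<in> S" "w \<noteq> []" "hd w = l" using first_letter unfolding L_def by blast
      then show "fst l \<in> I" "snd l \<in> carrier G" using Suc.prems(2) by (cases w; force)+
    qed
    have "gram (tl ` ?T) (\<lambda>u w. word_kernel u w - star (tau u) * tau w)"
    proof (rule Suc.IH)
      show "\<forall>w\<in>tl ` ?T. reduced_word G I w \<and> length w \<le> n"
      proof clarify
        fix u assume "u \<in> S" "u \<noteq> []"
        then show "reduced_word G I (tl u) \<and> length (tl u) \<le> n" using Suc.prems(2) by (cases u) auto
      qed
    qed (use Suc.prems in simp)
    then have "gram ?T (\<lambda>u w. word_kernel (tl u) (tl w) - star (tau (tl u)) * tau (tl w))"
      by (rule gram_comp) simp
    from gram_extend_by_zero[OF gram_automorphism[OF this aut[OF l]]]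
    show ?thesis unfolding B_def .
  qed
  have "gram S (\<lambda>u w. (\<Sum>i\<in>fst ` L. A i u w) + (\<Sum>l\<in>L. B l u w))"
    by (intro gram_add gram_sum A B)
  then show ?case
  proof (rule gram_cong)
    fix u w assume uw: "u \<in> S" "w \<in> S"
    then have red: "reduced_word G I u" "reduced_word G I w" using Suc.prems(2) by auto
    show "(\<Sum>i\<in>fst ` L. A i u w) + (\<Sum>l\<in>L. B l u w) = word_kernel u w - star (tau u) * tau w"
    proof (cases "u = [] \<or> w = []")
      case True
      then have "A i u w = 0" "B l u w = 0" for i l by (auto simp: A_def B_def)
      moreover have "word_kernel u w = star (tau u) * tau w" using True by (cases u; cases w) auto
      ultimately show ?thesis by simp
    next
      case False
      then obtain i g u' j h w' where eq: "u = (i, g) # u'" "w = (j, h) # w'"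
        by (metis list.exhaust prod.exhaust)
      have L: "(i, g) \<in> L" "i \<in> fst ` L" using uw eq by (force simp: L_def)+
      have "(\<Sum>k\<in>fst ` L. A k u w) = (\<Sum>k\<in>fst ` L. if k = i then A i u w else 0)"
        by (rule sum.cong) (auto simp: A_def eq)
      also have "\<dots> = A i u w" using L(2) fin by simp
      finally have sumA: "(\<Sum>k\<in>fst ` L. A k u w) = A i u w" .
      have "(\<Sum>l\<in>L. B l u w) = (\<Sum>l\<in>L. if l = (i, g) then B (i, g) u w else 0)"
        by (rule sum.cong) (auto simp: B_def eq)
      also have "\<dots> = B (i, g) u w" using L(1) fin by simp
      finally have "(\<Sum>l\<in>L. B l u w) = B (i, g) u w" .
      with sumA show ?thesis
        using word_kernel_recursion[of i g u' j h w'] red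
        unfolding eq by (simp add: A_def B_def first_def eq_commute[of j] eq_commute[of h]
            del: tau.simps word_kernel.simps)
    qed
  qed
qed

theorem gram_word_kernel:
  assumes "finite S" "\<And>w. w \<in> S \<Longrightarrow> reduced_word G I w"
  shows "gram S word_kernel"
proof -
  have "gram S (\<lambda>u w. word_kernel u w - star (tau u) * tau w)"
    by (rule gram_word_kernel_minus_rank_one[where n = "Max (length ` S)"]) (use assms in auto)
  from gram_add[OF this gram_rank_one[of S tau]] show ?thesis by simp
qed

lemma norm_tau_le:
  "reduced_word G I w \<Longrightarrow> norm (tau w) \<le> (\<Prod>(i, g)\<leftarrow>w. norm (\<kappa> i \<one> g))"
proof (induction w rule: tau.induct)
  case (2 i g w)
  have "norm (tau ((i, g) # w)) \<le> norm (\<kappa> i \<one> g) * norm (\<beta> i g (tau w))"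
    by (simp add: norm_mult_ineq)
  also have "norm (\<beta> i g (tau w)) = norm (tau w)"
    using 2 by (intro star_automorphism_isometric aut) simp_all
  also have "norm (\<kappa> i \<one> g) * norm (tau w)
      \<le> norm (\<kappa> i \<one> g) * (\<Prod>(i, g)\<leftarrow>w. norm (\<kappa> i \<one> g))"
    using 2 by (intro mult_left_mono) simp_all
  finally show ?case by simp
qed (simp add: norm_one_le)

end

section \<open>Graph products as words modulo moves\<close>

lemma syllable_words_simps [simp]:
  "[] \<in> syllable_words V G"
  "(v, g) # xs \<in> syllable_words V G \<longleftrightarrow> v \<in> V \<and> g \<in> carrier (G v) \<and> xs \<in> syllable_words V G"
  "xs @ ys \<in> syllable_words V G \<longleftrightarrow> xs \<in> syllable_words V G \<and> ys \<in> syllable_words V G"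
  by (auto simp: syllable_words_def)

lemma normal_closure_normal:
  assumes "group F" "S \<subseteq> carrier F"
  shows "normal_closure F S \<lhd> F" "S \<subseteq> normal_closure F S"
proof -
  interpret group F by (rule assms(1))
  have whole: "carrier F \<lhd> F" by (simp add: normal_inv_iff subgroup_self)
  let ?A = "{N. N \<lhd> F \<and> S \<subseteq> N}"
  have ne: "?A \<noteq> {}" using whole assms(2) by blast
  have "subgroup (\<Inter>?A) F"
    by (rule subgroups_Inter[OF _ ne]) (auto simp: normal_inv_iff)
  moreover have "x \<otimes>\<^bsub>F\<^esub> h \<otimes>\<^bsub>F\<^esub> inv\<^bsub>F\<^esub> x \<in> \<Inter>?A" if "x \<in> carrier F" "h \<in> \<Inter>?A" for x h
    using that by (auto simp: normal_inv_iff)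
  ultimately show "normal_closure F S \<lhd> F"
    unfolding normal_closure_def by (auto simp: normal_inv_iff)
  show "S \<subseteq> normal_closure F S" by (auto simp: normal_closure_def)
qed

locale graph_of_groups =
  fixes V :: "'v set" and E :: "('v \<times> 'v) set" and G :: "'v \<Rightarrow> ('g, 'm) monoid_scheme"
  assumes graph: "simplicial_graph V E"
    and groups: "v \<in> V \<Longrightarrow> group (G v)"
begin

abbreviation "W \<equiv> syllable_words V G"
abbreviation "R \<equiv> free_product_rel V G"
abbreviation "F \<equiv> free_product V G"
abbreviation "N \<equiv> normal_closure F (graph_relators V E G)"
abbreviation "GP \<equiv> graph_product V E G"
abbreviation gp_mult (infixl \<open>\<odot>\<close> 70) where "x \<odot> y \<equiv> x \<otimes>\<^bsub>GP\<^esub> y"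
abbreviation "gp_one \<equiv> \<one>\<^bsub>GP\<^esub>"
abbreviation "gp_inv x \<equiv> inv\<^bsub>GP\<^esub> x"

definition word_class :: "('v \<times> 'g) list \<Rightarrow> ('v \<times> 'g) list set" where
  "word_class xs = R `` {xs}"

definition inverse_word :: "('v \<times> 'g) list \<Rightarrow> ('v \<times> 'g) list" where
  "inverse_word xs = rev (map (\<lambda>(v, g). (v, inv\<^bsub>G v\<^esub> g)) xs)"

definition eval_word :: "('v \<times> 'g) list \<Rightarrow> ('v \<times> 'g) list set set" where
  "eval_word xs = N #>\<^bsub>F\<^esub> word_class xs"

lemma group_facts:
  assumes "v \<in> V"
  shows "\<one>\<^bsub>G v\<^esub> \<in> carrier (G v)" "g \<in> carrier (G v) \<Longrightarrow> inv\<^bsub>G v\<^esub> g \<in> carrier (G v)"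
    "g \<in> carrier (G v) \<Longrightarrow> h \<in> carrier (G v) \<Longrightarrow> g \<otimes>\<^bsub>G v\<^esub> h \<in> carrier (G v)"
    "g \<in> carrier (G v) \<Longrightarrow> inv\<^bsub>G v\<^esub> g \<otimes>\<^bsub>G v\<^esub> g = \<one>\<^bsub>G v\<^esub>"
    "g \<in> carrier (G v) \<Longrightarrow> g \<otimes>\<^bsub>G v\<^esub> inv\<^bsub>G v\<^esub> g = \<one>\<^bsub>G v\<^esub>"
    "g \<in> carrier (G v) \<Longrightarrow> inv\<^bsub>G v\<^esub> (inv\<^bsub>G v\<^esub> g) = g"
    "g \<in> carrier (G v) \<Longrightarrow> \<one>\<^bsub>G v\<^esub> \<otimes>\<^bsub>G v\<^esub> g = g"
  using groups[OF assms]
  by (simp_all add: group.is_monoid monoid.one_closed monoid.m_closed monoid.l_one group.inv_closed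
      group.l_inv group.r_inv group.inv_inv)

lemma edge_facts:
  assumes "(v, w) \<in> E"
  shows "v \<in> V" "w \<in> V" "(w, v) \<in> E" "v \<noteq> w"
  using assms graph unfolding simplicial_graph_def by (auto dest: symD irreflD)

lemma rel_words: "(xs, ys) \<in> R \<Longrightarrow> xs \<in> W \<and> ys \<in> W"
  by (induction rule: free_product_rel.induct) (auto simp: group_facts)

lemma equiv_rel: "equiv W R"
proof (rule equivI)
  show "R \<subseteq> W \<times> W" using rel_words by auto
  show "refl_on W R" using rel_words by (auto intro!: refl_onI free_product_rel.refl)
  show "sym R" by (rule symI) (rule free_product_rel.sym)
  show "trans R" by (rule transI) (rule free_product_rel.trans)
qed

lemma rel_context:
  assumes "(xs, ys) \<in> R" "ps \<in> W" "qs \<in> W"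
  shows "(ps @ xs @ qs, ps @ ys @ qs) \<in> R"
  using assms(1)
proof (induction rule: free_product_rel.induct)
  case (refl xs)
  then show ?case using assms by (simp add: free_product_rel.refl)
next
  case (sym xs ys)
  then show ?case by (rule_tac free_product_rel.sym)
next
  case (trans xs ys zs)
  show ?case by (rule free_product_rel.trans[OF trans.IH])
next
  case (one xs ys v)
  then show ?case
    using free_product_rel.one[of "ps @ xs" V G "ys @ qs" v] assms by simp
next
  case (mult xs ys v g h)
  then show ?case
    using free_product_rel.mult[of "ps @ xs" V G "ys @ qs" v g h] assms by simp
qed

lemma word_class_eq_iff: "xs \<in> W \<Longrightarrow> ys \<in> W \<Longrightarrow> word_class xs = word_class ys \<longleftrightarrow> (xs, ys) \<in> R"
  unfolding word_class_def by (rule eq_equiv_class_iff[OF equiv_rel])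

lemma carrier_free_product: "carrier F = word_class ` W"
  by (auto simp: free_product_def word_class_def quotient_def)

lemma one_free_product: "\<one>\<^bsub>F\<^esub> = word_class []"
  by (simp add: free_product_def word_class_def)

lemma mult_word_class:
  assumes "xs \<in> W" "ys \<in> W"
  shows "word_class xs \<otimes>\<^bsub>F\<^esub> word_class ys = word_class (xs @ ys)"
proof -
  have "R `` {xs' @ ys'} = word_class (xs @ ys)"
    if "xs' \<in> word_class xs" "ys' \<in> word_class ys" for xs' ys'
  proof -
    have r: "(xs, xs') \<in> R" "(ys, ys') \<in> R" using that by (simp_all add: word_class_def)
    then have W: "xs' \<in> W" "ys' \<in> W" using rel_words by blast+
    have "(xs @ ys, xs' @ ys) \<in> R" using rel_context[OF r(1), of "[]" ys] assms by simp
    moreover have "(xs' @ ys, xs' @ ys') \<in> R" using rel_context[OF r(2), of xs' "[]"] W by simp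
    ultimately have "(xs @ ys, xs' @ ys') \<in> R" by (rule free_product_rel.trans)
    then show ?thesis
      using W assms word_class_eq_iff[of "xs @ ys" "xs' @ ys'"] by (simp add: word_class_def)
  qed
  moreover have "xs \<in> word_class xs" "ys \<in> word_class ys"
    using assms by (simp_all add: word_class_def free_product_rel.refl)
  ultimately show ?thesis by (auto simp: free_product_def)
qed

lemma inverse_word_closed: "xs \<in> W \<Longrightarrow> inverse_word xs \<in> W"
  by (induction xs) (auto simp: inverse_word_def group_facts)

lemma inverse_word_Cons: "inverse_word ((v, g) # xs) = inverse_word xs @ [(v, inv\<^bsub>G v\<^esub> g)]"
  by (simp add: inverse_word_def)

lemma cancel_letters:
  assumes "v \<in> V" "g \<in> carrier (G v)" "h \<in> carrier (G v)" "g \<otimes>\<^bsub>G v\<^esub> h = \<one>\<^bsub>G v\<^esub>"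
  shows "([(v, g), (v, h)], []) \<in> R"
proof (rule free_product_rel.trans)
  show "([(v, g), (v, h)], [(v, \<one>\<^bsub>G v\<^esub>)]) \<in> R"
    using free_product_rel.mult[of "[]" V G "[]" v g h] assms by simp
  show "([(v, \<one>\<^bsub>G v\<^esub>)], []) \<in> R"
    using free_product_rel.one[of "[]" V G "[]" v] assms by simp
qed

lemma inverse_word_left: "xs \<in> W \<Longrightarrow> (inverse_word xs @ xs, []) \<in> R"
proof (induction xs)
  case (Cons l xs)
  obtain v g where l: "l = (v, g)" by (cases l)
  have v: "v \<in> V" "g \<in> carrier (G v)" "xs \<in> W" using Cons.prems l by simp_all
  have "([(v, inv\<^bsub>G v\<^esub> g), (v, g)], []) \<in> R" using v by (intro cancel_letters) (simp_all add: group_facts)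
  from rel_context[OF this inverse_word_closed[OF v(3)] v(3)]
  have "(inverse_word (l # xs) @ l # xs, inverse_word xs @ xs) \<in> R" by (simp add: inverse_word_Cons l)
  then show ?case using Cons.IH[OF v(3)] by (rule free_product_rel.trans)
qed (simp add: inverse_word_def free_product_rel.refl)

lemma inverse_word_right: "xs \<in> W \<Longrightarrow> (xs @ inverse_word xs, []) \<in> R"
proof -
  assume xs: "xs \<in> W"
  have "inverse_word (inverse_word xs) = xs"
    using xs by (induction xs) (auto simp: inverse_word_def rev_map group_facts)
  then show ?thesis using inverse_word_left[OF inverse_word_closed[OF xs]] by simp
qed

lemma group_free_product: "group F"
proof (rule groupI)
  show "x \<otimes>\<^bsub>F\<^esub> y \<in> carrier F" if "x \<in> carrier F" "y \<in> carrier F" for x y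
    using that by (auto simp: carrier_free_product mult_word_class)
  show "\<one>\<^bsub>F\<^esub> \<in> carrier F" by (simp add: carrier_free_product one_free_product)
  show "x \<otimes>\<^bsub>F\<^esub> y \<otimes>\<^bsub>F\<^esub> z = x \<otimes>\<^bsub>F\<^esub> (y \<otimes>\<^bsub>F\<^esub> z)"
    if "x \<in> carrier F" "y \<in> carrier F" "z \<in> carrier F" for x y z
    using that by (auto simp: carrier_free_product mult_word_class)
  show "\<one>\<^bsub>F\<^esub> \<otimes>\<^bsub>F\<^esub> x = x" if "x \<in> carrier F" for x
    using that by (auto simp: carrier_free_product mult_word_class one_free_product)
  show "\<exists>y\<in>carrier F. y \<otimes>\<^bsub>F\<^esub> x = \<one>\<^bsub>F\<^esub>" if x: "x \<in> carrier F" for x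
  proof -
    obtain xs where xs: "xs \<in> W" "x = word_class xs" using x by (auto simp: carrier_free_product)
    have "word_class (inverse_word xs) \<otimes>\<^bsub>F\<^esub> x = \<one>\<^bsub>F\<^esub>"
      using xs inverse_word_left[OF xs(1)]
      by (simp add: mult_word_class inverse_word_closed one_free_product word_class_eq_iff)
    then show ?thesis using inverse_word_closed[OF xs(1)] by (auto simp: carrier_free_product)
  qed
qed

lemma inv_word_class:
  assumes "xs \<in> W"
  shows "inv\<^bsub>F\<^esub> (word_class xs) = word_class (inverse_word xs)"
  using inverse_word_left[OF assms] assms
  by (intro group.inv_equality[OF group_free_product])
    (simp_all add: mult_word_class inverse_word_closed one_free_product word_class_eq_iff carrier_free_product)

lemma graph_relators_eq:
  "graph_relators V E G = {word_class [(v, g), (w, h), (v, inv\<^bsub>G v\<^esub> g), (w, inv\<^bsub>G w\<^esub> h)] | v w g h.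
     (v, w) \<in> E \<and> g \<in> carrier (G v) \<and> h \<in> carrier (G w)}"
proof -
  have "free_product_inj V G v g \<otimes>\<^bsub>F\<^esub> free_product_inj V G w h
      \<otimes>\<^bsub>F\<^esub> inv\<^bsub>F\<^esub> (free_product_inj V G v g) \<otimes>\<^bsub>F\<^esub> inv\<^bsub>F\<^esub> (free_product_inj V G w h)
      = word_class [(v, g), (w, h), (v, inv\<^bsub>G v\<^esub> g), (w, inv\<^bsub>G w\<^esub> h)]"
    if "(v, w) \<in> E" "g \<in> carrier (G v)" "h \<in> carrier (G w)" for v w g h
  proof -
    have i: "free_product_inj V G u k = word_class [(u, k)]" for u k
      by (simp add: free_product_inj_def word_class_def)
    show ?thesis
      unfolding i using that edge_facts[OF that(1)]
      by (simp add: inv_word_class mult_word_class inverse_word_def group_facts)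
  qed
  then show ?thesis unfolding graph_relators_def Let_def by (intro Collect_cong) metis
qed

lemma normal_N: "N \<lhd> F" and relators_N: "graph_relators V E G \<subseteq> N"
proof -
  have "graph_relators V E G \<subseteq> carrier F"
    unfolding graph_relators_eq carrier_free_product
    by (auto intro!: imageI simp: edge_facts group_facts)
  from normal_closure_normal[OF group_free_product this]
  show "N \<lhd> F" "graph_relators V E G \<subseteq> N" .
qed

lemma group_graph_product: "group GP"
  unfolding graph_product_def by (rule normal.factorgroup_is_group[OF normal_N])

lemma carrier_graph_product: "carrier GP = eval_word ` W"
  by (auto simp: graph_product_def FactGroup_def RCOSETS_def carrier_free_product eval_word_def)

lemma eval_word_closed: "xs \<in> W \<Longrightarrow> eval_word xs \<in> carrier GP"
  by (simp add: carrier_graph_product)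

lemma eval_word_append:
  assumes "xs \<in> W" "ys \<in> W"
  shows "eval_word (xs @ ys) = eval_word xs \<odot> eval_word ys"
  using normal.rcos_sum[OF normal_N, of "word_class xs" "word_class ys"] assms
  by (simp add: eval_word_def graph_product_def FactGroup_def carrier_free_product mult_word_class)

lemma eval_word_Nil: "eval_word [] = gp_one"
proof -
  have "eval_word [] \<odot> eval_word [] = eval_word []" using eval_word_append[of "[]" "[]"] by simp
  then show ?thesis
    using group.l_cancel_one[OF group_graph_product] eval_word_closed[of "[]"] by simp
qed

lemma eval_word_inj: "eval_word [(v, g)] = graph_product_inj V E G v g"
  by (simp add: eval_word_def graph_product_inj_def free_product_inj_def word_class_def)

lemma eval_word_rel: "(xs, ys) \<in> R \<Longrightarrow> eval_word xs = eval_word ys"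
  using word_class_eq_iff[of xs ys] rel_words[of xs ys] by (simp add: eval_word_def)

lemma eval_word_swap:
  assumes "(v, w) \<in> E" "g \<in> carrier (G v)" "h \<in> carrier (G w)"
  shows "eval_word [(v, g), (w, h)] = eval_word [(w, h), (v, g)]"
proof -
  interpret GP: group GP by (rule group_graph_product)
  note vw = edge_facts[OF assms(1)]
  let ?g' = "inv\<^bsub>G v\<^esub> g" and ?h' = "inv\<^bsub>G w\<^esub> h"
  have W: "[(v, g), (w, h)] \<in> W" "[(v, ?g'), (w, ?h')] \<in> W" "[(w, h), (v, g)] \<in> W"
    using assms vw by (simp_all add: group_facts)
  have "word_class [(v, g), (w, h), (v, ?g'), (w, ?h')] \<in> N"
    using relators_N assms unfolding graph_relators_eq by blast
  then have "eval_word ([(v, g), (w, h)] @ [(v, ?g'), (w, ?h')]) = eval_word []"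
    using subgroup.rcos_const[OF normal_imp_subgroup[OF normal_N] group_free_product]
      group.coset_mult_one[OF group_free_product, of N] subgroup.subset[OF normal_imp_subgroup[OF normal_N]]
    by (simp add: eval_word_def one_free_product[symmetric])
  then have 1: "eval_word [(v, g), (w, h)] \<odot> eval_word [(v, ?g'), (w, ?h')] = gp_one"
    unfolding eval_word_append[OF W(1,2)] eval_word_Nil .
  have "inverse_word [(v, ?g'), (w, ?h')] = [(w, h), (v, g)]"
    using assms vw by (simp add: inverse_word_def group_facts)
  then have "eval_word ([(w, h), (v, g)] @ [(v, ?g'), (w, ?h')]) = eval_word []"
    using eval_word_rel[OF inverse_word_left[OF W(2)]] by simp
  then have "eval_word [(w, h), (v, g)] \<odot> eval_word [(v, ?g'), (w, ?h')] = gp_one"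
    unfolding eval_word_append[OF W(3,2)] eval_word_Nil .
  with 1 show ?thesis
    using W eval_word_closed GP.right_cancel by metis
qed

text \<open>The words whose insertion or deletion never changes \<open>f\<close> form a normal subgroup of the free product
  that contains the relators. So \<open>f\<close> only depends on the element of the graph product.\<close>

theorem word_function_descends:
  assumes one: "\<And>xs ys v. xs \<in> W \<Longrightarrow> ys \<in> W \<Longrightarrow> v \<in> V \<Longrightarrow> f (xs @ [(v, \<one>\<^bsub>G v\<^esub>)] @ ys) = f (xs @ ys)"
    and mult: "\<And>xs ys v g h. xs \<in> W \<Longrightarrow> ys \<in> W \<Longrightarrow> v \<in> V \<Longrightarrow> g \<in> carrier (G v) \<Longrightarrow> h \<in> carrier (G v)
      \<Longrightarrow> f (xs @ [(v, g), (v, h)] @ ys) = f (xs @ [(v, g \<otimes>\<^bsub>G v\<^esub> h)] @ ys)"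
    and swap: "\<And>xs ys v w g h. xs \<in> W \<Longrightarrow> ys \<in> W \<Longrightarrow> (v, w) \<in> E \<Longrightarrow> g \<in> carrier (G v) \<Longrightarrow> h \<in> carrier (G w)
      \<Longrightarrow> f (xs @ [(v, g), (w, h)] @ ys) = f (xs @ [(w, h), (v, g)] @ ys)"
    and xs: "xs \<in> W" and ys: "ys \<in> W" and eq: "eval_word xs = eval_word ys"
  shows "f xs = f ys"
proof -
  interpret F: group F by (rule group_free_product)
  have rel: "f as = f bs" if "(as, bs) \<in> R" for as bs
    using that by (induction rule: free_product_rel.induct) (simp_all add: one[simplified] mult[simplified])
  have rel_in: "f (ps @ as @ qs) = f (ps @ bs @ qs)" if "(as, bs) \<in> R" "ps \<in> W" "qs \<in> W" for as bs ps qs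
    using rel[OF rel_context[OF that]] .
  define trivial where "trivial t \<longleftrightarrow> (\<forall>ps\<in>W. \<forall>qs\<in>W. f (ps @ t @ qs) = f (ps @ qs))" for t
  have trivialD: "f (ps @ t @ qs) = f (ps @ qs)" if "trivial t" "ps \<in> W" "qs \<in> W" for t ps qs
    using that by (simp add: trivial_def)
  define M where "M = word_class ` {t \<in> W. trivial t}"
  have trivial_cong: "trivial t" if "trivial s" "(s, t) \<in> R" for s t
    unfolding trivial_def using rel_in[OF that(2)] that(1) by (simp add: trivial_def)
  have M_iff: "word_class t \<in> M \<longleftrightarrow> trivial t" if "t \<in> W" for t
  proof
    assume "word_class t \<in> M"
    then obtain s where "s \<in> W" "trivial s" "word_class t = word_class s" by (auto simp: M_def)
    then show "trivial t" using trivial_cong word_class_eq_iff that by metis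
  qed (auto simp: M_def that)
  have "M \<lhd> F"
    unfolding F.normal_inv_iff
  proof (intro conjI ballI)
    show "subgroup M F"
    proof (rule F.subgroupI)
      show "M \<subseteq> carrier F" by (auto simp: M_def carrier_free_product)
      have "trivial []" by (simp add: trivial_def)
      then show "M \<noteq> {}" unfolding M_def using syllable_words_simps(1) by blast
      show "inv\<^bsub>F\<^esub> a \<in> M" if a: "a \<in> M" for a
      proof -
        obtain t where t: "t \<in> W" "trivial t" "a = word_class t" using a by (auto simp: M_def)
        have "trivial (inverse_word t)"
          unfolding trivial_def
        proof (intro ballI)
          fix ps qs assume pq: "ps \<in> W" "qs \<in> W"
          have "f (ps @ inverse_word t @ qs) = f (ps @ inverse_word t @ t @ qs)"
            using trivialD[OF t(2), of "ps @ inverse_word t" qs] pq inverse_word_closed[OF t(1)] by simp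
          also have "\<dots> = f (ps @ qs)" using rel_in[OF inverse_word_left[OF t(1)] pq] by simp
          finally show "f (ps @ inverse_word t @ qs) = f (ps @ qs)" .
        qed
        then show ?thesis using t by (simp add: inv_word_class M_iff inverse_word_closed)
      qed
      show "a \<otimes>\<^bsub>F\<^esub> b \<in> M" if ab: "a \<in> M" "b \<in> M" for a b
      proof -
        obtain s t where st: "s \<in> W" "trivial s" "a = word_class s" "t \<in> W" "trivial t" "b = word_class t"
          using ab by (auto simp: M_def)
        have "trivial (s @ t)"
          unfolding trivial_def
        proof (intro ballI)
          fix ps qs assume pq: "ps \<in> W" "qs \<in> W"
          show "f (ps @ (s @ t) @ qs) = f (ps @ qs)"
            using trivialD[OF st(2), of ps "t @ qs"] trivialD[OF st(5), of ps qs] pq st by simp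
        qed
        then show ?thesis using st by (simp add: mult_word_class M_iff)
      qed
    qed
  next
    fix x c assume "x \<in> carrier F" "c \<in> M"
    then obtain p t where p: "p \<in> W" "x = word_class p" and t: "t \<in> W" "trivial t" "c = word_class t"
      by (auto simp: M_def carrier_free_product)
    have "trivial (p @ t @ inverse_word p)"
      unfolding trivial_def
    proof (intro ballI)
      fix ps qs assume pq: "ps \<in> W" "qs \<in> W"
      have "f (ps @ (p @ t @ inverse_word p) @ qs) = f (ps @ (p @ inverse_word p) @ qs)"
        using trivialD[OF t(2), of "ps @ p" "inverse_word p @ qs"] pq p inverse_word_closed by simp
      also have "\<dots> = f (ps @ qs)" using rel_in[OF inverse_word_right[OF p(1)] pq] by simp
      finally show "f (ps @ (p @ t @ inverse_word p) @ qs) = f (ps @ qs)" .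
    qed
    then show "x \<otimes>\<^bsub>F\<^esub> c \<otimes>\<^bsub>F\<^esub> inv\<^bsub>F\<^esub> x \<in> M"
      using p t by (simp add: inv_word_class mult_word_class inverse_word_closed M_iff)
  qed
  moreover have "graph_relators V E G \<subseteq> M"
    unfolding graph_relators_eq
  proof clarify
    fix v w g h assume e: "(v, w) \<in> E" and g: "g \<in> carrier (G v)" and h: "h \<in> carrier (G w)"
    note vw = edge_facts[OF e]
    let ?g' = "inv\<^bsub>G v\<^esub> g" and ?h' = "inv\<^bsub>G w\<^esub> h"
    have "trivial [(v, g), (w, h), (v, ?g'), (w, ?h')]"
      unfolding trivial_def
    proof (intro ballI)
      fix ps qs assume pq: "ps \<in> W" "qs \<in> W"
      have "f (ps @ [(v, g), (w, h), (v, ?g'), (w, ?h')] @ qs) = f (ps @ [(v, g), (v, ?g')] @ [(w, h), (w, ?h')] @ qs)"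
        using swap[of "ps @ [(v, g)]" "(w, ?h') # qs" w v h ?g'] vw g h pq by (simp add: group_facts)
      also have "\<dots> = f (ps @ [(w, h), (w, ?h')] @ qs)"
        using rel_in[OF cancel_letters[of v g ?g'], of ps "[(w, h), (w, ?h')] @ qs"] vw g h pq
        by (simp add: group_facts)
      also have "\<dots> = f (ps @ qs)"
        using rel_in[OF cancel_letters[of w h ?h'], of ps qs] vw h pq by (simp add: group_facts)
      finally show "f (ps @ [(v, g), (w, h), (v, ?g'), (w, ?h')] @ qs) = f (ps @ qs)" .
    qed
    then show "word_class [(v, g), (w, h), (v, ?g'), (w, ?h')] \<in> M"
      using vw g h by (subst M_iff) (simp_all add: group_facts)
  qed
  ultimately have "N \<subseteq> M" unfolding normal_closure_def by blast
  have c: "word_class xs \<in> carrier F" "word_class ys \<in> carrier F"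
    using xs ys by (simp_all add: carrier_free_product)
  have "word_class xs \<in> N #>\<^bsub>F\<^esub> word_class ys"
    using F.rcos_self[OF c(1) normal_imp_subgroup[OF normal_N]] eq by (simp add: eval_word_def)
  then obtain a where a: "a \<in> N" "word_class xs = a \<otimes>\<^bsub>F\<^esub> word_class ys" by (auto simp: r_coset_def)
  have "a \<in> carrier F" using a(1) subgroup.subset[OF normal_imp_subgroup[OF normal_N]] by blast
  then have "word_class xs \<otimes>\<^bsub>F\<^esub> inv\<^bsub>F\<^esub> (word_class ys) = a" using a(2) c by (simp add: F.m_assoc)
  then have "word_class (xs @ inverse_word ys) \<in> M"
    using a(1) \<open>N \<subseteq> M\<close> xs ys by (auto simp: inv_word_class mult_word_class inverse_word_closed)
  then have "trivial (xs @ inverse_word ys)" using xs ys by (simp add: M_iff inverse_word_closed)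
  then have "f ys = f (xs @ inverse_word ys @ ys)" using trivialD[of "xs @ inverse_word ys" "[]" ys] ys by simp
  also have "\<dots> = f xs" using rel_in[OF inverse_word_left[OF ys] xs, of "[]"] by simp
  finally show ?thesis by simp
qed

end

section \<open>The action of a graph product\<close>

lemma id_star_automorphism: "id \<in> star_automorphisms"
  by (simp add: star_automorphisms_def)

lemma comp_star_automorphism:
  "f \<in> star_automorphisms \<Longrightarrow> g \<in> star_automorphisms \<Longrightarrow> f \<circ> g \<in> star_automorphisms"
  by (simp add: star_automorphisms_def bij_comp)

lemma idempotent_star_automorphism:
  assumes "f \<in> star_automorphisms" "f \<circ> f = f"
  shows "f = id"
proof
  fix x
  have "f (f x) = f x" using assms(2) by (metis comp_apply)
  moreover have "inj f" using assms(1) by (simp add: star_automorphisms_def bij_is_inj)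
  ultimately show "f x = id x" by (simp add: inj_eq)
qed

locale graph_action = graph_of_groups V E G
  for V :: "'v set" and E :: "('v \<times> 'v) set" and G :: "'v \<Rightarrow> ('g, 'm) monoid_scheme" +
  fixes \<alpha> :: "'v \<Rightarrow> 'g \<Rightarrow> 'a::unital_cstar_algebra \<Rightarrow> 'a"
  assumes actions: "v \<in> V \<Longrightarrow> cstar_action (G v) (\<alpha> v)"
    and commuting: "actions_commute E G \<alpha>"
begin

lemma vertex_action:
  assumes "v \<in> V"
  shows "g \<in> carrier (G v) \<Longrightarrow> \<alpha> v g \<in> star_automorphisms"
    "g \<in> carrier (G v) \<Longrightarrow> h \<in> carrier (G v) \<Longrightarrow> \<alpha> v (g \<otimes>\<^bsub>G v\<^esub> h) = \<alpha> v g \<circ> \<alpha> v h"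
    "\<alpha> v \<one>\<^bsub>G v\<^esub> = id"
proof -
  have hom: "\<alpha> v \<in> hom (G v) aut_group" using actions[OF assms] by (simp add: cstar_action_def)
  show aut: "\<alpha> v g \<in> star_automorphisms" if "g \<in> carrier (G v)" for g
    using hom_in_carrier[OF hom that] by (simp add: aut_group_def)
  show mult: "\<alpha> v (g \<otimes>\<^bsub>G v\<^esub> h) = \<alpha> v g \<circ> \<alpha> v h" if "g \<in> carrier (G v)" "h \<in> carrier (G v)" for g h
    using hom_mult[OF hom that] by (simp add: aut_group_def)
  have one: "\<one>\<^bsub>G v\<^esub> \<in> carrier (G v)" by (rule group_facts(1)[OF assms])
  have "\<alpha> v \<one>\<^bsub>G v\<^esub> \<circ> \<alpha> v \<one>\<^bsub>G v\<^esub> = \<alpha> v \<one>\<^bsub>G v\<^esub>"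
    using mult[OF one one] by (simp add: group_facts(7)[OF assms one])
  with aut[OF one] show "\<alpha> v \<one>\<^bsub>G v\<^esub> = id" by (rule idempotent_star_automorphism)
qed

definition word_action :: "('v \<times> 'g) list \<Rightarrow> 'a \<Rightarrow> 'a" where
  "word_action xs = foldr (\<lambda>(v, g) f. \<alpha> v g \<circ> f) xs id"

lemma word_action_simps [simp]:
  "word_action [] = id" "word_action ((v, g) # xs) = \<alpha> v g \<circ> word_action xs"
  by (simp_all add: word_action_def)

lemma word_action_append: "word_action (xs @ ys) = word_action xs \<circ> word_action ys"
  by (induction xs) (auto simp: o_assoc)

lemma word_action_automorphism: "xs \<in> W \<Longrightarrow> word_action xs \<in> star_automorphisms"
  by (induction xs) (auto intro!: comp_star_automorphism vertex_action(1) simp: id_star_automorphism)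

lemma word_action_descends:
  assumes "xs \<in> W" "ys \<in> W" "eval_word xs = eval_word ys"
  shows "word_action xs = word_action ys"
proof (rule word_function_descends[OF _ _ _ assms])
  fix xs ys v w g h
  assume e: "(v, w) \<in> E" and gh: "g \<in> carrier (G v)" "h \<in> carrier (G w)"
  have "\<alpha> v g \<circ> \<alpha> w h = \<alpha> w h \<circ> \<alpha> v g"
    using commuting e gh unfolding actions_commute_def by blast
  then have "\<alpha> v g \<circ> (\<alpha> w h \<circ> f) = \<alpha> w h \<circ> (\<alpha> v g \<circ> f)" for f :: "'a \<Rightarrow> 'a"
    by (simp only: o_assoc)
  then show "word_action (xs @ [(v, g), (w, h)] @ ys) = word_action (xs @ [(w, h), (v, g)] @ ys)"
    by (simp add: word_action_append)
qed (simp_all add: word_action_append vertex_action o_assoc)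

lemma graph_product_action_unique:
  assumes hom: "\<phi> \<in> hom GP aut_group"
    and ext: "\<And>v g. v \<in> V \<Longrightarrow> g \<in> carrier (G v) \<Longrightarrow> \<phi> (graph_product_inj V E G v g) = \<alpha> v g"
    and "xs \<in> W"
  shows "\<phi> (eval_word xs) = word_action xs"
  using assms(3)
proof (induction xs)
  case Nil
  have c: "eval_word [] \<in> carrier GP" by (simp add: eval_word_closed)
  have "eval_word [] \<odot> eval_word [] = eval_word []"
    using eval_word_append[of "[]" "[]"] by simp
  then have "\<phi> (eval_word []) \<circ> \<phi> (eval_word []) = \<phi> (eval_word [])"
    using hom_mult[OF hom c c] by (simp add: aut_group_def)
  moreover have "\<phi> (eval_word []) \<in> star_automorphisms"
    using hom_in_carrier[OF hom c] by (simp add: aut_group_def)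
  ultimately show ?case unfolding word_action_simps by (intro idempotent_star_automorphism)
next
  case (Cons l xs)
  obtain v g where l: "l = (v, g)" by (cases l)
  have W: "[(v, g)] \<in> W" "xs \<in> W" using Cons.prems l by simp_all
  have "\<phi> (eval_word [(v, g)] \<odot> eval_word xs) = \<phi> (eval_word [(v, g)]) \<circ> \<phi> (eval_word xs)"
    using hom_mult[OF hom eval_word_closed[OF W(1)] eval_word_closed[OF W(2)]] by (simp add: aut_group_def)
  moreover have "eval_word (l # xs) = eval_word [(v, g)] \<odot> eval_word xs"
    using eval_word_append[OF W] l by simp
  ultimately show ?case using Cons.IH[OF W(2)] W(1) l by (simp add: eval_word_inj ext)
qed

definition rep_word :: "('v \<times> 'g) list set set \<Rightarrow> ('v \<times> 'g) list" where
  "rep_word x = (SOME xs. xs \<in> W \<and> eval_word xs = x)"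

lemma rep_word:
  assumes "x \<in> carrier GP"
  shows "rep_word x \<in> W" "eval_word (rep_word x) = x"
proof -
  obtain xs where "xs \<in> W \<and> eval_word xs = x" using assms by (auto simp: carrier_graph_product)
  then have "rep_word x \<in> W \<and> eval_word (rep_word x) = x" unfolding rep_word_def by (rule someI)
  then show "rep_word x \<in> W" "eval_word (rep_word x) = x" by simp_all
qed

abbreviation "act \<equiv> graph_product_action V E G \<alpha>"

text \<open>The letters generate the graph product, which gives uniqueness; existence holds because the moves
  do not change \<open>word_action\<close>.\<close>

lemma act_hom: "act \<in> hom GP aut_group"
  and act_eval_word: "xs \<in> W \<Longrightarrow> act (eval_word xs) = word_action xs"
proof -
  let ?P = "\<lambda>\<phi>. \<phi> \<in> hom GP aut_group \<and> \<phi> \<in> extensional (carrier GP)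
        \<and> (\<forall>v \<in> V. \<forall>g \<in> carrier (G v). \<phi> (graph_product_inj V E G v g) = \<alpha> v g)"
  define \<Phi> where "\<Phi> = restrict (\<lambda>x. word_action (rep_word x)) (carrier GP)"
  have \<Phi>: "\<Phi> (eval_word xs) = word_action xs" if "xs \<in> W" for xs
    using that rep_word[OF eval_word_closed[OF that]]
    by (auto simp: \<Phi>_def eval_word_closed intro!: word_action_descends)
  have "?P \<Phi>"
  proof (intro conjI ballI)
    show "\<Phi> \<in> hom GP aut_group"
    proof (rule homI)
      fix x y assume "x \<in> carrier GP" "y \<in> carrier GP"
      then obtain xs ys where "xs \<in> W" "x = eval_word xs" "ys \<in> W" "y = eval_word ys"
        by (auto simp: carrier_graph_product)
      then show "\<Phi> (x \<odot> y) = \<Phi> x \<otimes>\<^bsub>aut_group\<^esub> \<Phi> y" "\<Phi> x \<in> carrier aut_group"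
        using \<Phi>[of "xs @ ys"]
        by (simp_all add: \<Phi> eval_word_append aut_group_def word_action_append word_action_automorphism)
    qed
    show "\<Phi> (graph_product_inj V E G v g) = \<alpha> v g" if "v \<in> V" "g \<in> carrier (G v)" for v g
      using \<Phi>[of "[(v, g)]"] that by (simp add: eval_word_inj)
  qed (simp add: \<Phi>_def)
  moreover have "\<phi> = \<Phi>" if "?P \<phi>" for \<phi>
  proof (rule extensionalityI)
    show "\<phi> x = \<Phi> x" if "x \<in> carrier GP" for x
      using that \<Phi> graph_product_action_unique[of \<phi>] \<open>?P \<phi>\<close> by (auto simp: carrier_graph_product)
  qed (use that in \<open>simp_all add: \<Phi>_def\<close>)
  ultimately have "act = \<Phi>" unfolding graph_product_action_def by (rule the_equality)
  with \<open>?P \<Phi>\<close> \<Phi> show "act \<in> hom GP aut_group" "xs \<in> W \<Longrightarrow> act (eval_word xs) = word_action xs"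
    by simp_all
qed

lemma act_automorphism: "x \<in> carrier GP \<Longrightarrow> act x \<in> star_automorphisms"
  using hom_in_carrier[OF act_hom] by (simp add: aut_group_def)

lemma act_mult: "x \<in> carrier GP \<Longrightarrow> y \<in> carrier GP \<Longrightarrow> act (x \<odot> y) a = act x (act y a)"
  using hom_mult[OF act_hom] by (simp add: aut_group_def)

lemma act_one: "act gp_one a = a"
  using act_eval_word[of "[]"] by (simp add: eval_word_Nil)

lemma act_inv: "x \<in> carrier GP \<Longrightarrow> act (gp_inv x) (act x a) = a"
  using group_graph_product
  by (simp add: act_mult[symmetric] group.inv_closed group.l_inv act_one)

end


section \<open>The tree of words at a vertex\<close>

text \<open>A conjugate of the group of a vertex \<open>v\<close> by an element \<open>x\<close> corresponds to a coset of the stabilizer of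
  that group. As an index for it serves the data that it carries: its embedding into the graph product
  and the kernels transported by \<open>x\<close>. Then no coset representatives have to be chosen, and equality
  of indices yields commutation relations. The kernels of the whole sequence of multipliers are
  recorded together, in order that the words over the indices are the same for all members of the
  sequence, as the proof of pointwise convergence requires.\<close>

type_synonym ('v, 'g, 'a) conjugate =
  "('g \<Rightarrow> ('v \<times> 'g) list set set) \<times> (nat \<Rightarrow> 'g \<Rightarrow> 'g \<Rightarrow> 'a)"

type_synonym ('v, 'g, 'a) conjugate_word = "(('v, 'g, 'a) conjugate \<times> 'g) list"

locale graph_multipliers = graph_action V E G \<alpha>
  for V :: "'v set" and E :: "('v \<times> 'v) set" and G :: "'v \<Rightarrow> ('g, 'm) monoid_scheme"
    and \<alpha> :: "'v \<Rightarrow> 'g \<Rightarrow> 'a::unital_cstar_algebra \<Rightarrow> 'a" +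
  fixes h :: "'v \<Rightarrow> nat \<Rightarrow> 'g \<Rightarrow> 'a"
  assumes multiplier: "v \<in> V \<Longrightarrow> positive_definite_multiplier (G v) (\<alpha> v) (h v n)"
    and unital: "v \<in> V \<Longrightarrow> unital_multiplier (G v) (h v n)"
    and multipliers_commute: "multipliers_commute E G \<alpha> (\<lambda>v. h v n)"
begin

text \<open>The value zero off the group lets the automorphisms of neighbouring groups fix this kernel as a
  total function (\<open>vertex_kernel_link\<close>).\<close>

definition vertex_kernel :: "'v \<Rightarrow> nat \<Rightarrow> 'g \<Rightarrow> 'g \<Rightarrow> 'a" where
  "vertex_kernel v n a b =
    (if a \<in> carrier (G v) \<and> b \<in> carrier (G v) then \<alpha> v b (h v n (inv\<^bsub>G v\<^esub> a \<otimes>\<^bsub>G v\<^esub> b)) else 0)"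

lemma vertex_kernel_gram:
  assumes "v \<in> V" "finite S" "S \<subseteq> carrier (G v)"
  shows "gram S (vertex_kernel v n)"
proof -
  obtain x where x: "bij_betw x {0..<card S} S" using ex_bij_betw_nat_finite[OF assms(2)] by blast
  have xS: "x i \<in> S" if "i < card S" for i using x that by (auto simp: bij_betw_def)
  have "positive_matrix (card S) (mat (card S) (card S)
      (\<lambda>(i, j). \<alpha> v (x j) (h v n (inv\<^bsub>G v\<^esub> (x i) \<otimes>\<^bsub>G v\<^esub> x j))))"
    using multiplier[OF assms(1), of n] xS assms(3) unfolding positive_definite_multiplier_def by blast
  then have "gram {..<card S} (\<lambda>i j. \<alpha> v (x j) (h v n (inv\<^bsub>G v\<^esub> (x i) \<otimes>\<^bsub>G v\<^esub> x j)))"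
    unfolding positive_matrix_iff_gram .
  then have "gram {..<card S} (\<lambda>i j. vertex_kernel v n (x i) (x j))"
    by (rule gram_cong) (use xS assms(3) in \<open>auto simp: vertex_kernel_def subset_iff\<close>)
  then have "gram S (\<lambda>a b. vertex_kernel v n (x (inv_into {0..<card S} x a)) (x (inv_into {0..<card S} x b)))"
  proof (rule gram_comp)
    show "inv_into {0..<card S} x ` S \<subseteq> {..<card S}"
      using x by (metis atLeast0LessThan bij_betw_imp_surj_on bij_betw_inv_into order_refl)
  qed
  then show ?thesis
    by (rule gram_cong) (simp add: bij_betw_inv_into_right[OF x])
qed

lemma h_central: "v \<in> V \<Longrightarrow> g \<in> carrier (G v) \<Longrightarrow> h v n g \<in> algebra_center"
  using multiplier[of v n] by (auto simp: positive_definite_multiplier_def)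

lemma vertex_kernel_one:
  assumes "v \<in> V" "g \<in> carrier (G v)"
  shows "vertex_kernel v n \<one>\<^bsub>G v\<^esub> g = \<alpha> v g (h v n g)"
  using assms groups[OF assms(1)]
  by (simp add: vertex_kernel_def group_facts group.is_monoid monoid.inv_one)

lemma vertex_kernel_unit:
  assumes "v \<in> V" "g \<in> carrier (G v)"
  shows "vertex_kernel v n g g = 1"
  using assms unital[OF assms(1), of n]
  by (simp add: vertex_kernel_def group_facts unital_multiplier_def
      star_automorphism_simps[OF vertex_action(1)])

lemma vertex_kernel_central:
  assumes "v \<in> V" "g \<in> carrier (G v)" "k \<in> carrier (G v)"
  shows "vertex_kernel v n g k \<in> algebra_center"
  using assms
  by (simp add: vertex_kernel_def center_automorphism[OF vertex_action(1)] h_central group_facts)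

lemma vertex_kernel_invariant:
  assumes "v \<in> V" "z \<in> carrier (G v)" "g \<in> carrier (G v)" "k \<in> carrier (G v)"
  shows "\<alpha> v z (vertex_kernel v n g k) = vertex_kernel v n (z \<otimes>\<^bsub>G v\<^esub> g) (z \<otimes>\<^bsub>G v\<^esub> k)"
proof -
  interpret Gv: group "G v" using groups[OF assms(1)] .
  have "inv\<^bsub>G v\<^esub> (z \<otimes>\<^bsub>G v\<^esub> g) \<otimes>\<^bsub>G v\<^esub> (z \<otimes>\<^bsub>G v\<^esub> k) = inv\<^bsub>G v\<^esub> g \<otimes>\<^bsub>G v\<^esub> k"
    using assms by (simp add: Gv.inv_mult_group Gv.m_assoc Gv.inv_solve_left')
  then show ?thesis using assms by (simp add: vertex_kernel_def vertex_action)
qed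

lemma vertex_kernel_link:
  assumes "(v, w) \<in> E" "l \<in> carrier (G w)"
  shows "\<alpha> w l (vertex_kernel v n g k) = vertex_kernel v n g k"
proof (cases "g \<in> carrier (G v) \<and> k \<in> carrier (G v)")
  case True
  note vw = edge_facts[OF assms(1)]
  let ?s = "inv\<^bsub>G v\<^esub> g \<otimes>\<^bsub>G v\<^esub> k"
  have s: "?s \<in> carrier (G v)" using True vw by (simp add: group_facts)
  have "\<alpha> w l (\<alpha> v k (h v n ?s)) = \<alpha> v k (\<alpha> w l (h v n ?s))"
  proof -
    have "\<alpha> v k \<circ> \<alpha> w l = \<alpha> w l \<circ> \<alpha> v k"
      using commuting assms True unfolding actions_commute_def by blast
    then show ?thesis by (metis comp_apply)
  qed
  also have "\<alpha> w l (h v n ?s) = h v n ?s"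
    using multipliers_commute[of n] assms s unfolding multipliers_commute_def by blast
  finally show ?thesis using True by (simp add: vertex_kernel_def)
next
  case False
  then have "vertex_kernel v n g k = 0" by (auto simp: vertex_kernel_def)
  then show ?thesis
    using star_automorphism_simps(6)[OF vertex_action(1)[OF edge_facts(2)[OF assms(1)] assms(2)]] by simp
qed

definition base :: "'v \<Rightarrow> ('v, 'g, 'a) conjugate" where
  "base v = (\<lambda>g. if g \<in> carrier (G v) then eval_word [(v, g)] else gp_one, vertex_kernel v)"

definition shift :: "('v \<times> 'g) list set set \<Rightarrow> ('v, 'g, 'a) conjugate \<Rightarrow> ('v, 'g, 'a) conjugate" where
  "shift x i = (\<lambda>g. x \<odot> fst i g \<odot> gp_inv x, \<lambda>n a b. act x (snd i n a b))"

definition conjugates :: "'v \<Rightarrow> ('v, 'g, 'a) conjugate set" where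
  "conjugates v = (\<lambda>x. shift x (base v)) ` carrier GP"

abbreviation "reduced_at v \<equiv> reduced_word (G v) (conjugates v)"

lemma base_closed: "v \<in> V \<Longrightarrow> fst (base v) g \<in> carrier GP"
  using group_graph_product by (simp add: base_def eval_word_closed group.is_monoid monoid.one_closed)

lemma shift_shift:
  assumes "x \<in> carrier GP" "y \<in> carrier GP" "\<And>g. fst i g \<in> carrier GP"
  shows "shift x (shift y i) = shift (x \<odot> y) i"
proof -
  interpret GP: group GP by (rule group_graph_product)
  show ?thesis using assms by (simp add: shift_def act_mult GP.inv_mult_group GP.m_assoc)
qed

lemma shift_one: "(\<And>g. fst i g \<in> carrier GP) \<Longrightarrow> shift gp_one i = i"
proof -
  assume c: "\<And>g. fst i g \<in> carrier GP"
  interpret GP: group GP by (rule group_graph_product)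
  show ?thesis using c by (simp add: shift_def act_one)
qed

lemma conjugates_closed: "v \<in> V \<Longrightarrow> i \<in> conjugates v \<Longrightarrow> fst i g \<in> carrier GP"
proof -
  interpret GP: group GP by (rule group_graph_product)
  show "v \<in> V \<Longrightarrow> i \<in> conjugates v \<Longrightarrow> fst i g \<in> carrier GP"
    by (auto simp: conjugates_def shift_def base_closed)
qed

lemma base_in_conjugates: "v \<in> V \<Longrightarrow> base v \<in> conjugates v"
proof -
  interpret GP: group GP by (rule group_graph_product)
  show "v \<in> V \<Longrightarrow> base v \<in> conjugates v"
    unfolding conjugates_def
    by (rule image_eqI[where x = "gp_one"]) (simp_all add: shift_one base_closed)
qed

lemma shift_conjugates:
  assumes "v \<in> V" "x \<in> carrier GP"
  shows "shift x ` conjugates v \<subseteq> conjugates v" "inj_on (shift x) (conjugates v)"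
proof -
  interpret GP: group GP by (rule group_graph_product)
  show "shift x ` conjugates v \<subseteq> conjugates v"
    using assms by (auto simp: conjugates_def shift_shift base_closed)
  show "inj_on (shift x) (conjugates v)"
  proof (rule inj_on_inverseI[where g = "shift (gp_inv x)"])
    show "shift (gp_inv x) (shift x i) = i" if "i \<in> conjugates v" for i
      using assms that conjugates_closed[OF assms(1) that] by (simp add: shift_shift shift_one)
  qed
qed

lemma kernel_family_conjugates:
  assumes "v \<in> V"
  shows "kernel_family (G v) (conjugates v) (\<lambda>i g. act (fst i g)) (\<lambda>i. snd i n)"
proof -
  interpret GP: group GP by (rule group_graph_product)
  have e: "eval_word [(v, g)] \<in> carrier GP" if "g \<in> carrier (G v)" for g
    using that assms by (simp add: eval_word_closed)
  have act_e: "act (eval_word [(v, g)]) = \<alpha> v g" if "g \<in> carrier (G v)" for g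
    using that assms act_eval_word[of "[(v, g)]"] by simp
  show ?thesis
  proof (rule kernel_family.intro)
    show "group (G v)" by (rule groups[OF assms])
    show "act (fst i g) \<in> star_automorphisms" if "i \<in> conjugates v" for i g
      using that assms by (simp add: act_automorphism conjugates_closed)
    show "act (fst i (g \<otimes>\<^bsub>G v\<^esub> k)) a = act (fst i g) (act (fst i k) a)"
      if "i \<in> conjugates v" "g \<in> carrier (G v)" "k \<in> carrier (G v)" for i g k a
    proof -
      from that(1) obtain x where x: "x \<in> carrier GP" "i = shift x (base v)" by (auto simp: conjugates_def)
      have ea: "act (eval_word [(v, g \<otimes>\<^bsub>G v\<^esub> k)]) b = act (eval_word [(v, g)]) (act (eval_word [(v, k)]) b)" for b
        using that assms by (simp add: act_e vertex_action group_facts)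
      show ?thesis
        using that assms x e by (simp add: shift_def base_def group_facts act_mult act_inv ea)
    qed
    show "gram S (snd i n)" if "i \<in> conjugates v" "finite S" "S \<subseteq> carrier (G v)" for i S
    proof -
      from that(1) obtain x where x: "x \<in> carrier GP" "i = shift x (base v)" by (auto simp: conjugates_def)
      then show ?thesis
        using gram_automorphism[OF vertex_kernel_gram[OF assms that(2,3)] act_automorphism[OF x(1)]]
        by (simp add: shift_def base_def)
    qed
    show "snd i n g g = 1" if "i \<in> conjugates v" "g \<in> carrier (G v)" for i g
      using that assms
      by (auto simp: conjugates_def shift_def base_def vertex_kernel_unit star_automorphism_simps[OF act_automorphism])
    show "snd i n g k \<in> algebra_center"
      if "i \<in> conjugates v" "g \<in> carrier (G v)" "k \<in> carrier (G v)" for i g k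
      using that assms
      by (auto simp: conjugates_def shift_def base_def vertex_kernel_central intro!: center_automorphism[OF act_automorphism])
    show "act (fst i z) (snd i n g k) = snd i n (z \<otimes>\<^bsub>G v\<^esub> g) (z \<otimes>\<^bsub>G v\<^esub> k)"
      if "i \<in> conjugates v" "z \<in> carrier (G v)" "g \<in> carrier (G v)" "k \<in> carrier (G v)" for i z g k
    proof -
      from that(1) obtain x where x: "x \<in> carrier GP" "i = shift x (base v)" by (auto simp: conjugates_def)
      then show ?thesis
        using that assms e[of z]
        by (simp add: shift_def base_def act_mult act_inv act_e vertex_kernel_invariant)
    qed
  qed
qed

text \<open>The graph product acts on reduced words over the conjugates: the group of \<open>v\<close> multiplies from the left
  in its own copy, the others permute the indices.\<close>

definition letter_move :: "'v \<Rightarrow> 'v \<times> 'g \<Rightarrow> ('v, 'g, 'a) conjugate_word \<Rightarrow> ('v, 'g, 'a) conjugate_word" where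
  "letter_move v l u =
    (if fst l = v then left_mult (G v) (base v) (snd l) u else map (apfst (shift (eval_word [l]))) u)"

definition word_move :: "'v \<Rightarrow> ('v \<times> 'g) list \<Rightarrow> ('v, 'g, 'a) conjugate_word \<Rightarrow> ('v, 'g, 'a) conjugate_word" where
  "word_move v xs u = foldr (letter_move v) xs u"

lemma word_move_simps [simp]:
  "word_move v [] u = u" "word_move v (l # xs) u = letter_move v l (word_move v xs u)"
  "word_move v (xs @ ys) u = word_move v xs (word_move v ys u)"
  by (simp_all add: word_move_def)

lemma letter_closed: "v \<in> V \<Longrightarrow> g \<in> carrier (G v) \<Longrightarrow> eval_word [(v, g)] \<in> carrier GP"
  by (simp add: eval_word_closed)

lemma letter_move_reduced:
  assumes "v \<in> V" "w \<in> V" "g \<in> carrier (G w)" "reduced_at v u"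
  shows "reduced_at v (letter_move v (w, g) u)"
proof (cases "w = v")
  case True
  with assms show ?thesis
    by (simp add: letter_move_def reduced_left_mult groups base_in_conjugates)
next
  case False
  with shift_conjugates[OF assms(1) letter_closed[OF assms(2,3)]] assms(4) show ?thesis
    by (simp add: letter_move_def reduced_map_apfst)
qed

lemma word_move_reduced:
  "v \<in> V \<Longrightarrow> xs \<in> W \<Longrightarrow> reduced_at v u \<Longrightarrow> reduced_at v (word_move v xs u)"
  by (induction xs) (auto intro!: letter_move_reduced)

lemma map_shift_cong:
  assumes "v \<in> V" "reduced_at v u" "\<And>i. i \<in> conjugates v \<Longrightarrow> f i = f' i"
  shows "map (apfst f) u = map (apfst f') u"
  using assms(2) 
proof (induction u)
  case (Cons l u)
  then show ?case using assms(3) by (cases l) simp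
qed simp

text \<open>Here both parts of the assumption that everything commutes according to the graph enter: the
  embedding is fixed by the relations of the graph product, the kernel by the condition on the
  multipliers.\<close>

lemma shift_base_link:
  assumes "(v, w) \<in> E" "g \<in> carrier (G w)"
  shows "shift (eval_word [(w, g)]) (base v) = base v"
proof -
  interpret GP: group GP by (rule group_graph_product)
  note vw = edge_facts[OF assms(1)]
  have e: "eval_word [(w, g)] \<in> carrier GP" using letter_closed vw assms by simp
  have a: "act (eval_word [(w, g)]) = \<alpha> w g" using act_eval_word[of "[(w, g)]"] vw assms by simp
  have "eval_word [(w, g)] \<odot> eval_word [(v, k)] \<odot> gp_inv (eval_word [(w, g)]) = eval_word [(v, k)]"
    if k: "k \<in> carrier (G v)" for k
  proof -
    have "eval_word [(w, g)] \<odot> eval_word [(v, k)] = eval_word [(v, k)] \<odot> eval_word [(w, g)]"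
      using eval_word_swap[OF assms(1) k assms(2)] eval_word_append[of "[(w, g)]" "[(v, k)]"]
        eval_word_append[of "[(v, k)]" "[(w, g)]"] vw k assms(2) by simp
    then show ?thesis using e letter_closed[OF vw(1) k] by (simp add: GP.m_assoc)
  qed
  then show ?thesis
    using e by (auto simp: shift_def base_def a vertex_kernel_link[OF assms] fun_eq_iff)
qed

lemma word_move_descends:
  assumes v: "v \<in> V" and u: "reduced_at v u"
    and "xs \<in> W" "ys \<in> W" "eval_word xs = eval_word ys"
  shows "word_move v xs u = word_move v ys u"
proof (rule word_function_descends[where f = "\<lambda>xs. word_move v xs u", OF _ _ _ assms(3-5)])
  fix xs ys w assume xy: "xs \<in> W" "ys \<in> W" and w: "w \<in> V"
  have red: "reduced_at v (word_move v ys u)" by (rule word_move_reduced[OF v xy(2) u])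
  have one: "letter_move v (w, \<one>\<^bsub>G w\<^esub>) u' = u'" if u': "reduced_at v u'" for u'
  proof (cases "w = v")
    case True
    then show ?thesis using left_mult_one[OF groups[OF v] u'] by (simp add: letter_move_def)
  next
    case False
    have "eval_word [(w, \<one>\<^bsub>G w\<^esub>)] = gp_one"
      using eval_word_rel[OF free_product_rel.one[of "[]" V G "[]" w]] w by (simp add: eval_word_Nil)
    then have "letter_move v (w, \<one>\<^bsub>G w\<^esub>) u' = map (apfst id) u'"
      using False map_shift_cong[OF v u', of "shift gp_one" id] conjugates_closed[OF v]
      by (simp add: letter_move_def shift_one)
    then show ?thesis by (simp add: apfst_id)
  qed
  show "word_move v (xs @ [(w, \<one>\<^bsub>G w\<^esub>)] @ ys) u = word_move v (xs @ ys) u"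
    using one[OF red] by simp
next
  fix xs ys w g k assume xy: "xs \<in> W" "ys \<in> W" and w: "w \<in> V" and g: "g \<in> carrier (G w)" and k: "k \<in> carrier (G w)"
  have red: "reduced_at v (word_move v ys u)" by (rule word_move_reduced[OF v xy(2) u])
  have "letter_move v (w, g) (letter_move v (w, k) (word_move v ys u)) = letter_move v (w, g \<otimes>\<^bsub>G w\<^esub> k) (word_move v ys u)"
  proof (cases "w = v")
    case True
    then show ?thesis using left_mult_mult[OF groups[OF v] red] g k by (simp add: letter_move_def)
  next
    case False
    have "eval_word [(w, g)] \<odot> eval_word [(w, k)] = eval_word [(w, g \<otimes>\<^bsub>G w\<^esub> k)]"
      using eval_word_rel[OF free_product_rel.mult[of "[]" V G "[]" w g k]]
        eval_word_append[of "[(w, g)]" "[(w, k)]"] w g k by simp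
    then show ?thesis
      using False map_shift_cong[OF v red, of "shift (eval_word [(w, g)]) \<circ> shift (eval_word [(w, k)])"]
        conjugates_closed[OF v] letter_closed w g k
      by (simp add: letter_move_def shift_shift apfst_compose o_def)
  qed
  then show "word_move v (xs @ [(w, g), (w, k)] @ ys) u = word_move v (xs @ [(w, g \<otimes>\<^bsub>G w\<^esub> k)] @ ys) u"
    by simp
next
  fix xs ys w w' g k assume xy: "xs \<in> W" "ys \<in> W" and e: "(w, w') \<in> E" and g: "g \<in> carrier (G w)" and k: "k \<in> carrier (G w')"
  note ww = edge_facts[OF e]
  have red: "reduced_at v (word_move v ys u)" by (rule word_move_reduced[OF v xy(2) u])
  \<comment> \<open>A neighbour of \<open>v\<close> fixes the base index, so it commutes with left multiplication there.\<close>
  have link: "map (apfst (shift (eval_word [(b, y)]))) (left_mult (G v) (base v) z (word_move v ys u))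
      = left_mult (G v) (base v) z (map (apfst (shift (eval_word [(b, y)]))) (word_move v ys u))"
    if "(v, b) \<in> E" "y \<in> carrier (G b)" for b y z
    using map_apfst_left_mult[OF shift_conjugates(2)[OF v letter_closed] red base_in_conjugates[OF v]]
      that edge_facts[OF that(1)] shift_base_link[OF that] by simp
  have "letter_move v (w, g) (letter_move v (w', k) (word_move v ys u))
      = letter_move v (w', k) (letter_move v (w, g) (word_move v ys u))"
  proof -
    consider "w = v" | "w' = v" | "w \<noteq> v" "w' \<noteq> v" by blast
    then show ?thesis
    proof cases
      case 1
      with ww link[of w' k g] e k show ?thesis by (simp add: letter_move_def)
    next
      case 2
      with ww link[of w g k] g show ?thesis by (simp add: letter_move_def)
    next
      case 3
      have "eval_word [(w, g)] \<odot> eval_word [(w', k)] = eval_word [(w', k)] \<odot> eval_word [(w, g)]"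
        using eval_word_swap[OF e g k] eval_word_append[of "[(w, g)]" "[(w', k)]"]
          eval_word_append[of "[(w', k)]" "[(w, g)]"] ww g k by simp
      then show ?thesis
        using 3 map_shift_cong[OF v red, of "shift (eval_word [(w, g)]) \<circ> shift (eval_word [(w', k)])"
            "shift (eval_word [(w', k)]) \<circ> shift (eval_word [(w, g)])"]
          conjugates_closed[OF v] letter_closed ww g k
        by (simp add: letter_move_def shift_shift apfst_compose o_def)
    qed
  qed
  then show "word_move v (xs @ [(w, g), (w', k)] @ ys) u = word_move v (xs @ [(w', k), (w, g)] @ ys) u"
    by simp
qed

abbreviation tree_kernel :: "'v \<Rightarrow> nat \<Rightarrow> ('v, 'g, 'a) conjugate_word \<Rightarrow> ('v, 'g, 'a) conjugate_word \<Rightarrow> 'a" where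
  "tree_kernel v n \<equiv> kernel_family.word_kernel (G v) (\<lambda>i g. act (fst i g)) (\<lambda>i. snd i n)"

lemma tree_kernel_word_move:
  assumes v: "v \<in> V" and "xs \<in> W"
    and "reduced_at v u" "reduced_at v w"
  shows "tree_kernel v n (word_move v xs u) (word_move v xs w) = word_action xs (tree_kernel v n u w)"
  using assms(2)
proof (induction xs)
  case (Cons l xs)
  obtain b g where l: "l = (b, g)" by (cases l)
  have b: "b \<in> V" "g \<in> carrier (G b)" "xs \<in> W" using Cons.prems l by simp_all
  let ?u = "word_move v xs u" and ?w = "word_move v xs w"
  have red: "reduced_at v ?u" "reduced_at v ?w"
    using assms b by (simp_all add: word_move_reduced)
  have ab: "act (eval_word [(b, g)]) = \<alpha> b g" using act_eval_word[of "[(b, g)]"] b by simp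
  have eb: "eval_word [(b, g)] \<in> carrier GP" using b by (simp add: letter_closed)
  have "tree_kernel v n (letter_move v l ?u) (letter_move v l ?w) = \<alpha> b g (tree_kernel v n ?u ?w)"
  proof (cases "b = v")
    case True
    then show ?thesis
      using kernel_family.word_kernel_left_mult[OF kernel_family_conjugates[OF v] base_in_conjugates[OF v] _ red, of g] b l ab
      by (simp add: letter_move_def base_def)
  next
    case False
    have "tree_kernel v n (map (apfst (shift (eval_word [(b, g)]))) ?u) (map (apfst (shift (eval_word [(b, g)]))) ?w)
        = act (eval_word [(b, g)]) (tree_kernel v n ?u ?w)"
    proof (rule kernel_family.word_kernel_map[OF kernel_family_conjugates[OF v] act_automorphism[OF eb] _ _
          shift_conjugates(2)[OF v eb] red])
      interpret GP: group GP by (rule group_graph_product)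
      show "act (fst (shift (eval_word [(b, g)]) i) k) (act (eval_word [(b, g)]) x)
        = act (eval_word [(b, g)]) (act (fst i k) x)" if "i \<in> conjugates v" for i k x
        using eb conjugates_closed[OF v that] by (simp add: shift_def act_mult act_inv)
    qed (simp add: shift_def)
    then show ?thesis using False l ab by (simp add: letter_move_def)
  qed
  then show ?case using Cons.IH[OF b(3)] l by simp
qed simp

definition tree_word :: "'v \<Rightarrow> ('v \<times> 'g) list set set \<Rightarrow> ('v, 'g, 'a) conjugate_word" where
  "tree_word v x = word_move v (rep_word x) []"

lemma tree_word_eval: "v \<in> V \<Longrightarrow> xs \<in> W \<Longrightarrow> tree_word v (eval_word xs) = word_move v xs []"
  unfolding tree_word_def
  using rep_word[OF eval_word_closed, of xs] by (intro word_move_descends) simp_all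

lemma tree_word_reduced: "v \<in> V \<Longrightarrow> x \<in> carrier GP \<Longrightarrow> reduced_at v (tree_word v x)"
  unfolding tree_word_def using rep_word[of x] by (intro word_move_reduced) simp_all

definition group_kernel :: "'v \<Rightarrow> nat \<Rightarrow> ('v \<times> 'g) list set set \<Rightarrow> ('v \<times> 'g) list set set \<Rightarrow> 'a" where
  "group_kernel v n x y = tree_kernel v n (tree_word v x) (tree_word v y)"

text \<open>The tree word of \<open>z x\<close> is the image of the tree word of \<open>x\<close> under the action of \<open>z\<close>.\<close>

lemma group_kernel_invariant:
  assumes "v \<in> V" "z \<in> carrier GP" "x \<in> carrier GP" "y \<in> carrier GP"
  shows "act z (group_kernel v n x y) = group_kernel v n (z \<odot> x) (z \<odot> y)"
proof -
  obtain zs xs ys where eq: "z = eval_word zs" "zs \<in> W" "x = eval_word xs" "xs \<in> W" "y = eval_word ys" "ys \<in> W"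
    using assms by (auto simp: carrier_graph_product)
  have "tree_word v (z \<odot> eval_word us) = word_move v zs (tree_word v (eval_word us))" if "us \<in> W" for us
    using that eq assms(1) by (simp add: eval_word_append[symmetric] tree_word_eval)
  then show ?thesis
    using tree_kernel_word_move[OF assms(1) eq(2) tree_word_reduced[OF assms(1,3)] tree_word_reduced[OF assms(1,4)]] eq
    by (simp add: group_kernel_def act_eval_word)
qed

lemma group_kernel_central:
  assumes "v \<in> V" "x \<in> carrier GP" "y \<in> carrier GP"
  shows "group_kernel v n x y \<in> algebra_center"
  unfolding group_kernel_def
  by (rule kernel_family.word_kernel_central[OF kernel_family_conjugates[OF assms(1)]])
    (use assms tree_word_reduced in auto)

lemma group_kernel_gram:
  assumes "v \<in> V" "finite S" "S \<subseteq> carrier GP"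
  shows "gram S (group_kernel v n)"
  unfolding group_kernel_def
proof (rule gram_comp)
  show "gram (tree_word v ` S) (tree_kernel v n)"
    by (rule kernel_family.gram_word_kernel[OF kernel_family_conjugates[OF assms(1)]])
      (use assms tree_word_reduced in auto)
qed simp

abbreviation tree_tau :: "'v \<Rightarrow> nat \<Rightarrow> ('v, 'g, 'a) conjugate_word \<Rightarrow> 'a" where
  "tree_tau v n \<equiv> kernel_family.tau (G v) (\<lambda>i g. act (fst i g)) (\<lambda>i. snd i n)"

lemma group_kernel_one:
  assumes "v \<in> V"
  shows "group_kernel v n gp_one x = tree_tau v n (tree_word v x)"
  using kernel_family.word_kernel.simps(1)[OF kernel_family_conjugates[OF assms]]
    tree_word_eval[OF assms, of "[]"]
  by (simp add: group_kernel_def eval_word_Nil)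

lemma group_kernel_one_trivial:
  assumes v: "v \<in> V" and "xs \<in> W" "\<And>g. (v, g) \<in> set xs \<Longrightarrow> g = \<one>\<^bsub>G v\<^esub>"
  shows "group_kernel v n gp_one (eval_word xs) = 1"
proof -
  have "word_move v xs [] = []"
    using assms(3)
  proof (induction xs)
    case (Cons l xs)
    then have "fst l = v \<Longrightarrow> snd l = \<one>\<^bsub>G v\<^esub>" by (cases l) auto
    then have "letter_move v l [] = []"
      using left_mult_one[OF groups[OF v], of "conjugates v" "[]" "base v"] by (simp add: letter_move_def)
    with Cons show ?case by simp
  qed simp
  then show ?thesis
    using assms kernel_family.tau.simps(1)[OF kernel_family_conjugates[OF v]]
    by (simp add: group_kernel_one tree_word_eval)
qed

lemma conjugate_kernel_norm:
  assumes "v \<in> V" "i \<in> conjugates v" "g \<in> carrier (G v)"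
  shows "norm (snd i n \<one>\<^bsub>G v\<^esub> g) = norm (h v n g)"
proof -
  obtain x where "x \<in> carrier GP" "i = shift x (base v)" using assms(2) by (auto simp: conjugates_def)
  then show ?thesis
    using assms by (simp add: shift_def base_def vertex_kernel_one star_automorphism_isometric[OF act_automorphism]
        star_automorphism_isometric[OF vertex_action(1)])
qed

lemma norm_tree_tau_le:
  assumes "v \<in> V" "reduced_at v u"
  shows "norm (tree_tau v n u) \<le> (\<Prod>g\<leftarrow>map snd u. norm (h v n g))"
proof -
  have "(\<Prod>(i, g)\<leftarrow>u. norm (snd i n \<one>\<^bsub>G v\<^esub> g)) = (\<Prod>g\<leftarrow>map snd u. norm (h v n g))"
    using assms(2)
  proof (induction u)
    case (Cons l u)
    then show ?case using conjugate_kernel_norm[OF assms(1)] by (cases l) simp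
  qed simp
  then show ?thesis
    using kernel_family.norm_tau_le[OF kernel_family_conjugates[OF assms(1)] assms(2), of n] by simp
qed

lemma tree_tau_tendsto_one:
  assumes v: "v \<in> V" and lim: "\<And>g. g \<in> carrier (G v) \<Longrightarrow> (\<lambda>n. h v n g) \<longlonglongrightarrow> 1"
    and "reduced_at v u"
  shows "(\<lambda>n. tree_tau v n u) \<longlonglongrightarrow> 1"
  using assms(3)
proof (induction u)
  case (Cons l u)
  obtain j g where l: "l = (j, g)" by (cases l)
  have isometric_lim: "(\<lambda>n. f (k n)) \<longlonglongrightarrow> 1" if "f \<in> star_automorphisms" "k \<longlonglongrightarrow> 1" for f and k :: "nat \<Rightarrow> 'a"
  proof -
    have "norm (f (k n) - 1) = norm (k n - 1)" for n
      using star_automorphism_isometric[OF that(1), of "k n - 1"] by (simp add: star_automorphism_simps[OF that(1)])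
    then show ?thesis using that(2) by (simp add: tendsto_iff dist_norm)
  qed
  have j: "j \<in> conjugates v" "g \<in> carrier (G v)" "reduced_at v u"
    using Cons.prems l by simp_all
  obtain x where x: "x \<in> carrier GP" "j = shift x (base v)" using j by (auto simp: conjugates_def)
  have "(\<lambda>n. snd j n \<one>\<^bsub>G v\<^esub> g) \<longlonglongrightarrow> 1"
    using x v j isometric_lim[OF act_automorphism[OF x(1)] isometric_lim[OF vertex_action(1)[OF v j(2)] lim[OF j(2)]]]
    by (simp add: shift_def base_def vertex_kernel_one)
  moreover have "(\<lambda>n. act (fst j g) (tree_tau v n u)) \<longlonglongrightarrow> 1"
    by (rule isometric_lim[OF act_automorphism[OF conjugates_closed[OF v j(1)]] Cons.IH[OF j(3)]])
  ultimately have "(\<lambda>n. snd j n \<one>\<^bsub>G v\<^esub> g * act (fst j g) (tree_tau v n u)) \<longlonglongrightarrow> 1 * 1"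
    by (rule tendsto_mult)
  then show ?case by (simp add: l kernel_family.tau.simps[OF kernel_family_conjugates[OF v]])
qed (simp add: kernel_family.tau.simps[OF kernel_family_conjugates[OF v]])

end

section \<open>Words of minimal length\<close>

context graph_multipliers
begin

definition minimal_word :: "('v \<times> 'g) list \<Rightarrow> bool" where
  "minimal_word xs \<longleftrightarrow> xs \<in> W \<and> (\<forall>ys\<in>W. eval_word ys = eval_word xs \<longrightarrow> length xs \<le> length ys)"

lemma minimal_word_exists:
  assumes "x \<in> carrier GP"
  shows "\<exists>xs. minimal_word xs \<and> eval_word xs = x"
proof -
  have "\<exists>xs. (xs \<in> W \<and> eval_word xs = x)
      \<and> (\<forall>ys. ys \<in> W \<and> eval_word ys = x \<longrightarrow> length xs \<le> length ys)"
    by (rule ex_has_least_nat[of _ "rep_word x"]) (simp add: rep_word[OF assms])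
  then show ?thesis unfolding minimal_word_def by blast
qed

lemma minimal_word_tail:
  assumes "minimal_word (l # xs)"
  shows "minimal_word xs"
proof -
  have W: "[l] \<in> W" "xs \<in> W" using assms by (cases l, simp add: minimal_word_def)+
  have "length xs \<le> length ys" if "ys \<in> W" "eval_word ys = eval_word xs" for ys
  proof -
    have "eval_word ([l] @ ys) = eval_word ([l] @ xs)" using that W by (simp only: eval_word_append)
    moreover have "[l] @ ys \<in> W" using W that by (cases l) simp
    ultimately have "length ([l] @ xs) \<le> length ([l] @ ys)"
      using assms unfolding minimal_word_def append_Cons append_Nil by blast
    then show ?thesis by simp
  qed
  with W show ?thesis by (simp add: minimal_word_def)
qed

lemma minimal_word_letter:
  assumes "minimal_word ((v, g) # xs)"
  shows "g \<noteq> \<one>\<^bsub>G v\<^esub>"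
proof
  assume g: "g = \<one>\<^bsub>G v\<^esub>"
  have W: "v \<in> V" "xs \<in> W" using assms by (simp_all add: minimal_word_def)
  have "eval_word ((v, g) # xs) = eval_word xs"
    using eval_word_rel[OF free_product_rel.one[of "[]" V G xs v]] W g by simp
  then have "length ((v, g) # xs) \<le> length xs" using assms W(2) unfolding minimal_word_def by metis
  then show False by simp
qed

text \<open>In a word of minimal length no two letters of \<open>v\<close> ever meet in the tree word: the first letter of
  the tree word has the base index only if the letters in front of the corresponding letter of the
  original word commute with the group of \<open>v\<close>, and then the word could be shortened.\<close>

lemma tree_word_minimal:
  assumes v: "v \<in> V" and "minimal_word xs"
  shows "map snd (word_move v xs []) = map snd (filter (\<lambda>l. fst l = v) xs)
    \<and> (\<forall>i g u. word_move v xs [] = (i, g) # u \<longrightarrow>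
        (\<exists>as bs. xs = as @ (v, g) # bs \<and> i = shift (eval_word as) (base v)))"
  using assms(2)
proof (induction xs)
  case (Cons l xs)
  interpret GP: group GP by (rule group_graph_product)
  obtain w g where l: "l = (w, g)" by (cases l)
  have W: "w \<in> V" "g \<in> carrier (G w)" "xs \<in> W" using Cons.prems l by (simp_all add: minimal_word_def)
  note IH = Cons.IH[OF minimal_word_tail[OF Cons.prems]]
  let ?u = "word_move v xs []"
  have red: "reduced_at v ?u" using v W by (simp add: word_move_reduced)
  show ?case
  proof (cases "w = v")
    case False
    have move: "word_move v (l # xs) [] = map (apfst (shift (eval_word [l]))) ?u"
      using False l by (simp add: letter_move_def)
    have "\<exists>as bs. l # xs = as @ (v, k) # bs \<and> i = shift (eval_word as) (base v)"
      if first: "word_move v (l # xs) [] = (i, k) # u" for i k u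
    proof -
      obtain j t where "?u = (j, k) # t" "i = shift (eval_word [l]) j"
        using first unfolding move by (cases ?u) (auto simp: apfst_def map_prod_def split: prod.splits)
      moreover then obtain as bs where "xs = as @ (v, k) # bs" "j = shift (eval_word as) (base v)"
        using IH by blast
      moreover then have "as \<in> W" using W by simp
      ultimately have "l # xs = (l # as) @ (v, k) # bs \<and> i = shift (eval_word (l # as)) (base v)"
        using eval_word_append[of "[l]" as] W l v by (simp add: shift_shift eval_word_closed base_closed)
      then show ?thesis by blast
    qed
    then show ?thesis using IH False l unfolding move by (simp add: o_def)
  next
    case True
    have nt: "g \<noteq> \<one>\<^bsub>G v\<^esub>" using minimal_word_letter[of w g xs] Cons.prems l True by simp
    have "\<not> starts_with (base v) ?u"
    proof
      assume "starts_with (base v) ?u"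
      then obtain k u where u: "?u = (base v, k) # u" by (auto simp: starts_with_Cons)
      then obtain as bs where ab: "xs = as @ (v, k) # bs" "base v = shift (eval_word as) (base v)"
        using IH by blast
      have abW: "as \<in> W" "bs \<in> W" "k \<in> carrier (G v)" using W ab by simp_all
      let ?a = "eval_word as" and ?k = "eval_word [(v, k)]"
      have c: "?a \<in> carrier GP" "?k \<in> carrier GP" using abW v by (simp_all add: eval_word_closed)
      have "fst (base v) k = ?a \<odot> fst (base v) k \<odot> gp_inv ?a"
        using ab(2) by (metis shift_def fst_conv)
      then have "?k = ?a \<odot> ?k \<odot> gp_inv ?a" using abW by (simp add: base_def)
      then have "?k \<odot> ?a = ?a \<odot> ?k"
        using c by (metis GP.inv_solve_right GP.m_closed GP.inv_closed)
      then have swap: "eval_word (as @ [(v, k)]) = eval_word ([(v, k)] @ as)"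
        using abW v by (simp only: eval_word_append syllable_words_simps)
      let ?ys = "(v, g \<otimes>\<^bsub>G v\<^esub> k) # as @ bs"
      have "eval_word (l # xs) = eval_word ([(v, g)] @ (as @ [(v, k)]) @ bs)" using ab l True by simp
      also have "\<dots> = eval_word [(v, g)] \<odot> (eval_word ([(v, k)] @ as) \<odot> eval_word bs)"
        using abW v W True swap by (simp only: eval_word_append syllable_words_simps)
      also have "\<dots> = eval_word ([] @ [(v, g), (v, k)] @ (as @ bs))"
        using abW v W True eval_word_append[of "[(v, g)]" "[(v, k)] @ as @ bs"] eval_word_append[of "[(v, k)] @ as" bs]
        by simp
      also have "\<dots> = eval_word ?ys"
        using eval_word_rel[OF free_product_rel.mult[of "[]" V G "as @ bs" v g k]] abW v W True by simp
      finally have "eval_word ?ys = eval_word (l # xs)" by simp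
      moreover have "?ys \<in> W" using abW v W True by (simp add: group_facts)
      ultimately have "length (l # xs) \<le> length ?ys" using Cons.prems unfolding minimal_word_def by blast
      then show False using ab by simp
    qed
    then have move: "word_move v (l # xs) [] = (base v, g) # ?u"
      using groups[OF v] W nt l True
      by (simp add: letter_move_def left_mult_def head_letter_def drop_letter_def cons_letter_def
          group.is_monoid monoid.r_one)
    have "base v = shift (eval_word []) (base v)"
      using v by (simp add: eval_word_Nil shift_one base_closed)
    moreover have "l # xs = [] @ (v, g) # xs" using l True by simp
    ultimately have "\<exists>as bs. l # xs = as @ (v, g) # bs \<and> base v = shift (eval_word as) (base v)"
      by blast
    then show ?thesis unfolding move using IH l True by simp
  qed
qed simp

lemma norm_group_kernel_minimal:
  assumes "v \<in> V" "minimal_word xs"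
  shows "norm (group_kernel v n gp_one (eval_word xs))
    \<le> (\<Prod>l\<leftarrow>filter (\<lambda>l. fst l = v) xs. norm (h v n (snd l)))"
proof -
  have xs: "xs \<in> W" using assms(2) by (simp add: minimal_word_def)
  have "norm (tree_tau v n (word_move v xs [])) \<le> (\<Prod>g\<leftarrow>map snd (word_move v xs []). norm (h v n g))"
    using assms(1) xs by (intro norm_tree_tau_le) (simp_all add: word_move_reduced)
  also have "map snd (word_move v xs []) = map snd (filter (\<lambda>l. fst l = v) xs)"
    using tree_word_minimal[OF assms] by blast
  finally show ?thesis
    using assms(1) xs by (simp add: group_kernel_one tree_word_eval o_def)
qed

end

section \<open>The product over all vertices\<close>

context graph_of_groups
begin

text \<open>The graph product is countable, but the graph need not be: arbitrarily many vertices may carry the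
  trivial group. The vertices defined here can be enumerated.\<close>

definition nontrivial_vertices :: "'v set" where
  "nontrivial_vertices = {v \<in> V. carrier (G v) \<noteq> {\<one>\<^bsub>G v\<^esub>}}"

abbreviation vertex_index :: "'v \<Rightarrow> nat" where
  "vertex_index \<equiv> to_nat_on nontrivial_vertices"

end

lemma prod_list_filter_classes:
  fixes f :: "'b \<Rightarrow> real" and c :: "'b \<Rightarrow> nat"
  assumes "\<And>x. x \<in> set xs \<Longrightarrow> c x < m"
  shows "(\<Prod>j<m. \<Prod>x\<leftarrow>filter (\<lambda>x. c x = j) xs. f x) = (\<Prod>x\<leftarrow>xs. f x)"
  using assms
proof (induction xs)
  case (Cons a xs)
  have "(\<Prod>j<m. \<Prod>x\<leftarrow>filter (\<lambda>x. c x = j) (a # xs). f x)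
      = (\<Prod>j<m. (if j = c a then f a else 1) * (\<Prod>x\<leftarrow>filter (\<lambda>x. c x = j) xs. f x))"
    by (rule prod.cong) auto
  also have "\<dots> = (\<Prod>j<m. if j = c a then f a else 1) * (\<Prod>x\<leftarrow>xs. f x)"
    unfolding prod.distrib using Cons by simp
  also have "(\<Prod>j<m. if j = c a then f a else 1) = f a"
    using Cons.prems[of a] by (subst prod.delta) simp_all
  finally show ?case by simp
qed simp

lemma prod_list_bounds:
  fixes f :: "'b \<Rightarrow> real"
  assumes "\<And>x. x \<in> set xs \<Longrightarrow> 0 \<le> f x \<and> f x \<le> q" "0 \<le> q" "q \<le> 1"
  shows "0 \<le> (\<Prod>x\<leftarrow>xs. f x)" "(\<Prod>x\<leftarrow>xs. f x) \<le> q ^ length xs"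
    "x \<in> set xs \<Longrightarrow> (\<Prod>x\<leftarrow>xs. f x) \<le> f x"
proof -
  have "0 \<le> (\<Prod>x\<leftarrow>xs. f x) \<and> (\<Prod>x\<leftarrow>xs. f x) \<le> q ^ length xs \<and> (\<forall>x\<in>set xs. (\<Prod>x\<leftarrow>xs. f x) \<le> f x)"
    using assms(1)
  proof (induction xs)
    case (Cons a xs)
    let ?p = "\<Prod>x\<leftarrow>xs. f x"
    have IH: "0 \<le> ?p" "?p \<le> q ^ length xs" "\<forall>x\<in>set xs. ?p \<le> f x" using Cons by auto
    have a: "0 \<le> f a" "f a \<le> q" using Cons.prems by auto
    have "q ^ length xs \<le> 1" using assms by (simp add: power_le_one)
    then have "?p \<le> 1" using IH(2) by linarith
    then have "f a * ?p \<le> f a" using a by (simp add: mult_left_le)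
    moreover have "f a * ?p \<le> ?p" using a assms(3) IH(1) by (intro mult_left_le_one_le) simp_all
    moreover have "f a * ?p \<le> q * q ^ length xs" using a IH assms(2) by (intro mult_mono) auto
    ultimately show ?case using IH a by (auto intro: order_trans)
  qed simp
  then show "0 \<le> (\<Prod>x\<leftarrow>xs. f x)" "(\<Prod>x\<leftarrow>xs. f x) \<le> q ^ length xs"
    "x \<in> set xs \<Longrightarrow> (\<Prod>x\<leftarrow>xs. f x) \<le> f x" by simp_all
qed

context graph_multipliers
begin

text \<open>A nontrivial letter of \<open>v\<close> has a tree word of length one at \<open>v\<close>, a letter of any other vertex has an
  empty one. So nontrivial letters of different vertices are different in the graph product.\<close>

lemma countable_nontrivial_vertices:
  assumes "countable (carrier GP)"
  shows "countable nontrivial_vertices"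
proof -
  define g where "g v = (SOME g. g \<in> carrier (G v) \<and> g \<noteq> \<one>\<^bsub>G v\<^esub>)" for v
  have g: "v \<in> V" "g v \<in> carrier (G v)" "g v \<noteq> \<one>\<^bsub>G v\<^esub>" if "v \<in> nontrivial_vertices" for v
  proof -
    show v: "v \<in> V" using that by (simp add: nontrivial_vertices_def)
    have "\<exists>g. g \<in> carrier (G v) \<and> g \<noteq> \<one>\<^bsub>G v\<^esub>"
      using that group_facts(1)[OF v] by (auto simp: nontrivial_vertices_def)
    then have "g v \<in> carrier (G v) \<and> g v \<noteq> \<one>\<^bsub>G v\<^esub>" unfolding g_def by (rule someI_ex)
    then show "g v \<in> carrier (G v)" "g v \<noteq> \<one>\<^bsub>G v\<^esub>" by simp_all
  qed
  have "inj_on (\<lambda>v. eval_word [(v, g v)]) nontrivial_vertices"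
  proof (rule inj_onI)
    fix v w assume vw: "v \<in> nontrivial_vertices" "w \<in> nontrivial_vertices"
      and eq: "eval_word [(v, g v)] = eval_word [(w, g w)]"
    have "word_move v [(v, g v)] [] = word_move v [(w, g w)] []"
      by (rule word_move_descends[OF g(1)[OF vw(1)] _ _ _ eq]) (use g vw in simp_all)
    moreover have "word_move v [(v, g v)] [] \<noteq> []"
      using g[OF vw(1)] groups[OF g(1)[OF vw(1)]]
      by (simp add: letter_move_def left_mult_def head_letter_def drop_letter_def cons_letter_def
          group.is_monoid monoid.r_one)
    ultimately show "v = w" by (cases "w = v") (simp_all add: letter_move_def)
  qed
  moreover have "countable ((\<lambda>v. eval_word [(v, g v)]) ` nontrivial_vertices)"
    by (rule countable_subset[OF _ assms]) (use g letter_closed in auto)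
  ultimately show ?thesis by (rule countable_image_inj_on[rotated])
qed

abbreviation "indexed j \<equiv> j \<in> vertex_index ` nontrivial_vertices"
abbreviation "vertex_at \<equiv> inv_into nontrivial_vertices vertex_index"

definition factor :: "nat \<Rightarrow> nat \<Rightarrow> ('v \<times> 'g) list set set \<Rightarrow> ('v \<times> 'g) list set set \<Rightarrow> 'a" where
  "factor n j x y = (if indexed j
     then group_kernel (vertex_at j) n x y else 1)"

definition partial_kernel :: "nat \<Rightarrow> nat \<Rightarrow> ('v \<times> 'g) list set set \<Rightarrow> ('v \<times> 'g) list set set \<Rightarrow> 'a" where
  "partial_kernel n m x y = (\<Prod>j\<leftarrow>[0..<m]. factor n j x y)"

text \<open>For given arguments all but finitely many factors are one, so the limit is a finite product.\<close>

definition total_kernel :: "nat \<Rightarrow> ('v \<times> 'g) list set set \<Rightarrow> ('v \<times> 'g) list set set \<Rightarrow> 'a" where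
  "total_kernel n x y = lim (\<lambda>m. partial_kernel n m x y)"

definition total_multiplier :: "nat \<Rightarrow> ('v \<times> 'g) list set set \<Rightarrow> 'a" where
  "total_multiplier n s = act (gp_inv s) (total_kernel n gp_one s)"

lemma partial_kernel_simps:
  "partial_kernel n 0 x y = 1"
  "partial_kernel n (Suc m) x y = partial_kernel n m x y * factor n m x y"
  by (simp_all add: partial_kernel_def)

lemma indexed_vertex:
  assumes "indexed j"
  shows "vertex_at j \<in> V"
  using inv_into_into[OF assms] by (simp add: nontrivial_vertices_def)

lemma gp_one_closed: "gp_one \<in> carrier GP"
  using group_graph_product by (simp add: group.is_monoid monoid.one_closed)

lemma factor_central: "x \<in> carrier GP \<Longrightarrow> y \<in> carrier GP \<Longrightarrow> factor n j x y \<in> algebra_center"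
  by (simp add: factor_def group_kernel_central indexed_vertex center_closed)

lemma factor_invariant:
  assumes "z \<in> carrier GP" "x \<in> carrier GP" "y \<in> carrier GP"
  shows "act z (factor n j x y) = factor n j (z \<odot> x) (z \<odot> y)"
  using assms
  by (simp add: factor_def group_kernel_invariant indexed_vertex star_automorphism_simps[OF act_automorphism])

lemma partial_kernel_central:
  "x \<in> carrier GP \<Longrightarrow> y \<in> carrier GP \<Longrightarrow> partial_kernel n m x y \<in> algebra_center"
  by (induction m) (simp_all add: partial_kernel_simps center_closed factor_central)

lemma partial_kernel_invariant:
  assumes "z \<in> carrier GP" "x \<in> carrier GP" "y \<in> carrier GP"
  shows "act z (partial_kernel n m x y) = partial_kernel n m (z \<odot> x) (z \<odot> y)"
  by (induction m)
    (simp_all add: partial_kernel_simps star_automorphism_simps[OF act_automorphism[OF assms(1)]]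
      factor_invariant[OF assms])

lemma partial_kernel_gram:
  assumes "finite S" "S \<subseteq> carrier GP"
  shows "gram S (partial_kernel n m)"
proof (induction m)
  case 0
  show ?case by (rule gram_cong[OF gram_rank_one[of S "\<lambda>_. 1"]]) (simp add: partial_kernel_simps)
next
  case (Suc m)
  have "gram S (factor n m)"
  proof (cases "indexed m")
    case True
    then show ?thesis
      using group_kernel_gram[OF indexed_vertex assms] by (rule_tac gram_cong) (auto simp: factor_def)
  next
    case False
    then show ?thesis by (intro gram_cong[OF gram_rank_one[of S "\<lambda>_. 1"]]) (simp add: factor_def)
  qed
  then have "gram S (\<lambda>x y. partial_kernel n m x y * factor n m x y)"
    using Suc assms(2) by (intro gram_schur_product) (auto intro: factor_central)
  then show ?case by (rule gram_cong) (simp add: partial_kernel_simps)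
qed

lemma factor_one:
  assumes "xs \<in> W" "\<And>l. l \<in> set xs \<Longrightarrow> vertex_index (fst l) \<noteq> j"
  shows "factor n j gp_one (eval_word xs) = 1"
proof (cases "indexed j")
  case True
  let ?v = "vertex_at j"
  have "vertex_index ?v = j" by (rule f_inv_into_f[OF True])
  then have "(?v, g) \<notin> set xs" for g using assms(2)[of "(?v, g)"] by auto
  then show ?thesis
    using group_kernel_one_trivial[OF indexed_vertex[OF True] assms(1)] True by (simp add: factor_def)
qed (simp add: factor_def)

lemma total_kernel_eq_partial:
  assumes "\<And>j. k \<le> j \<Longrightarrow> factor n j x y = 1"
  shows "total_kernel n x y = partial_kernel n k x y"
proof -
  have "partial_kernel n m x y = partial_kernel n k x y" if "k \<le> m" for m
    using that by (induction m rule: dec_induct) (simp_all add: partial_kernel_simps assms)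
  then have "eventually (\<lambda>m. partial_kernel n m x y = partial_kernel n k x y) sequentially"
    by (rule eventually_sequentiallyI)
  then show ?thesis
    unfolding total_kernel_def by (intro limI tendsto_eventually)
qed

lemma factor_eventually_one:
  assumes "x \<in> carrier GP" "y \<in> carrier GP"
  shows "\<exists>k. \<forall>n. \<forall>j\<ge>k. factor n j x y = 1"
proof -
  interpret GP: group GP by (rule group_graph_product)
  have s: "gp_inv x \<odot> y \<in> carrier GP" using assms by simp
  obtain xs where xs: "xs \<in> W" "eval_word xs = gp_inv x \<odot> y" using rep_word[OF s] by blast
  have "finite ((\<lambda>l. vertex_index (fst l)) ` set xs)" by simp
  then obtain k where k: "\<forall>j\<in>(\<lambda>l. vertex_index (fst l)) ` set xs. j < k"
    unfolding finite_nat_set_iff_bounded by blast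
  have "factor n j x y = 1" if "k \<le> j" for n j
  proof -
    have "factor n j gp_one (gp_inv x \<odot> y) = 1"
      using factor_one[OF xs(1), of j n] k that unfolding xs(2) by force
    then have "factor n j (x \<odot> gp_one) (x \<odot> (gp_inv x \<odot> y)) = act x 1"
      using factor_invariant[OF assms(1) gp_one_closed s] by metis
    then show ?thesis
      using assms by (simp add: star_automorphism_simps[OF act_automorphism] GP.m_assoc[symmetric])
  qed
  then show ?thesis by blast
qed

lemma total_kernel_finite_product:
  assumes "finite S" "S \<subseteq> carrier GP"
  shows "\<exists>k. \<forall>x\<in>S. \<forall>y\<in>S. \<forall>n. total_kernel n x y = partial_kernel n k x y"
proof -
  have "\<forall>p\<in>S \<times> S. \<exists>k. \<forall>n. \<forall>j\<ge>k. factor n j (fst p) (snd p) = 1"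
    using factor_eventually_one assms(2) by auto
  then obtain k where k: "\<forall>p\<in>S \<times> S. \<forall>n. \<forall>j\<ge>k p. factor n j (fst p) (snd p) = 1" by metis
  have fin: "finite (k ` (S \<times> S))" using assms(1) by simp
  define m where "m = Max (insert 0 (k ` (S \<times> S)))"
  have "total_kernel n x y = partial_kernel n m x y" if "x \<in> S" "y \<in> S" for x y n
  proof (rule total_kernel_eq_partial)
    fix j assume "m \<le> j"
    moreover have "k (x, y) \<le> m" unfolding m_def using that fin by (intro Max_ge) auto
    ultimately have "k (x, y) \<le> j" by simp
    then show "factor n j x y = 1" using k that by force
  qed
  then show ?thesis by blast
qed

lemma total_kernel_central:
  assumes "x \<in> carrier GP" "y \<in> carrier GP"
  shows "total_kernel n x y \<in> algebra_center"
proof -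
  obtain k where "total_kernel n x y = partial_kernel n k x y"
    using total_kernel_finite_product[of "{x, y}"] assms by auto
  then show ?thesis by (simp add: partial_kernel_central assms)
qed

lemma total_kernel_gram:
  assumes "finite S" "S \<subseteq> carrier GP"
  shows "gram S (total_kernel n)"
proof -
  obtain k where "\<forall>x\<in>S. \<forall>y\<in>S. \<forall>n. total_kernel n x y = partial_kernel n k x y"
    using total_kernel_finite_product[OF assms] by blast
  then show ?thesis by (intro gram_cong[OF partial_kernel_gram[OF assms, of n k]]) simp
qed

lemma total_kernel_invariant:
  assumes "z \<in> carrier GP" "x \<in> carrier GP" "y \<in> carrier GP"
  shows "act z (total_kernel n x y) = total_kernel n (z \<odot> x) (z \<odot> y)"
proof -
  interpret GP: group GP by (rule group_graph_product)
  let ?S = "{x, y, z \<odot> x, z \<odot> y}"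
  obtain k where "\<forall>x\<in>?S. \<forall>y\<in>?S. \<forall>n. total_kernel n x y = partial_kernel n k x y"
    using total_kernel_finite_product[of ?S] assms by auto
  then show ?thesis by (simp add: partial_kernel_invariant assms)
qed

lemma act_total_multiplier:
  assumes "x \<in> carrier GP" "y \<in> carrier GP"
  shows "act y (total_multiplier n (gp_inv x \<odot> y)) = total_kernel n x y"
proof -
  interpret GP: group GP by (rule group_graph_product)
  let ?s = "gp_inv x \<odot> y"
  have s: "?s \<in> carrier GP" using assms by simp
  have "act y (total_multiplier n ?s) = act (y \<odot> gp_inv ?s) (total_kernel n gp_one ?s)"
    using assms s by (simp only: total_multiplier_def act_mult GP.inv_closed)
  also have "y \<odot> gp_inv ?s = x"
    using assms by (simp add: GP.inv_mult_group GP.m_assoc[symmetric])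
  also have "act x (total_kernel n gp_one ?s) = total_kernel n x y"
    using assms s by (simp add: total_kernel_invariant GP.m_assoc[symmetric])
  finally show ?thesis .
qed

theorem positive_definite_total_multiplier: "positive_definite_multiplier GP act (total_multiplier n)"
  unfolding positive_definite_multiplier_def positive_matrix_iff_gram
proof (intro conjI allI impI funcsetI)
  interpret GP: group GP by (rule group_graph_product)
  show "total_multiplier n s \<in> algebra_center" if "s \<in> carrier GP" for s
    using that unfolding total_multiplier_def
    by (intro center_automorphism[OF act_automorphism] total_kernel_central) simp_all
  fix m :: nat and x assume x: "\<forall>i<m. x i \<in> carrier GP"
  have "gram {..<m} (\<lambda>i j. total_kernel n (x i) (x j))"
    using x by (intro gram_comp[OF total_kernel_gram[of "x ` {..<m}"]]) auto
  then show "gram {..<m} (\<lambda>i j. act (x j) (total_multiplier n (gp_inv (x i) \<odot> x j)))"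
    by (rule gram_cong) (simp add: act_total_multiplier x)
qed

lemma norm_total_multiplier:
  "s \<in> carrier GP \<Longrightarrow> norm (total_multiplier n s) = norm (total_kernel n gp_one s)"
  unfolding total_multiplier_def using group_graph_product
  by (intro star_automorphism_isometric act_automorphism group.inv_closed)

lemma norm_total_multiplier_minimal:
  assumes c: "countable nontrivial_vertices" and min: "minimal_word xs"
    and nontrivial: "\<And>l. l \<in> set xs \<Longrightarrow> fst l \<in> nontrivial_vertices"
  shows "norm (total_multiplier n (eval_word xs)) \<le> (\<Prod>l\<leftarrow>xs. norm (h (fst l) n (snd l)))"
proof -
  have xs: "xs \<in> W" using min by (simp add: minimal_word_def)
  let ?f = "\<lambda>l. norm (h (fst l) n (snd l))" and ?c = "\<lambda>l. vertex_index (fst l)"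
  have "finite (?c ` set xs)" by simp
  then obtain k where "\<forall>j\<in>?c ` set xs. j < k" unfolding finite_nat_set_iff_bounded by blast
  then have k: "?c l < k" if "l \<in> set xs" for l using that by blast
  have factor: "norm (factor n j gp_one (eval_word xs)) \<le> (\<Prod>l\<leftarrow>filter (\<lambda>l. ?c l = j) xs. ?f l)" for j
  proof (cases "j \<in> ?c ` set xs")
    case True
    then obtain l where l: "l \<in> set xs" "j = vertex_index (fst l)" by blast
    note v = nontrivial[OF l(1)]
    have inj: "inj_on vertex_index nontrivial_vertices" by (rule inj_on_to_nat_on[OF c])
    have inv: "vertex_at j = fst l"
      unfolding l(2) by (rule inv_into_f_f[OF inj v])
    have V: "fst l \<in> V" using v by (simp add: nontrivial_vertices_def)
    have "filter (\<lambda>l. ?c l = j) xs = filter (\<lambda>l'. fst l' = fst l) xs"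
      using nontrivial v inj l(2) by (intro filter_cong) (auto dest: inj_onD)
    moreover have "factor n j gp_one (eval_word xs) = group_kernel (fst l) n gp_one (eval_word xs)"
      using v l(2) inv by (auto simp: factor_def)
    moreover have "(\<Prod>l'\<leftarrow>filter (\<lambda>l'. fst l' = fst l) xs. norm (h (fst l) n (snd l')))
        = (\<Prod>l'\<leftarrow>filter (\<lambda>l'. fst l' = fst l) xs. ?f l')"
      by (intro arg_cong[where f = prod_list] map_cong) auto
    ultimately show ?thesis using norm_group_kernel_minimal[OF V min, of n] by simp
  next
    case False
    then have "factor n j gp_one (eval_word xs) = 1" by (intro factor_one[OF xs]) auto
    moreover have "filter (\<lambda>l. ?c l = j) xs = []" using False by (auto simp: filter_empty_conv)
    ultimately show ?thesis by (simp add: norm_one_le)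
  qed
  have "factor n j gp_one (eval_word xs) = 1" if "k \<le> j" for j
    using factor_one[OF xs, of j n] k that by force
  then have "total_kernel n gp_one (eval_word xs) = partial_kernel n k gp_one (eval_word xs)"
    by (rule total_kernel_eq_partial)
  moreover have "norm (partial_kernel n m gp_one (eval_word xs))
      \<le> (\<Prod>j<m. \<Prod>l\<leftarrow>filter (\<lambda>l. ?c l = j) xs. ?f l)" for m
  proof (induction m)
    case (Suc m)
    let ?p = "norm (partial_kernel n m gp_one (eval_word xs))"
    have "norm (partial_kernel n (Suc m) gp_one (eval_word xs))
        \<le> ?p * norm (factor n m gp_one (eval_word xs))"
      unfolding partial_kernel_simps by (rule norm_mult_ineq)
    also have "\<dots> \<le> (\<Prod>j<m. \<Prod>l\<leftarrow>filter (\<lambda>l. ?c l = j) xs. ?f l) * (\<Prod>l\<leftarrow>filter (\<lambda>l. ?c l = m) xs. ?f l)"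
      by (intro mult_mono Suc factor order_trans[OF norm_ge_zero Suc]) simp
    finally show ?case by simp
  qed (simp add: partial_kernel_simps norm_one_le)
  ultimately have "norm (total_kernel n gp_one (eval_word xs)) \<le> (\<Prod>j<k. \<Prod>l\<leftarrow>filter (\<lambda>l. ?c l = j) xs. ?f l)"
    by simp
  also have "\<dots> = (\<Prod>l\<leftarrow>xs. ?f l)" by (rule prod_list_filter_classes) (rule k)
  finally show ?thesis using norm_total_multiplier[OF eval_word_closed[OF xs]] by simp
qed

text \<open>The multiplier is at most a product of numbers below one, taken over the letters of a word of
  minimal length. If this product is at least \<open>\<epsilon>\<close> then so is every factor, which leaves finitely many
  letters, and the length of the word is bounded as well.\<close>

lemma total_multiplier_C0:
  assumes c: "countable nontrivial_vertices"
    and q: "0 < q" "q < 1"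
      "\<And>v g. v \<in> V \<Longrightarrow> g \<in> carrier (G v) \<Longrightarrow> g \<noteq> \<one>\<^bsub>G v\<^esub> \<Longrightarrow> norm (h v n g) \<le> q"
    and fin: "\<And>\<epsilon>. 0 < \<epsilon> \<Longrightarrow> finite {(v, g). v \<in> nontrivial_vertices \<and> g \<in> carrier (G v)
      \<and> g \<noteq> \<one>\<^bsub>G v\<^esub> \<and> \<epsilon> \<le> norm (h v n g)}"
  shows "total_multiplier n \<in> C0 GP"
  unfolding C0_def
proof (intro CollectI allI impI)
  fix \<epsilon> :: real assume \<epsilon>: "0 < \<epsilon>"
  define A where "A = {(v, g). v \<in> nontrivial_vertices \<and> g \<in> carrier (G v) \<and> g \<noteq> \<one>\<^bsub>G v\<^esub> \<and> \<epsilon> \<le> norm (h v n g)}"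
  obtain L where L: "q ^ L < \<epsilon>" using real_arch_pow_inv[OF \<epsilon> q(2)] by blast
  let ?X = "{xs. set xs \<subseteq> A \<and> length xs \<le> L}"
  have "xs \<in> W" if "set xs \<subseteq> A" for xs
    using that by (induction xs) (auto simp: A_def nontrivial_vertices_def)
  then have sub: "eval_word ` ?X \<subseteq> carrier GP" by (auto intro: eval_word_closed)
  have finX: "finite (eval_word ` ?X)"
    using fin[OF \<epsilon>] by (intro finite_imageI finite_lists_length_le) (simp add: A_def)
  have "norm (total_multiplier n s) < \<epsilon>" if s: "s \<in> carrier GP - eval_word ` ?X" for s
  proof (rule ccontr)
    assume "\<not> norm (total_multiplier n s) < \<epsilon>"
    obtain xs where xs: "minimal_word xs" "eval_word xs = s" using minimal_word_exists s by blast
    have letters: "fst l \<in> V \<and> snd l \<in> carrier (G (fst l)) \<and> snd l \<noteq> \<one>\<^bsub>G (fst l)\<^esub>" if "l \<in> set xs" for l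
      using xs(1) that
    proof (induction xs)
      case (Cons a xs)
      obtain v g where a: "a = (v, g)" by (cases a)
      have "v \<in> V" "g \<in> carrier (G v)" using Cons.prems(1) a by (simp_all add: minimal_word_def)
      then show ?case
        using Cons.IH[OF minimal_word_tail[OF Cons.prems(1)]] Cons.prems(2) a
          minimal_word_letter[of v g xs] Cons.prems(1) by auto
    qed simp
    have nontrivial: "fst l \<in> nontrivial_vertices" if "l \<in> set xs" for l
      using letters[OF that] by (auto simp: nontrivial_vertices_def)
    let ?f = "\<lambda>l. norm (h (fst l) n (snd l))"
    have f: "0 \<le> ?f l \<and> ?f l \<le> q" if "l \<in> set xs" for l using letters[OF that] q(3) by simp
    have \<epsilon>_le: "\<epsilon> \<le> (\<Prod>l\<leftarrow>xs. ?f l)"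
      using norm_total_multiplier_minimal[OF c xs(1) nontrivial, of n] xs(2)
        \<open>\<not> norm (total_multiplier n s) < \<epsilon>\<close> by simp
    have q': "0 \<le> q" "q \<le> 1" using q by simp_all
    note bounds = prod_list_bounds[of xs ?f q, OF f q']
    have "\<epsilon> \<le> ?f l" if "l \<in> set xs" for l
      using bounds(3)[OF _ that] \<epsilon>_le by simp
    then have "l \<in> A" if "l \<in> set xs" for l
      using letters[OF that] nontrivial[OF that] that by (cases l) (force simp: A_def)
    then have "set xs \<subseteq> A" by blast
    moreover have "length xs \<le> L"
    proof (rule ccontr)
      assume "\<not> length xs \<le> L"
      then have "q ^ length xs \<le> q ^ L" using q' by (intro power_decreasing) simp_all
      then show False using bounds(2) \<epsilon>_le L by linarith
    qed
    ultimately show False using s xs(2) by blast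
  qed
  then show "\<exists>F. finite F \<and> F \<subseteq> carrier GP \<and> (\<forall>s\<in>carrier GP - F. norm (total_multiplier n s) < \<epsilon>)"
    using sub finX by blast
qed

lemma total_multiplier_tendsto_one:
  assumes lim: "\<And>v g. v \<in> V \<Longrightarrow> g \<in> carrier (G v) \<Longrightarrow> (\<lambda>n. h v n g) \<longlonglongrightarrow> 1"
    and s: "s \<in> carrier GP"
  shows "(\<lambda>n. norm (total_multiplier n s - 1)) \<longlonglongrightarrow> 0"
proof -
  interpret GP: group GP by (rule group_graph_product)
  obtain k where "\<forall>x\<in>{gp_one, s}. \<forall>y\<in>{gp_one, s}. \<forall>n. total_kernel n x y = partial_kernel n k x y"
    using total_kernel_finite_product[of "{gp_one, s}"] s by auto
  then have k: "total_kernel n gp_one s = partial_kernel n k gp_one s" for n by simp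
  have factor: "(\<lambda>n. factor n j gp_one s) \<longlonglongrightarrow> 1" for j
  proof (cases "indexed j")
    case True
    note V = indexed_vertex[OF True]
    show ?thesis
      using True tree_tau_tendsto_one[OF V lim[OF V] tree_word_reduced[OF V s]]
      by (simp add: factor_def group_kernel_one[OF V])
  qed (simp add: factor_def)
  have "(\<lambda>n. partial_kernel n m gp_one s) \<longlonglongrightarrow> 1" for m
  proof (induction m)
    case (Suc m)
    from tendsto_mult[OF Suc factor[of m]] show ?case by (simp add: partial_kernel_simps)
  qed (simp add: partial_kernel_simps)
  then have "(\<lambda>n. norm (total_kernel n gp_one s - 1)) \<longlonglongrightarrow> 0"
    unfolding k by (simp add: LIM_zero tendsto_norm_zero)
  moreover have "norm (total_multiplier n s - 1) = norm (total_kernel n gp_one s - 1)" for n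
    using star_automorphism_isometric[OF act_automorphism, of "gp_inv s" "total_kernel n gp_one s - 1"] s
    by (simp add: total_multiplier_def star_automorphism_simps[OF act_automorphism])
  ultimately show ?thesis by simp
qed

lemma norm_multiplier_le_one:
  assumes "v \<in> V" "g \<in> carrier (G v)"
  shows "norm (h v n g) \<le> 1"
proof -
  have "gram {\<one>\<^bsub>G v\<^esub>, g} (vertex_kernel v n)"
    using assms by (intro vertex_kernel_gram) (auto simp: group_facts)
  from gram_norm_le_one[OF this, of g "\<one>\<^bsub>G v\<^esub>"]
  have "norm (vertex_kernel v n \<one>\<^bsub>G v\<^esub> g) \<le> 1"
    using assms by (simp add: vertex_kernel_unit group_facts)
  then show ?thesis
    using assms by (simp add: vertex_kernel_one star_automorphism_isometric[OF vertex_action(1)])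
qed

end

text \<open>Mixing a multiplier with the positive definite function that is one at the identity and zero
  elsewhere scales it by \<open>r\<close> away from the identity.\<close>

definition damp :: "('g, 'm) monoid_scheme \<Rightarrow> real \<Rightarrow> ('g \<Rightarrow> 'a::unital_cstar_algebra) \<Rightarrow> 'g \<Rightarrow> 'a" where
  "damp G r h g = (if g = \<one>\<^bsub>G\<^esub> then 1 else r *\<^sub>R h g)"

lemma center_scaleR: "a \<in> algebra_center \<Longrightarrow> r *\<^sub>R a \<in> algebra_center"
  by (simp add: algebra_center_def)

lemma positive_definite_damp:
  assumes G: "group G" and \<alpha>: "\<And>g. g \<in> carrier G \<Longrightarrow> \<alpha> g \<in> star_automorphisms"
    and h: "positive_definite_multiplier G \<alpha> h" "h \<one>\<^bsub>G\<^esub> = 1" and r: "0 \<le> r" "r \<le> 1"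
  shows "positive_definite_multiplier G \<alpha> (damp G r h)"
  unfolding positive_definite_multiplier_def positive_matrix_iff_gram
proof (intro conjI allI impI funcsetI)
  interpret group G by (rule G)
  show "damp G r h g \<in> algebra_center" if "g \<in> carrier G" for g
    using h(1) that by (auto simp: damp_def positive_definite_multiplier_def center_closed intro!: center_scaleR)
  fix n :: nat and x assume x: "\<forall>i<n. x i \<in> carrier G"
  have "gram {..<n} (\<lambda>i j. \<alpha> (x j) (h (inv\<^bsub>G\<^esub> x i \<otimes>\<^bsub>G\<^esub> x j)))"
    using h(1) x by (simp add: positive_definite_multiplier_def positive_matrix_iff_gram)
  moreover have "gram {..<n} (\<lambda>i j. if x i = x j then 1 else 0)"
    by (rule gram_comp[OF gram_identity[of "x ` {..<n}"]]) simp_all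
  ultimately have "gram {..<n} (\<lambda>i j. r *\<^sub>R \<alpha> (x j) (h (inv\<^bsub>G\<^esub> x i \<otimes>\<^bsub>G\<^esub> x j))
      + (1 - r) *\<^sub>R (if x i = x j then 1 else 0))"
    using r by (intro gram_add gram_scaleR) simp_all
  then show "gram {..<n} (\<lambda>i j. \<alpha> (x j) (damp G r h (inv\<^bsub>G\<^esub> x i \<otimes>\<^bsub>G\<^esub> x j)))"
  proof (rule gram_cong)
    fix i j assume "i \<in> {..<n}" "j \<in> {..<n}"
    then have c: "x i \<in> carrier G" "x j \<in> carrier G" using x by simp_all
    note a = star_automorphism_simps[OF \<alpha>[OF c(2)]]
    have "inv\<^bsub>G\<^esub> x i \<otimes>\<^bsub>G\<^esub> x j = \<one>\<^bsub>G\<^esub> \<longleftrightarrow> x i = x j"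
    proof
      assume "inv\<^bsub>G\<^esub> x i \<otimes>\<^bsub>G\<^esub> x j = \<one>\<^bsub>G\<^esub>"
      then have "x i \<otimes>\<^bsub>G\<^esub> (inv\<^bsub>G\<^esub> x i \<otimes>\<^bsub>G\<^esub> x j) = x i" using c by simp
      then show "x i = x j" using c by (simp add: m_assoc[symmetric])
    qed (use c in simp)
    then show "r *\<^sub>R \<alpha> (x j) (h (inv\<^bsub>G\<^esub> x i \<otimes>\<^bsub>G\<^esub> x j)) + (1 - r) *\<^sub>R (if x i = x j then 1 else 0)
        = \<alpha> (x j) (damp G r h (inv\<^bsub>G\<^esub> x i \<otimes>\<^bsub>G\<^esub> x j))"
      using h(2) by (auto simp: damp_def a scaleR_left_diff_distrib)
  qed
qed

section \<open>The Haagerup property of graph products\<close>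

theorem theorem5p3:
  fixes V :: "'v set" and E :: "('v \<times> 'v) set"
    and G :: "'v \<Rightarrow> ('g, 'm) monoid_scheme"
    and \<alpha> :: "'v \<Rightarrow> 'g \<Rightarrow> 'a::unital_cstar_algebra \<Rightarrow> 'a"
    and h :: "'v \<Rightarrow> nat \<Rightarrow> 'g \<Rightarrow> 'a"
  assumes "simplicial_graph V E"
    and "\<And>v. v \<in> V \<Longrightarrow> group (G v)"
    and "\<And>v. v \<in> V \<Longrightarrow> countable (carrier (G v))"
    and "countable (carrier (graph_product V E G))"
    and "\<And>v. v \<in> V \<Longrightarrow> cstar_action (G v) (\<alpha> v)"
    and "actions_commute E G \<alpha>"
    and "\<And>v. v \<in> V \<Longrightarrow> haagerup_witness (G v) (\<alpha> v) (h v)"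
    and "\<And>v n. v \<in> V \<Longrightarrow> unital_multiplier (G v) (h v n)"
    and "\<And>n. multipliers_commute E G \<alpha> (\<lambda>v. h v n)"
  shows "haagerup_property (graph_product V E G) (graph_product_action V E G \<alpha>)"
proof -
  interpret A: graph_action V E G \<alpha>
    by (intro graph_action.intro graph_of_groups.intro graph_action_axioms.intro) (fact assms)+
  have pd: "positive_definite_multiplier (G v) (\<alpha> v) (h v n)" and c0: "h v n \<in> C0 (G v)" if "v \<in> V" for v n
    using assms(7)[OF that] by (simp_all add: haagerup_witness_def)
  interpret H: graph_multipliers V E G \<alpha> h
    by unfold_locales (fact pd assms)+
  let ?c = "A.vertex_index"
  have countable: "countable A.nontrivial_vertices"
    by (rule H.countable_nontrivial_vertices[OF assms(4)])
  \<comment> \<open>For fixed \<open>n\<close> the weight is bounded away from one and tends to zero along the vertices; for a fixed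
    vertex it tends to one.\<close>
  define r where "r v n = exp (- (real (?c v) + 1) / (real n + 1))" for v n
  define d where "d v n = damp (G v) (r v n) (h v n)" for v n
  have r: "0 \<le> r v n" "r v n \<le> 1" "r v n \<le> exp (- 1 / (real n + 1))" for v n
  proof -
    show "r v n \<le> exp (- 1 / (real n + 1))"
      unfolding r_def exp_le_cancel_iff by (intro divide_right_mono) simp_all
    also have "\<dots> \<le> 1" by simp
    finally show "r v n \<le> 1" .
  qed (simp add: r_def)
  have unital: "h v n \<one>\<^bsub>G v\<^esub> = 1" if "v \<in> V" for v n
    using assms(8)[OF that] by (simp add: unital_multiplier_def)
  interpret D: graph_multipliers V E G \<alpha> d
  proof
    show "positive_definite_multiplier (G v) (\<alpha> v) (d v n)" if "v \<in> V" for v n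
      unfolding d_def
      by (rule positive_definite_damp[OF assms(2)[OF that] A.vertex_action(1)[OF that] pd[OF that] unital[OF that] r(1,2)])
    show "unital_multiplier (G v) (d v n)" for v n
      by (simp add: unital_multiplier_def d_def damp_def)
    show "multipliers_commute E G \<alpha> (\<lambda>v. d v n)" for n
      unfolding multipliers_commute_def
    proof clarify
      fix v w a b assume e: "(v, w) \<in> E" and ab: "a \<in> carrier (G v)" "b \<in> carrier (G w)"
      note vw = A.edge_facts[OF e]
      have "\<alpha> v a (h w n b) = h w n b" "\<alpha> w b (h v n a) = h v n a"
        using assms(9)[of n] e ab unfolding multipliers_commute_def by blast+
      then show "\<alpha> v a (d w n b) = d w n b \<and> \<alpha> w b (d v n a) = d v n a"
        using ab by (simp add: d_def damp_def star_automorphism_simps[OF A.vertex_action(1)[OF vw(1)]]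
            star_automorphism_simps[OF A.vertex_action(1)[OF vw(2)]] A.vertex_action(3)[OF vw(1)] A.vertex_action(3)[OF vw(2)])
    qed
  qed
  have norm_d: "norm (d v n g) \<le> r v n" "norm (d v n g) \<le> norm (h v n g)"
    if "v \<in> V" "g \<in> carrier (G v)" "g \<noteq> \<one>\<^bsub>G v\<^esub>" for v n g
    using that H.norm_multiplier_le_one[OF that(1,2), of n] r[of v n]
    by (simp_all add: d_def damp_def mult_left_le mult_left_le_one_le)
  have decay: "D.total_multiplier n \<in> C0 (graph_product V E G)" for n
  proof (rule D.total_multiplier_C0[OF countable, where q = "exp (- 1 / (real n + 1))"])
    show "norm (d v n g) \<le> exp (- 1 / (real n + 1))"
      if "v \<in> V" "g \<in> carrier (G v)" "g \<noteq> \<one>\<^bsub>G v\<^esub>" for v g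
      by (rule order_trans[OF norm_d(1)[OF that] r(3)])
    fix \<epsilon> :: real assume \<epsilon>: "0 < \<epsilon>"
    obtain K :: nat where K: "- ln \<epsilon> * (real n + 1) < real K" using reals_Archimedean2 by blast
    let ?B = "{v \<in> A.nontrivial_vertices. ?c v < K}"
    have "finite (?c -` {..<K} \<inter> A.nontrivial_vertices)"
      by (rule finite_vimage_IntI[OF _ inj_on_to_nat_on[OF countable]]) simp
    then have B: "finite ?B" by (rule rev_finite_subset) auto
    have fin: "finite {g \<in> carrier (G v). \<epsilon> \<le> norm (h v n g)}" if v: "v \<in> V" for v
    proof -
      obtain F where F: "finite F" "\<forall>s\<in>carrier (G v) - F. norm (h v n s) < \<epsilon>"
        using c0[OF v, of n] \<epsilon> unfolding C0_def by blast
      have "g \<in> F" if g: "g \<in> carrier (G v)" "\<epsilon> \<le> norm (h v n g)" for g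
      proof (rule ccontr)
        assume "g \<notin> F"
        with F(2) g(1) have "norm (h v n g) < \<epsilon>" by blast
        with g(2) show False by simp
      qed
      then have "{g \<in> carrier (G v). \<epsilon> \<le> norm (h v n g)} \<subseteq> F" by blast
      then show ?thesis using F(1) by (rule finite_subset)
    qed
    have "finite (Sigma ?B (\<lambda>v. {g \<in> carrier (G v). \<epsilon> \<le> norm (h v n g)}))"
      using B fin by (intro finite_SigmaI) (auto simp: A.nontrivial_vertices_def)
    then show "finite {(v, g). v \<in> A.nontrivial_vertices \<and> g \<in> carrier (G v) \<and> g \<noteq> \<one>\<^bsub>G v\<^esub> \<and> \<epsilon> \<le> norm (d v n g)}"
    proof (rule rev_finite_subset, clarify)
      fix v g assume v: "v \<in> A.nontrivial_vertices" and g: "g \<in> carrier (G v)" "g \<noteq> \<one>\<^bsub>G v\<^esub>" "\<epsilon> \<le> norm (d v n g)"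
      have V: "v \<in> V" using v by (simp add: A.nontrivial_vertices_def)
      have "\<epsilon> \<le> r v n" using norm_d(1)[OF V g(1,2), of n] g(3) by linarith
      with \<epsilon> have "ln \<epsilon> \<le> ln (r v n)" by (intro ln_mono) simp_all
      also have "\<dots> = - (real (?c v) + 1) / (real n + 1)" by (simp add: r_def)
      finally have "ln \<epsilon> * (real n + 1) \<le> - (real (?c v) + 1)" by (simp add: pos_le_divide_eq)
      then have "real (?c v) + 1 \<le> - ln \<epsilon> * (real n + 1)" by simp
      then have "?c v < K" using K by linarith
      moreover have "\<epsilon> \<le> norm (h v n g)" using norm_d(2)[OF V g(1,2), of n] g(3) by linarith
      ultimately show "v \<in> ?B \<and> g \<in> {g \<in> carrier (G v). \<epsilon> \<le> norm (h v n g)}" using v g by blast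
    qed
  qed simp_all
  have limit: "(\<lambda>n. norm (D.total_multiplier n s - 1)) \<longlonglongrightarrow> 0" if "s \<in> carrier (graph_product V E G)" for s
  proof (rule D.total_multiplier_tendsto_one[OF _ that])
    fix v g assume vg: "v \<in> V" "g \<in> carrier (G v)"
    have "(\<lambda>n. norm (h v n g - 1)) \<longlonglongrightarrow> 0" using assms(7)[OF vg(1)] vg(2) by (simp add: haagerup_witness_def)
    then have h: "(\<lambda>n. h v n g) \<longlonglongrightarrow> 1" by (simp add: tendsto_norm_zero_iff LIM_zero_iff)
    have "(\<lambda>n. exp (- (real (?c v) + 1) * inverse (real (Suc n)))) \<longlonglongrightarrow> exp 0"
      by (intro tendsto_exp tendsto_mult_right_zero LIMSEQ_inverse_real_of_nat)
    then have "(\<lambda>n. r v n) \<longlonglongrightarrow> 1" by (simp add: r_def divide_inverse add.commute)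
    from tendsto_scaleR[OF this h] show "(\<lambda>n. d v n g) \<longlonglongrightarrow> 1"
      by (cases "g = \<one>\<^bsub>G v\<^esub>") (simp_all add: d_def damp_def)
  qed
  have "haagerup_witness (graph_product V E G) (graph_product_action V E G \<alpha>) D.total_multiplier"
    unfolding haagerup_witness_def
    by (intro conjI allI ballI D.positive_definite_total_multiplier decay limit)
  then have "\<exists>m. haagerup_witness (graph_product V E G) (graph_product_action V E G \<alpha>) m"
    by (rule exI[of _ D.total_multiplier])
  then show ?thesis
    by (simp only: haagerup_property_def cstar_action_def A.group_graph_product A.act_hom simp_thms)
qed

end
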